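(* There is a universal constant $C$ such that the following holds. Let $A\in\mathbb{R}^{m\times n}$ have rank $r$ and SVD $A=U\Sigma V^T=\sum_{i=1}^r\sigma_iu_iv_i^T$, let $E\in\mathbb{R}^{m\times n}$ be nonzero, and let $\tilde A=A+E$ (notation as in the context). Define $$\tau_1:=\max_{0\le a\le 10\log(m+n)}\frac1{\sqrt r}\max\left\{\frac{\|(EE^T)^aU\|_{2,\infty}}{\|E\|^{2a}},\ \frac{\|(EE^T)^aEV\|_{2,\infty}}{\|E\|^{2a+1}}\right\},$$ $$\tau_2:=\max_{0\le a\le 10\log(m+n)}\frac1{\sqrt r}\max\left\{\frac{\|(E^TE)^aV\|_{2,\infty}}{\|E\|^{2a}},\ \frac{\|(E^TE)^aE^TU\|_{2,\infty}}{\|E\|^{2a+1}}\right\},$$ where $a$ ranges over integers, and $$y:=\tfrac12\max_{i\ne j}\left(|u_i^TEE^Tu_j|+|v_i^TE^TEv_j|\right).$$ Let $S\subset[r]$ be an arbitrary nonempty subset satisfying $$\max\left\{\frac{\|E\|}{\sigma_S},\ \frac{2r\|U^TEV\|_\infty}{\Delta_S},\ \frac{\sqrt{2r}\,\|E\|}{\sqrt{\Delta_S\sigma_S}}\right\}\le\frac18 .$$ Then $$\|\tilde V_S\tilde V_S^T-V_SV_S^T\|_\infty\le C\tau_2^2\, r\left(\frac{\|E\|}{\sigma_S}+\frac{2r\|U^TEV\|_\infty}{\Delta_S}+\frac{2ry}{\Delta_S\sigma_S}\right),$$ $$\|\tilde V_S\tilde V_S^T-V_SV_S^T\|_{2,\infty}\le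 C\tau_2\, r\left(\frac{\|E\|}{\sigma_S}+\frac{2r\|U^TEV\|_\infty}{\Delta_S}+\frac{2ry}{\Delta_S\sigma_S}\right).$$ Moreover, when $S=[s]$ for some $s\in[r]$, with $\delta_s=\sigma_s-\sigma_{s+1}$, $$\|\tilde A_s-A_s\|_\infty\le C\tau_1\tau_2\,\sigma_s r\left(\frac{\|E\|}{\sigma_s}+\frac{2r\|U^TEV\|_\infty}{\delta_s}+\frac{2ry}{\delta_s\sigma_s}\right).$$
   Context: The singular values of $A$ are $\sigma_1\ge\dots\ge\sigma_r>0$, with the convention $\sigma_{r+1}=0$; $U=[u_1,\dots,u_r]$, $V=[v_1,\dots,v_r]$. The SVD of $\tilde A$ is $\tilde A=\sum_{i=1}^{\min\{m,n\}}\tilde\sigma_i\tilde u_i\tilde v_i^T$ with $\tilde\sigma_1\ge\tilde\sigma_2\ge\cdots$. For $S\subset[r]$: $\sigma_S=\min\{\sigma_i:i\in S\}$; $\Delta_S=\min\{|\sigma_i-\sigma_j|: i\in S,\ j\in[r+1]\setminus S\}$; $V_S=[v_i]_{i\in S}$, $\tilde V_S=[\tilde v_i]_{i\in S}$. For $s\in[r]$: $A_s=\sum_{i\le s}\sigma_iu_iv_i^T$, $\tilde A_s=\sum_{i\le s}\tilde\sigma_i\tilde u_i\tilde v_i^T$. $\|\cdot\|$ is the operator (spectral) norm, $\|\cdot\|_\infty$ the largest absolute value of an entry, and $\|\cdot\|_{2,\infty}$ the largest Euclidean norm of a row. *)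

theory Defs
  imports
    Complex_Main
    "Jordan_Normal_Form.Matrix"
    "Jordan_Normal_Form.DL_Rank"
    "Jordan_Normal_Form.DL_Submatrix"
begin

text \<open>
  Matrices are the dimension-carrying matrices of Jordan\_Normal\_Form, so that constants can be
  quantified before the dimensions. Rows, columns and singular values are indexed from 0:
  the paper's \<open>\<sigma>\<^sub>i, u\<^sub>i, v\<^sub>i\<close> with \<open>1 \<le> i \<le> r\<close> are \<open>\<sigma> (i - 1)\<close>, \<open>col U (i - 1)\<close>,
  \<open>col V (i - 1)\<close>; the set \<open>[s]\<close> is \<open>{..<s}\<close>; and \<open>\<sigma>\<^sub>r\<^sub>+\<^sub>1\<close> is \<open>\<sigma> r\<close>.
\<close>

definition vec_norm2 :: "real vec \<Rightarrow> real" where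
  "vec_norm2 x = sqrt (x \<bullet> x)"

definition spectral_norm :: "real mat \<Rightarrow> real" where
  "spectral_norm M =
     Sup {vec_norm2 (M *\<^sub>v x) | x. x \<in> carrier_vec (dim_col M) \<and> vec_norm2 x \<le> 1}"

text \<open>The next two norms are meaningful only for matrices with at least one entry
  (at least one row, respectively).\<close>

definition max_norm :: "real mat \<Rightarrow> real" where
  "max_norm M = Max (abs ` elements_mat M)"

definition two_inf_norm :: "real mat \<Rightarrow> real" where
  "two_inf_norm M = Max ((\<lambda>i. vec_norm2 (row M i)) ` {..<dim_row M})"

text \<open>\<open>\<Sum>i<k. \<sigma> i \<cdot> u\<^sub>i v\<^sub>i\<^sup>T\<close>, where \<open>u\<^sub>i\<close> and \<open>v\<^sub>i\<close> are the columns of \<open>U\<close> and \<open>V\<close>.\<close>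

definition rank_one_sum :: "nat \<Rightarrow> real mat \<Rightarrow> (nat \<Rightarrow> real) \<Rightarrow> real mat \<Rightarrow> real mat" where
  "rank_one_sum k U \<sigma> V =
     mat (dim_row U) (dim_row V) (\<lambda>(a, b). \<Sum>i<k. \<sigma> i * U $$ (a, i) * V $$ (b, i))"

text \<open>A singular value decomposition with \<open>k\<close> terms. Zero singular values are allowed, so that
  this covers the compact decomposition (\<open>k\<close> the rank) as well as the one with
  \<open>k = min m n\<close> terms.\<close>

definition is_svd :: "real mat \<Rightarrow> nat \<Rightarrow> real mat \<Rightarrow> (nat \<Rightarrow> real) \<Rightarrow> real mat \<Rightarrow> bool" where
  "is_svd M k U \<sigma> V \<longleftrightarrow>
     U \<in> carrier_mat (dim_row M) k \<and> V \<in> carrier_mat (dim_col M) k \<and>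
     transpose_mat U * U = 1\<^sub>m k \<and> transpose_mat V * V = 1\<^sub>m k \<and>
     (\<forall>i<k. 0 \<le> \<sigma> i) \<and> (\<forall>i j. i \<le> j \<and> j < k \<longrightarrow> \<sigma> j \<le> \<sigma> i) \<and>
     M = rank_one_sum k U \<sigma> V"

definition select_cols :: "real mat \<Rightarrow> nat set \<Rightarrow> real mat" where
  "select_cols V S = submatrix V UNIV S"

definition sigma_S :: "(nat \<Rightarrow> real) \<Rightarrow> nat set \<Rightarrow> real" where
  "sigma_S \<sigma> S = Min (\<sigma> ` S)"

text \<open>The index \<open>j\<close> also takes the value \<open>r\<close>, where \<open>\<sigma> r = 0\<close> by convention.\<close>

definition Delta_S :: "nat \<Rightarrow> (nat \<Rightarrow> real) \<Rightarrow> nat set \<Rightarrow> real" where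
  "Delta_S r \<sigma> S = Min {\<bar>\<sigma> i - \<sigma> j\<bar> | i j. i \<in> S \<and> j \<in> {..r} - S}"

text \<open>In the next definitions the rank \<open>r\<close> is the number of columns of \<open>U\<close> and of \<open>V\<close>,
  and \<open>m + n\<close> is \<open>dim_row E + dim_col E\<close>.\<close>

definition tau_range :: "real mat \<Rightarrow> nat set" where
  "tau_range E = {a. real a \<le> 10 * ln (real (dim_row E + dim_col E))}"

definition tau1 :: "real mat \<Rightarrow> real mat \<Rightarrow> real mat \<Rightarrow> real" where
  "tau1 E U V = Max ((\<lambda>a. 1 / sqrt (real (dim_col U)) *
     max (two_inf_norm ((E * transpose_mat E) ^\<^sub>m a * U) / spectral_norm E ^ (2 * a))
         (two_inf_norm ((E * transpose_mat E) ^\<^sub>m a * E * V) / spectral_norm E ^ (2 * a + 1)))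
     ` tau_range E)"

definition tau2 :: "real mat \<Rightarrow> real mat \<Rightarrow> real mat \<Rightarrow> real" where
  "tau2 E U V = Max ((\<lambda>a. 1 / sqrt (real (dim_col V)) *
     max (two_inf_norm ((transpose_mat E * E) ^\<^sub>m a * V) / spectral_norm E ^ (2 * a))
         (two_inf_norm ((transpose_mat E * E) ^\<^sub>m a * transpose_mat E * U)
            / spectral_norm E ^ (2 * a + 1)))
     ` tau_range E)"

text \<open>Inserting 0 only matters for \<open>r = 1\<close>, where there is no pair \<open>i \<noteq> j\<close>: the maximum of
  nonnegative numbers over the empty set is read as 0.\<close>

definition y_param :: "real mat \<Rightarrow> real mat \<Rightarrow> real mat \<Rightarrow> real" where
  "y_param E U V = 1 / 2 * Max (insert 0
     {\<bar>col U i \<bullet> ((E * transpose_mat E) *\<^sub>v col U j)\<bar> +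
      \<bar>col V i \<bullet> ((transpose_mat E * E) *\<^sub>v col V j)\<bar>
      | i j. i < dim_col U \<and> j < dim_col U \<and> i \<noteq> j})"

end

theory Submission
  imports Defs "HOL-Analysis.Euclidean_Space"
begin

text \<open>
  The Hermitian dilations \<open>H\<close>, \<open>W\<close> of \<open>A\<close>, \<open>E\<close> turn singular vectors into eigenvectors. No contour
  integrals are needed: an eigenvector \<open>x\<close> of \<open>H + W\<close> with a large eigenvalue \<open>\<nu>\<close> satisfies
  \<open>x = (\<nu> - W)\<^sup>-\<^sup>1 H x\<close>, and expanding the inverse into a Neumann series expresses the coordinates
  of \<open>x\<close> through the vectors \<open>W\<^sup>k p\<close> with \<open>p\<close> a singular direction of \<open>A\<close>, whose coordinates are what
  \<open>\<tau>\<^sub>1\<close> and \<open>\<tau>\<^sub>2\<close> control. Up to a relative error of order \<open>\<parallel>E\<parallel> / \<sigma>\<^sub>S\<close> this reduces every entry to the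
  compression of the perturbed spectral projection to the \<open>2r\<close>-dimensional range of \<open>H\<close>.

  There the overlap of the perturbed eigenvectors with the unselected eigenspaces is bounded in the
  Frobenius norm by a Sylvester equation with gap \<open>\<Delta>\<^sub>S\<close>. Its right-hand side is \<open>U\<^sup>TEV\<close> to first
  order and the off-diagonal part of the compressed \<open>W\<^sup>2\<close> (hence \<open>y\<close>) to second order; the diagonal of
  \<open>W\<^sup>2\<close> only shifts eigenvalues and is absorbed into the gap. The gap itself survives the
  perturbation by a Courant--Fischer argument, and since the selected and the perturbed eigenspaces
  have equal dimension, the small overlap makes the compressed projections close.
\<close>

section \<open>Sums over finite sets\<close>

text \<open>The largest singular value of \<open>A\<close> occurs nowhere in the bounds, so no step
  may use the norm of \<open>H\<close>. A second obstacle: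
  \<open>e\<^sup>2 / (\<Delta> * \<sigma>S)\<close> is assumed to be small, but it is not dominated
  by the error to be proved. It may be spent on keeping the gap open, yet must not survive as an
  error term, which rules out a direct use of Weyl or Davis-Kahan bounds. Hence all second-order
  terms are taken apart. What is neither absorbed into the gap nor measured by \<open>y\<close>
  carries a factor \<xi> or is of third order, and in the latter case one factor
  \<open>e / \<sigma>S\<close> is split off while the hypothesis pays for the rest.

  The logarithmic range of \<open>a\<close> suffices for the Neumann series because orthonormality
  of the columns of \<open>U\<close> and \<open>V\<close> forces \<open>sqrt r * tau1\<close> and
  \<open>sqrt r * tau2\<close> to be at least \<open>1 / sqrt (m + n)\<close>, while every further
  term of the series gains a factor of at most 1/7.\<close>

lemma underdetermined_system_nontrivial:
  fixes a :: "'i \<Rightarrow> 'j \<Rightarrow> real"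
  assumes "finite B" "finite A" "card B < card A"
  shows "\<exists>c. (\<exists>k\<in>A. c k \<noteq> 0) \<and> (\<forall>l\<in>B. (\<Sum>k\<in>A. c k * a k l) = 0)"
  using assms
proof (induction B arbitrary: A a rule: finite_induct)
  case empty
  then have "A \<noteq> {}" by auto
  then show ?case by (intro exI[of _ "\<lambda>_. 1"]) auto
next
  case (insert b B)
  show ?case
  proof (cases "\<forall>k\<in>A. a k b = 0")
    case True
    have "card B < card A" using insert.prems insert.hyps by simp
    from insert.IH[OF insert.prems(1) this, of a] True show ?thesis by auto
  next
    case False
    then obtain k0 where k0: "k0 \<in> A" "a k0 b \<noteq> 0" by auto
    \<comment> \<open>Gaussian elimination: equation \<open>b\<close> is solved for the unknown
      \<open>k0\<close>, and \<open>a'\<close> holds the coefficients of the other unknowns after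
      substitution. The value \<open>z\<close> below restores \<open>k0\<close>.\<close>
    define a' where "a' k l = a k l - a k b / a k0 b * a k0 l" for k l
    have "finite (A - {k0})" "card B < card (A - {k0})"
      using insert.prems insert.hyps k0 by (auto simp: card_Diff_singleton)
    from insert.IH[OF this, of a'] obtain c where
      c: "\<exists>k\<in>A - {k0}. c k \<noteq> 0" "\<forall>l\<in>B. (\<Sum>k\<in>A - {k0}. c k * a' k l) = 0" by auto
    define z where "z = - (\<Sum>k\<in>A - {k0}. c k * a k b) / a k0 b"
    define c' where "c' = c(k0 := z)"
    have split: "(\<Sum>k\<in>A. c' k * a k l) = z * a k0 l + (\<Sum>k\<in>A - {k0}. c k * a k l)" for l
      using insert.prems(1) k0(1) by (subst sum.remove[of _ k0]) (auto simp: c'_def)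
    have "(\<Sum>k\<in>A. c' k * a k l) = (\<Sum>k\<in>A - {k0}. c k * a' k l)" for l
    proof -
      have "(\<Sum>k\<in>A - {k0}. c k * a' k l)
          = (\<Sum>k\<in>A - {k0}. c k * a k l) - (\<Sum>k\<in>A - {k0}. c k * a k b * (a k0 l / a k0 b))"
        unfolding sum_subtractf[symmetric] a'_def by (intro sum.cong) (simp_all add: algebra_simps)
      also have "\<dots> = (\<Sum>k\<in>A. c' k * a k l)"
        unfolding split z_def sum_distrib_right[symmetric] by simp
      finally show ?thesis ..
    qed
    moreover have "(\<Sum>k\<in>A. c' k * a k b) = 0"
      unfolding split z_def using k0 by simp
    moreover have "\<exists>k\<in>A. c' k \<noteq> 0" using c(1) by (auto simp: c'_def)
    ultimately show ?thesis using c(2) by (intro exI[of _ c']) auto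
  qed
qed

lemma L2_set_mult_le:
  assumes "\<And>i. i \<in> A \<Longrightarrow> \<bar>c i\<bar> \<le> b" "0 \<le> b"
  shows "L2_set (\<lambda>i. c i * f i) A \<le> b * L2_set f A"
proof -
  have "L2_set (\<lambda>i. c i * f i) A = L2_set (\<lambda>i. \<bar>c i * f i\<bar>) A" by (simp add: L2_set_def)
  also have "\<dots> \<le> L2_set (\<lambda>i. b * \<bar>f i\<bar>) A"
    using assms by (intro L2_set_mono) (auto simp: abs_mult mult_right_mono)
  also have "\<dots> = b * L2_set (\<lambda>i. \<bar>f i\<bar>) A" using assms(2) by (simp add: L2_set_right_distrib)
  finally show ?thesis by (simp add: L2_set_def)
qed

lemma L2_set_uminus: "L2_set (\<lambda>i. - f i) A = L2_set f A"
  by (simp add: L2_set_def)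

lemma L2_set_bounded:
  assumes "\<And>i. i \<in> A \<Longrightarrow> \<bar>f i\<bar> \<le> b"
  shows "L2_set f A \<le> sqrt (card A) * b"
proof (cases "A = {}")
  case False
  then have "0 \<le> b" using assms by fastforce
  have "L2_set f A = L2_set (\<lambda>i. \<bar>f i\<bar>) A" by (simp add: L2_set_def)
  also have "\<dots> \<le> L2_set (\<lambda>_. b) A" using assms by (intro L2_set_mono) auto
  finally show ?thesis using \<open>0 \<le> b\<close> by (simp add: L2_set_constant)
qed simp

lemma abs_sum_le_L2: "\<bar>\<Sum>i\<in>A. f i * g i\<bar> \<le> L2_set f A * L2_set g A"
  by (rule order_trans[OF sum_abs]) (simp add: abs_mult L2_set_mult_ineq)

section \<open>Orthonormal families\<close>

definition orthonormal_on :: "'i set \<Rightarrow> ('i \<Rightarrow> 'h::real_inner) \<Rightarrow> bool" where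
  "orthonormal_on A x \<longleftrightarrow> finite A \<and> (\<forall>i\<in>A. \<forall>j\<in>A. inner (x i) (x j) = (if i = j then 1 else 0))"

lemma orthonormal_on_subset: "orthonormal_on A x \<Longrightarrow> B \<subseteq> A \<Longrightarrow> orthonormal_on B x"
  unfolding orthonormal_on_def by (meson finite_subset subsetD)

lemma orthonormal_on_finite: "orthonormal_on A x \<Longrightarrow> finite A"
  by (simp add: orthonormal_on_def)

context
  fixes A :: "'i set" and x :: "'i \<Rightarrow> 'h::real_inner"
  assumes on: "orthonormal_on A x"
begin

lemma orthonormal_inner_sum: "k \<in> A \<Longrightarrow> inner (x k) (\<Sum>i\<in>A. c i *\<^sub>R x i) = c k"
proof -
  assume k: "k \<in> A"
  have "inner (x k) (\<Sum>i\<in>A. c i *\<^sub>R x i) = (\<Sum>i\<in>A. if i = k then c i else 0)"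
    unfolding inner_sum_right using on k
    by (intro sum.cong) (auto simp: orthonormal_on_def)
  with k orthonormal_on_finite[OF on] show ?thesis by simp
qed

lemma orthonormal_sum_inner_sum:
  "inner (\<Sum>i\<in>A. c i *\<^sub>R x i) (\<Sum>i\<in>A. d i *\<^sub>R x i) = (\<Sum>i\<in>A. c i * d i)"
  by (simp add: inner_sum_left orthonormal_inner_sum)

lemma orthonormal_norm_sum: "norm (\<Sum>i\<in>A. c i *\<^sub>R x i) = L2_set c A"
  by (simp add: norm_eq_sqrt_inner orthonormal_sum_inner_sum L2_set_def power2_eq_square)

lemma orthonormal_norm: "k \<in> A \<Longrightarrow> norm (x k) = 1"
  using on by (simp add: norm_eq_sqrt_inner orthonormal_on_def)

end

definition proj :: "'i set \<Rightarrow> ('i \<Rightarrow> 'h) \<Rightarrow> 'h \<Rightarrow> 'h::real_inner" where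
  "proj A x v = (\<Sum>i\<in>A. inner (x i) v *\<^sub>R x i)"

lemma proj_add: "proj A x (u + v) = proj A x u + proj A x v"
  and proj_diff: "proj A x (u - v) = proj A x u - proj A x v"
  and proj_scaleR: "proj A x (c *\<^sub>R v) = c *\<^sub>R proj A x v"
  by (simp_all add: proj_def inner_add inner_diff scaleR_add_left scaleR_diff_left
      sum.distrib sum_subtractf scaleR_sum_right)

lemma inner_proj_commute: "inner (proj A x u) v = inner u (proj A x v)"
  by (simp add: proj_def inner_sum_left inner_sum_right inner_commute mult.commute)

lemma inner_proj_sum: "inner u (proj A x v) = (\<Sum>i\<in>A. inner (x i) u * inner (x i) v)"
  by (simp add: proj_def inner_sum_right inner_commute mult.commute)

lemma proj_Un:
  "finite A \<Longrightarrow> finite B \<Longrightarrow> A \<inter> B = {} \<Longrightarrow> proj (A \<union> B) x v = proj A x v + proj B x v"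
  by (simp add: proj_def sum.union_disjoint)

context
  fixes A :: "'i set" and x :: "'i \<Rightarrow> 'h::real_inner"
  assumes on: "orthonormal_on A x"
begin

lemma norm_proj: "norm (proj A x v) = L2_set (\<lambda>i. inner (x i) v) A"
  by (simp add: proj_def orthonormal_norm_sum[OF on])

lemma inner_proj_member: "k \<in> A \<Longrightarrow> inner (x k) (proj A x v) = inner (x k) v"
  by (simp add: proj_def orthonormal_inner_sum[OF on])

lemma proj_sum_self: "proj A x (\<Sum>i\<in>A. c i *\<^sub>R x i) = (\<Sum>i\<in>A. c i *\<^sub>R x i)"
  unfolding proj_def[of A x] by (simp add: orthonormal_inner_sum[OF on])

lemma proj_idem: "proj A x (proj A x v) = proj A x v"
  using proj_sum_self[of "\<lambda>i. inner (x i) v"] by (simp add: proj_def)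

lemma inner_proj_proj: "inner (proj A x u) (proj A x v) = inner u (proj A x v)"
  by (simp add: inner_proj_commute proj_idem)

lemma norm_proj_pythagoras: "(norm v)\<^sup>2 = (norm (proj A x v))\<^sup>2 + (norm (v - proj A x v))\<^sup>2"
proof -
  have "inner v (proj A x v) = inner (proj A x v) (proj A x v)" by (simp add: inner_proj_proj)
  moreover have "inner (proj A x v) v = inner (proj A x v) (proj A x v)"
    by (simp add: inner_proj_commute proj_idem)
  ultimately show ?thesis by (simp add: power2_norm_eq_inner inner_diff)
qed

lemma norm_proj_le: "norm (proj A x v) \<le> norm v"
  by (rule power2_le_imp_le) (simp_all add: norm_proj_pythagoras[of v])

lemma norm_minus_proj_le: "norm (v - proj A x v) \<le> norm v"
  by (rule power2_le_imp_le) (simp_all add: norm_proj_pythagoras[of v])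

lemma bessel: "L2_set (\<lambda>i. inner (x i) v) A \<le> norm v"
  using norm_proj_le[of v] by (simp add: norm_proj)

lemma bessel': "L2_set (\<lambda>i. inner v (x i)) A \<le> norm v"
  using bessel[of v] by (simp add: inner_commute)

text \<open>A Frobenius norm taken row by row with Bessel's inequality, so that only the size of
  \<open>B\<close> costs a factor and the size of \<open>A\<close> does not.\<close>

lemma L2_set_prod_inner_le:
  assumes "finite B" "\<And>j. j \<in> B \<Longrightarrow> norm (b j) \<le> M"
  shows "L2_set (\<lambda>(j, i). inner (b j) (x i)) (B \<times> A) \<le> sqrt (card B) * M"
proof -
  have "L2_set (\<lambda>(j, i). inner (b j) (x i)) (B \<times> A)
      = L2_set (\<lambda>j. L2_set (\<lambda>i. inner (b j) (x i)) A) B"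
    by (simp add: L2_set_def sum_nonneg sum.cartesian_product case_prod_beta)
  also have "\<dots> \<le> sqrt (card B) * M"
    by (intro L2_set_bounded) (simp add: order_trans[OF bessel' assms(2)])
  finally show ?thesis .
qed

end

section \<open>Two spectral decompositions of operators differing by a small one\<close>

text \<open>Neither family has to be complete: directions outside the span of \<open>p\<close> or of
  \<open>x\<close> belong to the eigenvalue 0. The compression of \<open>W\<close> gets its own
  entrywise bound \<xi> because it can be far smaller than the norm bound \<open>e\<close>.\<close>

locale spectral_pair =
  fixes J L :: "'i set" and p x :: "'i \<Rightarrow> 'h::real_inner" and \<mu> \<nu> :: "'i \<Rightarrow> real"
    and W :: "'h \<Rightarrow> 'h" and e \<xi> :: real
  assumes on_p: "orthonormal_on J p" and on_x: "orthonormal_on L x"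
    and spec: "(\<Sum>j\<in>J. (\<mu> j * inner (p j) v) *\<^sub>R p j) + W v
        = (\<Sum>l\<in>L. (\<nu> l * inner (x l) v) *\<^sub>R x l)"
    and linear_W: "linear W"
    and W_sym: "inner (W u) v = inner u (W v)"
    and W_bound: "norm (W v) \<le> e * norm v"
    and e_nonneg: "0 \<le> e"
    and \<xi>_bound: "j \<in> J \<Longrightarrow> k \<in> J \<Longrightarrow> \<bar>inner (p j) (W (p k))\<bar> \<le> \<xi>"
begin

definition H :: "'h \<Rightarrow> 'h" where
  "H v = (\<Sum>j\<in>J. (\<mu> j * inner (p j) v) *\<^sub>R p j)"

definition Ht :: "'h \<Rightarrow> 'h" where
  "Ht v = (\<Sum>l\<in>L. (\<nu> l * inner (x l) v) *\<^sub>R x l)"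

abbreviation Pi :: "'h \<Rightarrow> 'h" where "Pi \<equiv> proj J p"

abbreviation d :: real where "d \<equiv> real (card J)"

lemmas W_add = linear_add[OF linear_W]
lemmas W_diff = linear_diff[OF linear_W]
lemmas W_scaleR = linear_scale[OF linear_W]
lemmas W_sum = linear_sum[OF linear_W]

lemma fin_J: "finite J" and fin_L: "finite L"
  using on_p on_x by (auto dest: orthonormal_on_finite)

lemma inner_p_p: "j \<in> J \<Longrightarrow> k \<in> J \<Longrightarrow> j \<noteq> k \<Longrightarrow> inner (p j) (p k) = 0"
  and inner_x_x: "l \<in> L \<Longrightarrow> k \<in> L \<Longrightarrow> l \<noteq> k \<Longrightarrow> inner (x l) (x k) = 0"
  using on_p on_x by (auto simp: orthonormal_on_def)

lemma Ht_eq: "Ht v = H v + W v"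
  by (simp add: Ht_def H_def spec)

lemma H_add: "H (u + v) = H u + H v"
  by (simp add: H_def inner_add ring_distribs scaleR_add_left sum.distrib)

lemma inner_H: "inner u (H v) = (\<Sum>j\<in>J. \<mu> j * inner (p j) u * inner (p j) v)"
  by (simp add: H_def inner_sum_right inner_commute[of u] mult_ac)

lemma inner_Ht: "inner u (Ht v) = (\<Sum>l\<in>L. \<nu> l * inner (x l) u * inner (x l) v)"
  by (simp add: Ht_def inner_sum_right inner_commute[of u] mult_ac)

lemma H_sym: "inner (H u) v = inner u (H v)"
  by (subst inner_commute) (simp add: inner_H mult_ac)

lemma inner_p_H: "j \<in> J \<Longrightarrow> inner (p j) (H v) = \<mu> j * inner (p j) v"
  unfolding H_def by (rule orthonormal_inner_sum[OF on_p])

lemma Pi_H: "Pi (H v) = H v"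
  unfolding H_def by (rule proj_sum_self[OF on_p])

lemma Ht_x: "l \<in> L \<Longrightarrow> Ht (x l) = \<nu> l *\<^sub>R x l"
proof -
  assume l: "l \<in> L"
  have "Ht (x l) = (\<Sum>k\<in>L. if k = l then \<nu> l *\<^sub>R x l else 0)"
    unfolding Ht_def using on_x l by (intro sum.cong) (auto simp: orthonormal_on_def)
  with l fin_L show ?thesis by simp
qed

lemma \<xi>_nonneg: "j \<in> J \<Longrightarrow> 0 \<le> \<xi>"
  using \<xi>_bound[of j j] by (meson abs_ge_zero order_trans)

lemma norm_Pi_W_p: "j \<in> J \<Longrightarrow> norm (Pi (W (p j))) \<le> sqrt d * \<xi>"
  by (simp add: norm_proj[OF on_p] L2_set_bounded \<xi>_bound)

text \<open>A square matrix of size \<open>d\<close> with entries at most \<xi> has operator norm at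
  most \<open>d * \<xi>\<close>. With \<open>d = 2r\<close> this is the source of the factor
  \<open>2r\<close> in front of the entrywise norm.\<close>

lemma norm_Pi_W_Pi: "norm (Pi (W (Pi v))) \<le> d * \<xi> * norm (Pi v)"
proof -
  have "\<bar>inner (p j) (W (Pi v))\<bar> \<le> sqrt d * \<xi> * norm (Pi v)" if j: "j \<in> J" for j
  proof -
    have "inner (p j) (W (Pi v)) = inner (Pi (W (p j))) (Pi v)"
      by (simp add: W_sym[symmetric] proj_idem[OF on_p] inner_proj_commute)
    also have "\<bar>\<dots>\<bar> \<le> norm (Pi (W (p j))) * norm (Pi v)" by (rule Cauchy_Schwarz_ineq2)
    also have "\<dots> \<le> sqrt d * \<xi> * norm (Pi v)"
      by (intro mult_right_mono norm_Pi_W_p j) auto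
    finally show ?thesis .
  qed
  then have "norm (Pi (W (Pi v))) \<le> sqrt d * (sqrt d * \<xi> * norm (Pi v))"
    by (simp add: norm_proj[OF on_p, of "W _"] L2_set_bounded)
  then show ?thesis by (simp add: mult.assoc[symmetric])
qed

lemma quadratic_W_bound: "\<bar>inner (Pi v) (W (Pi v))\<bar> \<le> d * \<xi> * (norm (Pi v))\<^sup>2"
proof -
  have "inner (Pi v) (W (Pi v)) = inner (Pi v) (Pi (W (Pi v)))"
    by (simp add: inner_proj_commute proj_idem[OF on_p])
  also have "\<bar>\<dots>\<bar> \<le> norm (Pi v) * norm (Pi (W (Pi v)))" by (rule Cauchy_Schwarz_ineq2)
  also have "\<dots> \<le> norm (Pi v) * (d * \<xi> * norm (Pi v))"
    by (intro mult_left_mono norm_Pi_W_Pi) auto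
  finally show ?thesis by (simp add: power2_eq_square mult_ac)
qed

text \<open>Courant--Fischer comparison: a dimension count gives a nonzero vector in one spectral
  subspace that is orthogonal to the other one. Compared with Weyl's inequality, the error is of
  first order only in the compression of \<open>W\<close> to the range of \<open>Pi\<close>.\<close>

lemma eigenvalue_lower_bound:
  assumes A: "A \<subseteq> J" and B: "B \<subseteq> L" and card: "card B < card A"
    and m0: "\<And>j. j \<in> A \<Longrightarrow> m0 \<le> \<mu> j" and b: "\<And>l. l \<in> L - B \<Longrightarrow> \<nu> l \<le> b" "0 \<le> b"
  shows "m0 - d * \<xi> \<le> b"
proof -
  have fin: "finite A" "finite B" using A B fin_J fin_L finite_subset by auto
  obtain c where c: "\<exists>k\<in>A. c k \<noteq> 0" "\<forall>l\<in>B. (\<Sum>k\<in>A. c k * inner (x l) (p k)) = 0"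
    using underdetermined_system_nontrivial[OF fin(2,1) card, of "\<lambda>k l. inner (x l) (p k)"] by auto
  define c' where "c' k = (if k \<in> A then c k else 0)" for k
  define v where "v = (\<Sum>k\<in>J. c' k *\<^sub>R p k)"
  have v_A: "v = (\<Sum>k\<in>A. c k *\<^sub>R p k)"
    unfolding v_def c'_def using A fin_J by (intro sum.mono_neutral_cong_right) auto
  have pv: "inner (p j) v = c' j" if "j \<in> J" for j
    unfolding v_def by (rule orthonormal_inner_sum[OF on_p that])
  have xv: "inner (x l) v = 0" if "l \<in> B" for l
    using c(2) that by (simp add: v_A inner_sum_right)
  have Pv: "Pi v = v" unfolding v_def by (rule proj_sum_self[OF on_p])
  have nv: "(norm v)\<^sup>2 = (\<Sum>j\<in>J. (c' j)\<^sup>2)"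
    unfolding v_def orthonormal_norm_sum[OF on_p] by (simp add: L2_set_def sum_nonneg)
  have pos: "0 < (norm v)\<^sup>2"
  proof -
    obtain k where k: "k \<in> A" "c k \<noteq> 0" using c(1) by auto
    then have "0 < (c' k)\<^sup>2" by (simp add: c'_def)
    also have "\<dots> \<le> (\<Sum>j\<in>J. (c' j)\<^sup>2)" using k A fin_J by (intro member_le_sum) auto
    finally show ?thesis by (simp add: nv)
  qed
  have "m0 * (norm v)\<^sup>2 \<le> inner v (H v)"
    unfolding nv inner_H sum_distrib_left
    using m0 by (intro sum_mono) (auto simp: pv c'_def power2_eq_square mult.assoc intro!: mult_right_mono)
  moreover have "- (d * \<xi> * (norm v)\<^sup>2) \<le> inner v (W v)"
    using quadratic_W_bound[of v] by (simp add: Pv)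
  moreover have "inner v (Ht v) \<le> b * (norm v)\<^sup>2"
  proof -
    have "inner v (Ht v) \<le> (\<Sum>l\<in>L. b * (inner (x l) v)\<^sup>2)"
      unfolding inner_Ht power2_eq_square
      using b(1) xv by (intro sum_mono) (metis DiffI mult.assoc mult_right_mono mult_zero_right order_refl power2_eq_square zero_le_power2)
    also have "\<dots> = b * (L2_set (\<lambda>l. inner (x l) v) L)\<^sup>2"
      by (simp add: L2_set_def sum_nonneg sum_distrib_left)
    \<comment> \<open>Only Bessel's inequality is available: the part of \<open>v\<close> outside
      the span of \<open>x\<close> sees the eigenvalue 0 of \<open>Ht\<close>, and
      \<open>0 \<le> b\<close> covers it.\<close>
    also have "\<dots> \<le> b * (norm v)\<^sup>2"
      using bessel[OF on_x] b(2) by (intro mult_left_mono power_mono) auto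
    finally show ?thesis .
  qed
  ultimately have "m0 * (norm v)\<^sup>2 - d * \<xi> * (norm v)\<^sup>2 \<le> b * (norm v)\<^sup>2"
    by (simp add: Ht_eq inner_add)
  then have "(m0 - d * \<xi>) * (norm v)\<^sup>2 \<le> b * (norm v)\<^sup>2" by (simp add: left_diff_distrib)
  with pos show ?thesis by simp
qed

text \<open>The test vector now lies in the span of the \<open>x\<close>, hence not in the range of
  \<open>Pi\<close>. Its component \<open>z\<close> outside that range sees the eigenvalue 0 of
  \<open>H\<close> and at most \<open>e\<close> from \<open>W\<close>, which leaves a surplus
  \<open>(m0 - e) * (norm z)\<^sup>2\<close>. Paying the cross term of \<open>W\<close> from this
  surplus turns a first-order error into the second-order one.\<close>

lemma eigenvalue_upper_bound:
  assumes A: "A \<subseteq> L" and B: "B \<subseteq> J" and card: "card B < card A"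
    and b: "\<And>l. l \<in> A \<Longrightarrow> b \<le> \<nu> l" and m0: "\<And>j. j \<in> J - B \<Longrightarrow> \<mu> j \<le> m0" and m0_e: "e < m0"
  shows "b \<le> m0 + d * \<xi> + e\<^sup>2 / (m0 - e)"
proof -
  have fin: "finite A" "finite B" using A B fin_J fin_L finite_subset by auto
  obtain c where c: "\<exists>k\<in>A. c k \<noteq> 0" "\<forall>j\<in>B. (\<Sum>k\<in>A. c k * inner (p j) (x k)) = 0"
    using underdetermined_system_nontrivial[OF fin(2,1) card, of "\<lambda>k j. inner (p j) (x k)"] by auto
  define c' where "c' k = (if k \<in> A then c k else 0)" for k
  define v where "v = (\<Sum>k\<in>L. c' k *\<^sub>R x k)"
  have v_A: "v = (\<Sum>k\<in>A. c k *\<^sub>R x k)"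
    unfolding v_def c'_def using A fin_L by (intro sum.mono_neutral_cong_right) auto
  have xv: "inner (x j) v = c' j" if "j \<in> L" for j
    unfolding v_def by (rule orthonormal_inner_sum[OF on_x that])
  have pv: "inner (p l) v = 0" if "l \<in> B" for l
    using c(2) that by (simp add: v_A inner_sum_right)
  have nv: "(norm v)\<^sup>2 = (\<Sum>j\<in>L. (c' j)\<^sup>2)"
    unfolding v_def orthonormal_norm_sum[OF on_x] by (simp add: L2_set_def sum_nonneg)
  have pos: "0 < (norm v)\<^sup>2"
  proof -
    obtain k where k: "k \<in> A" "c k \<noteq> 0" using c(1) by auto
    then have "0 < (c' k)\<^sup>2" by (simp add: c'_def)
    also have "\<dots> \<le> (\<Sum>j\<in>L. (c' j)\<^sup>2)" using k A fin_L by (intro member_le_sum) auto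
    finally show ?thesis by (simp add: nv)
  qed
  have 1: "b * (norm v)\<^sup>2 \<le> inner v (Ht v)"
    unfolding nv inner_Ht sum_distrib_left
    using b by (intro sum_mono) (auto simp: xv c'_def power2_eq_square mult.assoc intro!: mult_right_mono)
  define a where "a = norm (Pi v)"
  define z where "z = v - Pi v"
  define h where "h = e\<^sup>2 / (m0 - e)"
  have 2: "inner v (H v) \<le> m0 * a\<^sup>2"
  proof -
    have "inner v (H v) \<le> (\<Sum>l\<in>J. m0 * (inner (p l) v)\<^sup>2)"
      unfolding inner_H power2_eq_square
      using m0 pv by (intro sum_mono) (metis DiffI mult.assoc mult_right_mono mult_zero_right order_refl power2_eq_square zero_le_power2)
    also have "\<dots> = m0 * a\<^sup>2"
      by (simp add: a_def norm_proj[OF on_p] L2_set_def sum_nonneg sum_distrib_left)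
    finally show ?thesis .
  qed
  have 3: "inner v (W v) \<le> d * \<xi> * a\<^sup>2 + 2 * e * a * norm z + e * (norm z)\<^sup>2"
  proof -
    have "inner (a + b) (W (a + b)) = inner a (W a) + 2 * inner a (W b) + inner b (W b)" for a b
      using W_sym[of a b] by (simp add: W_add inner_add inner_commute[of b "W a"])
    from this[of "Pi v" z]
    have "inner v (W v) = inner (Pi v) (W (Pi v)) + 2 * inner (Pi v) (W z) + inner z (W z)"
      by (simp add: z_def)
    moreover have "inner (Pi v) (W (Pi v)) \<le> d * \<xi> * a\<^sup>2"
      using quadratic_W_bound[of v] by (simp add: a_def)
    moreover have "inner (Pi v) (W z) \<le> a * (e * norm z)" "inner z (W z) \<le> norm z * (e * norm z)"
      unfolding a_def using norm_cauchy_schwarz W_bound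
      by (meson mult_left_mono norm_ge_zero order_trans)+
    ultimately show ?thesis by (simp add: power2_eq_square mult_ac)
  qed
  \<comment> \<open>Weighted arithmetic-geometric mean inequality; \<open>h\<close> is chosen so
    that \<open>h * (m0 - e) = e\<^sup>2\<close> completes the square.\<close>
  have 4: "2 * e * a * norm z \<le> h * a\<^sup>2 + (m0 - e) * (norm z)\<^sup>2"
  proof -
    have "0 \<le> (e * a - (m0 - e) * norm z)\<^sup>2 / (m0 - e)" using m0_e by simp
    also have "\<dots> = h * a\<^sup>2 + (m0 - e) * (norm z)\<^sup>2 - 2 * e * a * norm z"
      using m0_e unfolding h_def by (simp add: power2_eq_square divide_simps) (simp add: algebra_simps)
    finally show ?thesis by simp
  qed
  have nz: "(norm v)\<^sup>2 = a\<^sup>2 + (norm z)\<^sup>2"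
    unfolding a_def z_def by (rule norm_proj_pythagoras[OF on_p])
  have d\<xi>: "0 \<le> d * \<xi>" using \<xi>_nonneg by (cases "J = {}") auto
  have h: "0 \<le> h" using m0_e by (simp add: h_def)
  have "b * (norm v)\<^sup>2 \<le> m0 * a\<^sup>2 + d * \<xi> * a\<^sup>2 + h * a\<^sup>2 + m0 * (norm z)\<^sup>2"
    using 1 2 3 4 by (simp add: Ht_eq inner_add algebra_simps)
  also have "\<dots> \<le> (m0 + d * \<xi> + h) * (norm v)\<^sup>2"
    unfolding nz using mult_nonneg_nonneg[OF d\<xi>, of "(norm z)\<^sup>2"] mult_nonneg_nonneg[OF h, of "(norm z)\<^sup>2"]
    by (simp add: distrib_left distrib_right)
  finally show ?thesis using pos by (simp add: h_def)
qed

end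

text \<open>\<open>I\<close> is the selected cluster, \<open>s\<close> a lower bound for its
  perturbed eigenvalues and \<open>g\<close> its distance to the unselected unperturbed ones.
  \<open>partner\<close> is the involution that exchanges the eigenvectors of a dilation for a
  singular value and its negative. Within such a pair the entry of \<open>W\<^sup>2\<close> is a
  difference of diagonal quantities that \<open>y\<close> does not see, so \<open>y_bound\<close>
  exempts it.\<close>

locale spectral_perturbation = spectral_pair +
  fixes I :: "'a set" and partner :: "'a \<Rightarrow> 'a" and s g y :: real
  assumes I_J: "I \<subseteq> J" and I_L: "I \<subseteq> L"
    and s_pos: "0 < s" and e_s: "e \<le> s / 7" and g_pos: "0 < g"
    and \<nu>_large: "i \<in> I \<Longrightarrow> s \<le> \<bar>\<nu> i\<bar>"
    and gap: "i \<in> I \<Longrightarrow> j \<in> J - I \<Longrightarrow> g \<le> \<bar>\<nu> i - \<mu> j\<bar>"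
    and y_nonneg: "0 \<le> y"
    and y_bound: "j \<in> J \<Longrightarrow> k \<in> J \<Longrightarrow> k \<noteq> j \<Longrightarrow> k \<noteq> partner j \<Longrightarrow> \<bar>inner (W (p j)) (W (p k))\<bar> \<le> y"
    and partner: "j \<in> J - I \<Longrightarrow> partner j \<in> J - I" "partner j \<noteq> j" "partner (partner j) = j"
begin

abbreviation T0 :: "'b \<Rightarrow> 'b" where "T0 \<equiv> proj I x"
abbreviation Pc :: "'b \<Rightarrow> 'b" where "Pc \<equiv> proj (J - I) p"
abbreviation PI :: "'b \<Rightarrow> 'b" where "PI \<equiv> proj I p"

definition Q :: "'b \<Rightarrow> 'b" where "Q v = v - Pi v"

definition q :: real where "q = e / s"

text \<open>The Frobenius norm of a sine-theta matrix: overlaps of unselected unperturbed with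
  selected perturbed eigenvectors.\<close>

definition leak :: real where
  "leak = L2_set (\<lambda>(j, i). inner (p j) (x i)) ((J - I) \<times> I)"

lemma fin_I: "finite I" using I_J fin_J finite_subset by auto

lemma on_pI: "orthonormal_on I p" and on_xI: "orthonormal_on I x" and on_pc: "orthonormal_on (J - I) p"
  using orthonormal_on_subset[OF on_p] orthonormal_on_subset[OF on_x] I_J I_L by auto

lemma q_nonneg: "0 \<le> q" and q_le: "q \<le> 1 / 7"
  using e_nonneg e_s s_pos by (auto simp: q_def divide_simps)

lemma leak_nonneg: "0 \<le> leak" by (simp add: leak_def)

lemma \<nu>_nz: "i \<in> I \<Longrightarrow> \<nu> i \<noteq> 0" using \<nu>_large s_pos by fastforce

lemma inverse_\<nu>: "i \<in> I \<Longrightarrow> \<bar>1 / \<nu> i\<bar> \<le> 1 / s"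
  using \<nu>_large[of i] s_pos by (simp add: frac_le)

lemma Pi_split: "Pi v = PI v + Pc v"
  using proj_Un[of I "J - I" p v] I_J fin_J fin_I by (simp add: Un_absorb1)

lemma H_x: "i \<in> I \<Longrightarrow> H (x i) = \<nu> i *\<^sub>R x i - W (x i)"
  using Ht_x[of i] I_L by (auto simp: Ht_eq algebra_simps)

lemma Q_scaleR: "Q (c *\<^sub>R v) = c *\<^sub>R Q v"
  and Q_diff: "Q (u - v) = Q u - Q v"
  by (simp_all add: Q_def proj_diff proj_scaleR algebra_simps)

lemma Q_sym: "inner (Q u) v = inner u (Q v)"
  by (simp add: Q_def inner_diff inner_proj_commute)

lemma norm_Q_le: "norm (Q v) \<le> norm v"
  unfolding Q_def by (rule norm_minus_proj_le[OF on_p])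

text \<open>\<open>Q\<close> annihilates the range of \<open>H\<close>, so the eigenvalue equation
  loses its \<open>H\<close> term. Each use trades a vector outside the range of \<open>Pi\<close>
  for a factor of size \<open>e / s\<close>.\<close>

lemma Q_x: "i \<in> I \<Longrightarrow> Q (x i) = (1 / \<nu> i) *\<^sub>R Q (W (x i))"
proof -
  assume i: "i \<in> I"
  have "Q (H (x i)) = 0" by (simp add: Q_def Pi_H)
  then have "\<nu> i *\<^sub>R Q (x i) = Q (W (x i))" using H_x[OF i] by (simp add: Q_diff Q_scaleR)
  then show ?thesis using \<nu>_nz[OF i] by (metis divide_self scaleR_one scaleR_scaleR times_divide_eq_left mult_1)
qed

text \<open>Entrywise Sylvester equation for the components of the perturbed eigenvectors outside the
  selected eigenspaces, with the part of \<open>x i\<close> outside the range of \<open>Pi\<close> eliminated twice by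
  \<open>Q_x\<close>. The block of a pair \<open>j, partner j\<close> is separated because its entries need
  not be small; it is absorbed into the gap.\<close>

lemma sylvester_entry:
  assumes j: "j \<in> J - I" and i: "i \<in> I"
  defines "a \<equiv> Pi (W (p j))"
    and "b \<equiv> (\<Sum>k\<in>J - {j, partner j}. inner (W (p j)) (W (p k)) *\<^sub>R p k) - Pi (W (Pi (W (p j))))"
    and "c \<equiv> W (Q (W (Q (W (p j)))))"
  shows "(\<nu> i - \<mu> j) * inner (p j) (x i) =
    inner a (x i) + (1 / \<nu> i) * inner b (x i) + (1 / \<nu> i)\<^sup>2 * inner c (x i)
    + (1 / \<nu> i * inner (W (p j)) (W (p j))) * inner (p j) (x i)
    + (1 / \<nu> i * inner (W (p j)) (W (p (partner j)))) * inner (p (partner j)) (x i)"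
proof -
  have jJ: "j \<in> J" "partner j \<in> J" "partner j \<noteq> j" using j partner by auto
  have "inner (p j) (H (x i)) = \<mu> j * inner (p j) (x i)" by (rule inner_p_H[OF jJ(1)])
  then have "(\<nu> i - \<mu> j) * inner (p j) (x i) = inner (W (p j)) (x i)"
    by (simp add: H_x[OF i] inner_diff W_sym algebra_simps)
  also have "\<dots> = inner (W (p j)) (Pi (x i)) + inner (W (p j)) (Q (x i))"
    by (simp add: Q_def inner_diff)
  also have "inner (W (p j)) (Pi (x i)) = inner a (x i)"
    by (simp add: a_def inner_proj_commute)
  also have "inner (W (p j)) (Q (x i)) = (1 / \<nu> i) * inner (W (p j)) (Q (W (x i)))"
    by (simp add: Q_x[OF i])
  also have "inner (W (p j)) (Q (W (x i)))
      = inner (W (p j)) (Q (W (Pi (x i)))) + inner (W (p j)) (Q (W (Q (x i))))"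
    by (simp add: Q_def W_add W_diff proj_add proj_diff inner_diff inner_add)
  also have "inner (W (p j)) (Q (W (Q (x i)))) = (1 / \<nu> i) * inner c (x i)"
    by (simp add: Q_x[OF i] c_def W_scaleR Q_scaleR Q_sym W_sym)
  \<comment> \<open>Writing \<open>Q\<close> as identity minus \<open>Pi\<close> gives the
    compression of \<open>W\<^sup>2\<close> minus the square of the compressed \<open>W\<close>. The
    first has the entries bounded by \<open>y\<close>, the second is small through \<xi>.\<close>
  also have "inner (W (p j)) (Q (W (Pi (x i))))
      = inner (W (p j)) (W (Pi (x i))) - inner (Pi (W (Pi (W (p j))))) (x i)"
    by (simp add: Q_def inner_diff inner_proj_commute W_sym)
  also have "inner (W (p j)) (W (Pi (x i)))
      = (\<Sum>k\<in>J. inner (p k) (x i) * inner (W (p j)) (W (p k)))"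
    by (simp add: proj_def[of J] W_sum W_scaleR inner_sum_right)
  also have "\<dots> = inner (W (p j)) (W (p j)) * inner (p j) (x i)
      + inner (W (p j)) (W (p (partner j))) * inner (p (partner j)) (x i)
      + inner (\<Sum>k\<in>J - {j, partner j}. inner (W (p j)) (W (p k)) *\<^sub>R p k) (x i)"
  proof -
    have "(\<Sum>k\<in>J. f k) = f j + (f (partner j) + (\<Sum>k\<in>J - {j, partner j}. f k))" for f :: "'a \<Rightarrow> real"
      using jJ fin_J by (simp add: sum.remove[of J j] sum.remove[of "J - {j}" "partner j"]
          Diff_insert2[symmetric] insert_commute)
    then show ?thesis by (simp add: inner_sum_left mult_ac)
  qed
  finally show ?thesis
    by (simp add: b_def inner_diff power2_eq_square algebra_simps)
qed

text \<open>Frobenius norm of \<open>sylvester_entry\<close>. This norm fits because dividing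
  entries by different gaps, each at least \<open>g\<close>, cannot increase it beyond the factor
  \<open>1 / g\<close>. The diagonal and the partner term each cost \<open>e\<^sup>2 / s\<close>
  times \<open>leak\<close> itself and move to the left-hand side.\<close>

lemma leak_bound:
  "(g - 2 * e\<^sup>2 / s) * leak \<le> d * \<xi> * (1 + q) + d * y / s + sqrt d * e ^ 3 / s\<^sup>2"
proof (cases "J - I = {}")
  case True
  have "0 \<le> d * \<xi>" using \<xi>_nonneg by (cases "J = {}") auto
  then show ?thesis unfolding leak_def True using y_nonneg e_nonneg s_pos q_nonneg by simp
next
  case False
  let ?B = "J - I"
  let ?D = "?B \<times> I"
  define a where "a j = Pi (W (p j))" for j
  define b1 where "b1 j = (\<Sum>k\<in>J - {j, partner j}. inner (W (p j)) (W (p k)) *\<^sub>R p k)" for j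
  define b where "b j = b1 j - Pi (W (a j))" for j
  define c where "c j = W (Q (W (Q (W (p j)))))" for j
  define Y where "Y = (\<lambda>(j, i). inner (p j) (x i))"
  have \<xi>0: "0 \<le> \<xi>" using False \<xi>_nonneg by blast
  have np: "norm (p j) = 1" if "j \<in> J" for j using orthonormal_norm[OF on_p that] .
  have na: "norm (a j) \<le> sqrt d * \<xi>" if "j \<in> J" for j
    unfolding a_def by (rule norm_Pi_W_p[OF that])
  have nb: "norm (b j) \<le> sqrt d * y + e * (sqrt d * \<xi>)" if j: "j \<in> J" for j
  proof -
    have "norm (b1 j) = L2_set (\<lambda>k. inner (W (p j)) (W (p k))) (J - {j, partner j})"
      unfolding b1_def by (rule orthonormal_norm_sum[OF orthonormal_on_subset[OF on_p]]) auto
    also have "\<dots> \<le> sqrt (card (J - {j, partner j})) * y"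
      by (intro L2_set_bounded) (auto intro: y_bound j)
    also have "\<dots> \<le> sqrt d * y"
      using y_nonneg by (intro mult_right_mono) (auto intro: card_mono fin_J)
    finally have 1: "norm (b1 j) \<le> sqrt d * y" .
    have "norm (Pi (W (a j))) \<le> e * (sqrt d * \<xi>)"
      using norm_proj_le[OF on_p, of "W (a j)"] W_bound[of "a j"] mult_left_mono[OF na[OF j] e_nonneg]
      by linarith
    with 1 norm_triangle_ineq4[of "b1 j" "Pi (W (a j))"] show ?thesis by (simp add: b_def)
  qed
  have WQ: "norm (W (Q v)) \<le> e * norm v" for v
    using W_bound[of "Q v"] mult_left_mono[OF norm_Q_le e_nonneg, of v] by linarith
  have nc: "norm (c j) \<le> e ^ 3" if j: "j \<in> J" for j
  proof -
    have "norm (W (p j)) \<le> e" using W_bound[of "p j"] np[OF j] by simp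
    then have "norm (W (Q (W (p j)))) \<le> e * e"
      using WQ[of "W (p j)"] mult_left_mono[OF _ e_nonneg] by (meson order_trans)
    then have "norm (c j) \<le> e * (e * e)"
      unfolding c_def using WQ[of "W (Q (W (p j)))"] mult_left_mono[OF _ e_nonneg] by (meson order_trans)
    then show ?thesis by (simp add: power3_eq_cube)
  qed
  have WW: "\<bar>1 / \<nu> i * inner (W (p j)) (W (p k))\<bar> \<le> e\<^sup>2 / s" if "i \<in> I" "j \<in> J" "k \<in> J" for i j k
  proof -
    have "\<bar>inner (W (p j)) (W (p k))\<bar> \<le> norm (W (p j)) * norm (W (p k))" by (rule Cauchy_Schwarz_ineq2)
    also have "\<dots> \<le> e * e" using W_bound[of "p j"] W_bound[of "p k"] np that e_nonneg
      by (intro mult_mono) auto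
    finally show ?thesis unfolding abs_mult
      using mult_mono[OF inverse_\<nu>[OF that(1)], of "\<bar>inner (W (p j)) (W (p k))\<bar>" "e\<^sup>2"] s_pos
      by (simp add: power2_eq_square)
  qed
  have cB: "sqrt (card ?B) \<le> sqrt d" by (auto intro: card_mono fin_J)
  have prod: "L2_set (\<lambda>(j, i). inner (f j) (x i)) ?D \<le> sqrt d * M"
    if "\<And>j. j \<in> J \<Longrightarrow> norm (f j) \<le> M" "0 \<le> M" for f M
    using L2_set_prod_inner_le[OF on_xI, of ?B f M] that(1) fin_J mult_right_mono[OF cB that(2)] by force
  have s1: "0 \<le> 1 / s" using s_pos by simp
  define t1 where "t1 = (\<lambda>(j, i). inner (a j) (x i))"
  define t2 where "t2 = (\<lambda>z. 1 / \<nu> (snd z) * (\<lambda>(j, i). inner (b j) (x i)) z)"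
  define t3 where "t3 = (\<lambda>z. (1 / \<nu> (snd z))\<^sup>2 * (\<lambda>(j, i). inner (c j) (x i)) z)"
  define t4 where "t4 = (\<lambda>z. (1 / \<nu> (snd z) * inner (W (p (fst z))) (W (p (fst z)))) * Y z)"
  define t5 where "t5 = (\<lambda>z. (1 / \<nu> (snd z) * inner (W (p (fst z))) (W (p (partner (fst z)))))
      * Y (partner (fst z), snd z))"
  have eq: "(\<nu> (snd z) - \<mu> (fst z)) * Y z = t1 z + t2 z + t3 z + t4 z + t5 z" if "z \<in> ?D" for z
    using sylvester_entry[of "fst z" "snd z"] that
    by (auto simp: t1_def t2_def t3_def t4_def t5_def Y_def a_def b_def b1_def c_def case_prod_beta)
  have "g * leak = L2_set (\<lambda>z. g * Y z) ?D"
    using g_pos by (simp add: leak_def Y_def L2_set_right_distrib)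
  also have "\<dots> = L2_set (\<lambda>z. \<bar>g * Y z\<bar>) ?D" by (simp add: L2_set_def)
  also have "\<dots> \<le> L2_set (\<lambda>z. \<bar>(\<nu> (snd z) - \<mu> (fst z)) * Y z\<bar>) ?D"
    using gap g_pos by (intro L2_set_mono) (auto simp: abs_mult intro!: mult_right_mono)
  also have "\<dots> = L2_set (\<lambda>z. t1 z + t2 z + t3 z + t4 z + t5 z) ?D"
    using eq by (simp add: L2_set_def)
  also have "\<dots> \<le> L2_set t1 ?D + L2_set t2 ?D + L2_set t3 ?D + L2_set t4 ?D + L2_set t5 ?D"
    by (intro order_trans[OF L2_set_triangle_ineq] add_mono order_refl)
  also have "L2_set t1 ?D \<le> d * \<xi>"
    using prod[of a "sqrt d * \<xi>"] na \<xi>0 by (simp add: t1_def mult.assoc[symmetric])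
  also have "L2_set t2 ?D \<le> d * y / s + q * (d * \<xi>)"
  proof -
    have "L2_set t2 ?D \<le> 1 / s * L2_set (\<lambda>(j, i). inner (b j) (x i)) ?D"
      unfolding t2_def using s1 inverse_\<nu> by (intro L2_set_mult_le) auto
    also have "\<dots> \<le> 1 / s * (sqrt d * (sqrt d * y + e * (sqrt d * \<xi>)))"
      using nb y_nonneg e_nonneg \<xi>0 s1 by (intro mult_left_mono prod) auto
    also have "\<dots> = d * y / s + q * (d * \<xi>)"
      by (simp add: q_def algebra_simps add_divide_distrib)
    finally show ?thesis .
  qed
  also have "L2_set t3 ?D \<le> sqrt d * e ^ 3 / s\<^sup>2"
  proof -
    have "\<bar>(1 / \<nu> i)\<^sup>2\<bar> \<le> (1 / s)\<^sup>2" if "i \<in> I" for i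
      using power_mono[OF inverse_\<nu>[OF that], of 2] by (simp only: power2_abs abs_power2 abs_ge_zero)
    then have "L2_set t3 ?D \<le> (1 / s)\<^sup>2 * L2_set (\<lambda>(j, i). inner (c j) (x i)) ?D"
      unfolding t3_def by (intro L2_set_mult_le) auto
    also have "\<dots> \<le> (1 / s)\<^sup>2 * (sqrt d * e ^ 3)"
      using nc e_nonneg by (intro mult_left_mono prod) auto
    finally show ?thesis by (simp add: power_divide)
  qed
  also have "L2_set t4 ?D \<le> e\<^sup>2 / s * leak"
    unfolding t4_def leak_def Y_def[symmetric] using s_pos by (intro L2_set_mult_le WW) auto
  also have "L2_set t5 ?D \<le> e\<^sup>2 / s * leak"
  proof -
    have "L2_set t5 ?D \<le> e\<^sup>2 / s * L2_set (\<lambda>z. Y (partner (fst z), snd z)) ?D"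
      unfolding t5_def using s_pos partner by (intro L2_set_mult_le WW) auto
    \<comment> \<open>\<open>partner\<close> permutes the unselected indices, so the rearranged
      overlaps have the same Frobenius norm.\<close>
    also have "L2_set (\<lambda>z. Y (partner (fst z), snd z)) ?D = L2_set Y ?D"
      unfolding L2_set_def using partner
      by (intro arg_cong[of _ _ sqrt] sum.reindex_bij_witness[of _ "\<lambda>z. (partner (fst z), snd z)" "\<lambda>z. (partner (fst z), snd z)"]) auto
    finally show ?thesis by (simp add: leak_def Y_def)
  qed
  finally show ?thesis by (simp add: algebra_simps)
qed

section \<open>Angles between the perturbed and the unperturbed selected eigenspaces\<close>

lemma inner_Pc_T0: "\<bar>inner (Pc u) (T0 v)\<bar> \<le> leak * norm u * norm v"
proof -
  have "inner (Pc u) (T0 v) = (\<Sum>j\<in>J - I. \<Sum>i\<in>I. inner (p j) u * (inner (x i) v * inner (p j) (x i)))"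
    unfolding proj_def by (simp add: inner_sum_left) (simp add: inner_sum_right sum_distrib_left)
  also have "\<dots> = (\<Sum>(j, i)\<in>(J - I) \<times> I. inner (p j) (x i) * (inner (p j) u * inner (x i) v))"
    by (simp add: sum.cartesian_product mult_ac)
  also have "\<dots> = (\<Sum>z\<in>(J - I) \<times> I. (\<lambda>(j, i). inner (p j) (x i)) z * (\<lambda>(j, i). inner (p j) u * inner (x i) v) z)"
    by (simp add: case_prod_beta)
  also have "\<bar>\<dots>\<bar> \<le> leak * L2_set (\<lambda>(j, i). inner (p j) u * inner (x i) v) ((J - I) \<times> I)"
    unfolding leak_def by (rule abs_sum_le_L2)
  also have "L2_set (\<lambda>(j, i). inner (p j) u * inner (x i) v) ((J - I) \<times> I)
      = L2_set (\<lambda>j. inner (p j) u) (J - I) * L2_set (\<lambda>i. inner (x i) v) I"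
    unfolding L2_set_def real_sqrt_mult[symmetric] sum_product
    by (simp add: sum.cartesian_product case_prod_beta power_mult_distrib)
  also have "leak * \<dots> \<le> leak * (norm u * norm v)"
    using bessel[OF on_pc] bessel[OF on_xI] leak_nonneg by (intro mult_left_mono mult_mono) auto
  finally show ?thesis by (simp add: mult.assoc)
qed

text \<open>\<open>W\<close> is applied to the combined vector and not term by term; orthonormality
  of the \<open>x\<close> then gives \<open>q\<close> without a factor depending on
  \<open>card I\<close>.\<close>

lemma norm_W_sum_inverse:
  "norm (\<Sum>i\<in>I. (c i / \<nu> i) *\<^sub>R W (x i)) \<le> q * L2_set c I"
proof -
  have "(\<Sum>i\<in>I. (c i / \<nu> i) *\<^sub>R W (x i)) = W (\<Sum>i\<in>I. (c i / \<nu> i) *\<^sub>R x i)"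
    by (simp add: W_sum W_scaleR)
  also have "norm \<dots> \<le> e * L2_set (\<lambda>i. 1 / \<nu> i * c i) I"
    using W_bound[of "\<Sum>i\<in>I. (c i / \<nu> i) *\<^sub>R x i"] by (simp add: orthonormal_norm_sum[OF on_xI])
  also have "\<dots> \<le> e * (1 / s * L2_set c I)"
    using inverse_\<nu> s_pos e_nonneg by (intro mult_left_mono L2_set_mult_le) auto
  finally show ?thesis by (simp add: q_def)
qed

lemma norm_Q_T0: "norm (Q (T0 v)) \<le> q * norm (T0 v)"
proof -
  have Q_sum: "Q (\<Sum>i\<in>I. f i) = (\<Sum>i\<in>I. Q (f i))" for f
    by (simp add: Q_def proj_def inner_sum_right scaleR_sum_left sum_subtractf sum.swap[of _ J])
  have "Q (T0 v) = (\<Sum>i\<in>I. inner (x i) v *\<^sub>R Q (x i))"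
    by (simp add: proj_def[of I] Q_sum Q_scaleR)
  also have "\<dots> = (\<Sum>i\<in>I. Q ((inner (x i) v / \<nu> i) *\<^sub>R W (x i)))"
    by (intro sum.cong refl) (simp add: Q_x Q_scaleR)
  also have "\<dots> = Q (\<Sum>i\<in>I. (inner (x i) v / \<nu> i) *\<^sub>R W (x i))" by (simp add: Q_sum)
  finally show ?thesis
    using order_trans[OF norm_Q_le norm_W_sum_inverse[of "\<lambda>i. inner (x i) v"]]
    by (simp add: norm_proj[OF on_xI])
qed

lemma norm_Pc_T0: "norm (Pc (T0 v)) \<le> leak * norm (T0 v)"
proof -
  let ?w = "Pc (T0 v)"
  have "norm ?w * norm ?w = inner ?w (T0 (T0 v))"
    by (simp add: proj_idem[OF on_xI] inner_proj_commute inner_proj_proj[OF on_pc]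
        flip: power2_norm_eq_inner power2_eq_square) (simp add: power2_norm_eq_inner inner_proj_commute proj_idem[OF on_pc])
  also have "\<dots> = inner (Pc ?w) (T0 (T0 v))" by (simp add: proj_idem[OF on_pc])
  also have "\<dots> \<le> leak * norm ?w * norm (T0 v)" using inner_Pc_T0[of ?w "T0 v"] by simp
  finally have "norm ?w * norm ?w \<le> norm ?w * (leak * norm (T0 v))" by (simp add: mult_ac)
  then show ?thesis
    using leak_nonneg by (cases "norm ?w = 0") auto
qed

text \<open>Bounds the sine of the largest angle: \<open>q\<close> accounts for the part outside the
  range of \<open>Pi\<close>, \<open>leak\<close> for the unselected part inside it.\<close>

definition \<kappa> :: real where "\<kappa> = q + leak"

lemma \<kappa>_nonneg: "0 \<le> \<kappa>" using q_nonneg leak_nonneg by (simp add: \<kappa>_def)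

text \<open>Pythagoras for the three orthogonal parts of \<open>T0 v\<close> under
  \<open>PI\<close>, \<open>Pc\<close> and \<open>Q\<close>; the last two are at most
  \<open>leak\<close> and \<open>q\<close> times its norm.\<close>

lemma norm_PI_T0: "(1 - \<kappa>\<^sup>2) * (norm (T0 v))\<^sup>2 \<le> (norm (PI (T0 v)))\<^sup>2"
proof -
  let ?w = "T0 v"
  have "(norm ?w)\<^sup>2 = (norm (Pi ?w))\<^sup>2 + (norm (Q ?w))\<^sup>2"
    unfolding Q_def by (rule norm_proj_pythagoras[OF on_p])
  also have "(norm (Pi ?w))\<^sup>2 = (norm (PI ?w))\<^sup>2 + (norm (Pc ?w))\<^sup>2"
    unfolding norm_proj[OF on_p] norm_proj[OF on_pI] norm_proj[OF on_pc] using I_J fin_J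
    by (simp add: L2_set_def sum_nonneg sum.subset_diff[of I J] add.commute)
  also have "(norm (Pc ?w))\<^sup>2 \<le> (leak * norm ?w)\<^sup>2" by (rule power_mono[OF norm_Pc_T0]) simp
  also have "(norm (Q ?w))\<^sup>2 \<le> (q * norm ?w)\<^sup>2" by (rule power_mono[OF norm_Q_T0]) simp
  finally have 1: "(norm ?w)\<^sup>2 \<le> (norm (PI ?w))\<^sup>2 + (leak\<^sup>2 + q\<^sup>2) * (norm ?w)\<^sup>2"
    by (simp add: power_mult_distrib algebra_simps)
  have "(leak\<^sup>2 + q\<^sup>2) * (norm ?w)\<^sup>2 \<le> \<kappa>\<^sup>2 * (norm ?w)\<^sup>2"
    using q_nonneg leak_nonneg by (intro mult_right_mono) (auto simp: \<kappa>_def power2_sum)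
  with 1 show ?thesis by (simp add: algebra_simps)
qed

text \<open>Both eigenspaces have dimension \<open>card I\<close>, so a small angle in one direction
  makes \<open>PI\<close> map the range of \<open>T0\<close> onto its own range and gives the
  same angle in the other direction.\<close>

lemma norm_PI_minus_T0: "norm (PI v - T0 (PI v)) \<le> \<kappa> * norm (PI v)"
\<comment> \<open>For \<open>1 \<le> \<kappa>\<close> the claim only says that identity minus
  \<open>T0\<close> is a contraction.\<close>
proof (cases "1 \<le> \<kappa> \<or> PI v = 0")
  case True
  then show ?thesis
    using norm_minus_proj_le[OF on_xI, of "PI v"] mult_right_mono[of 1 \<kappa> "norm (PI v)"]
    by (auto simp: proj_def)
next
  case False
  then have \<kappa>1: "0 < 1 - \<kappa>\<^sup>2" using \<kappa>_nonneg by (simp add: power_less_one_iff)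
  \<comment> \<open>One unknown more than equations: the index \<open>None\<close> carries the
    scalar in front of \<open>PI v\<close>, the others the coordinates of a vector \<open>w\<close>
    in the range of \<open>T0\<close> with \<open>PI w = c None *\<^sub>R PI v\<close>.\<close>
  define A where "A = insert None (Some ` I)"
  define a where "a k l = (case k of None \<Rightarrow> - inner (p l) v | Some i \<Rightarrow> inner (p l) (x i))" for k l
  have "card I < card A" using fin_I by (simp add: A_def card_insert_if card_image)
  then obtain c where c: "\<exists>k\<in>A. c k \<noteq> 0" "\<forall>l\<in>I. (\<Sum>k\<in>A. c k * a k l) = 0"
    using underdetermined_system_nontrivial[of I A a] fin_I by (auto simp: A_def)
  define w where "w = (\<Sum>i\<in>I. c (Some i) *\<^sub>R x i)"
  have sys: "inner (p l) w = c None * inner (p l) v" if "l \<in> I" for l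
  proof -
    have "(\<Sum>k\<in>A. c k * a k l) = - c None * inner (p l) v + (\<Sum>i\<in>I. c (Some i) * inner (p l) (x i))"
      unfolding A_def using fin_I by (subst sum.insert) (auto simp: a_def sum.reindex)
    then show ?thesis using c(2) that by (simp add: w_def inner_sum_right)
  qed
  have Tw: "T0 w = w" unfolding w_def by (rule proj_sum_self[OF on_xI])
  have PIw: "PI w = c None *\<^sub>R PI v"
    by (simp add: proj_def[of I p] sys scaleR_sum_right)
  have wle: "(1 - \<kappa>\<^sup>2) * (norm w)\<^sup>2 \<le> (norm (PI w))\<^sup>2" using norm_PI_T0[of w] by (simp add: Tw)
  \<comment> \<open>Otherwise \<open>PI\<close> would annihilate a nonzero vector in the range of
    \<open>T0\<close>, against \<open>norm_PI_T0\<close>.\<close>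
  have nz: "c None \<noteq> 0"
  proof
    assume c0: "c None = 0"
    then have "(norm w)\<^sup>2 \<le> 0" using wle \<kappa>1 by (simp add: PIw mult_le_0_iff)
    then have "L2_set (\<lambda>i. c (Some i)) I = 0" by (simp add: w_def orthonormal_norm_sum[OF on_xI])
    then have "\<forall>i\<in>I. c (Some i) = 0" using fin_I by (simp add: L2_set_eq_0_iff)
    with c0 c(1) show False by (auto simp: A_def)
  qed
  define u where "u = PI v"
  define w' where "w' = (1 / c None) *\<^sub>R w"
  have PIw': "PI w' = u" using nz by (simp add: w'_def proj_scaleR PIw u_def)
  have Tw': "T0 w' = w'" by (simp add: w'_def proj_scaleR Tw)
  have PIu: "PI u = u" by (simp add: u_def proj_idem[OF on_pI])
  have w'le: "(1 - \<kappa>\<^sup>2) * (norm w')\<^sup>2 \<le> (norm u)\<^sup>2" using norm_PI_T0[of w'] by (simp add: Tw' PIw')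
  \<comment> \<open>Duality transfers the angle: \<open>w'\<close> is a preimage of \<open>u\<close>
    that is not much longer than \<open>u\<close>, and testing \<open>u\<close> against it bounds
    \<open>T0 u\<close> from below.\<close>
  have "(norm u)\<^sup>2 = inner u w'"
    using inner_proj_commute[of I p u w'] by (simp add: PIu PIw' power2_norm_eq_inner)
  also have "\<dots> = inner (T0 u) w'" by (simp add: inner_proj_commute Tw')
  also have "\<dots> \<le> norm (T0 u) * norm w'" by (rule norm_cauchy_schwarz)
  finally have "((norm u)\<^sup>2)\<^sup>2 \<le> (norm (T0 u) * norm w')\<^sup>2" by (intro power_mono) auto
  then have "(1 - \<kappa>\<^sup>2) * ((norm u)\<^sup>2)\<^sup>2 \<le> (norm (T0 u))\<^sup>2 * ((1 - \<kappa>\<^sup>2) * (norm w')\<^sup>2)"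
    using mult_left_mono[of _ _ "1 - \<kappa>\<^sup>2"] \<kappa>1 by (simp add: power_mult_distrib mult_ac)
  also have "\<dots> \<le> (norm (T0 u))\<^sup>2 * (norm u)\<^sup>2" by (intro mult_left_mono w'le) auto
  finally have "((1 - \<kappa>\<^sup>2) * (norm u)\<^sup>2) * (norm u)\<^sup>2 \<le> (norm (T0 u))\<^sup>2 * (norm u)\<^sup>2"
    by (simp add: power2_eq_square mult_ac)
  moreover have "0 < (norm u)\<^sup>2" using False by (simp add: u_def)
  ultimately have "(1 - \<kappa>\<^sup>2) * (norm u)\<^sup>2 \<le> (norm (T0 u))\<^sup>2" by simp
  with norm_proj_pythagoras[OF on_xI, of u]
  have "(norm (u - T0 u))\<^sup>2 \<le> (\<kappa> * norm u)\<^sup>2" by (simp add: power_mult_distrib algebra_simps)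
  then show ?thesis unfolding u_def by (rule power2_le_imp_le) (simp add: \<kappa>_nonneg)
qed

section \<open>Comparison of the compressed projections and operators\<close>

lemma norm_PI_le: "norm (PI v) \<le> norm v" and norm_Pc_le: "norm (Pc v) \<le> norm v"
  by (simp_all add: norm_proj_le on_pI on_pc)

text \<open>In the block decomposition by \<open>PI\<close> and \<open>Pc\<close> the selected block
  deviates from the identity by at most \<kappa>, and every block with a \<open>Pc\<close> side is
  controlled by \<open>leak\<close>.\<close>

lemma compressed_projection_bound:
  assumes u: "Pi u = u" and v: "Pi v = v"
  shows "\<bar>inner u (T0 v) - inner u (PI v)\<bar> \<le> (\<kappa> + 3 * leak) * norm u * norm v"
proof -
  have us: "u = PI u + Pc u" and vs: "v = PI v + Pc v" using Pi_split[of u] Pi_split[of v] u v by auto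
  have PIPc: "inner (PI a) (PI b) = inner a (PI b)" for a b by (rule inner_proj_proj[OF on_pI])
  have "T0 v = T0 (PI v) + T0 (Pc v)" using vs proj_add[of I x "PI v" "Pc v"] by simp
  then have "inner u (T0 v) = inner (PI u) (T0 (PI v)) + inner (Pc u) (T0 (PI v)) + inner u (T0 (Pc v))"
    using us inner_add_left[of "PI u" "Pc u" "T0 (PI v)"] by (simp add: inner_add_right)
  moreover have "inner (PI u) (PI v) = inner u (PI v)" by (rule PIPc)
  ultimately have eq: "inner u (T0 v) - inner u (PI v)
      = - inner (PI u) (PI v - T0 (PI v)) + inner (Pc u) (T0 (PI v)) + inner (Pc v) (T0 u)"
    by (simp add: inner_diff_right inner_proj_commute[of I x u, symmetric] inner_commute[of "Pc v"])
  have "\<bar>inner (PI u) (PI v - T0 (PI v))\<bar> \<le> norm (PI u) * norm (PI v - T0 (PI v))"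
    by (rule Cauchy_Schwarz_ineq2)
  also have "\<dots> \<le> norm u * (\<kappa> * norm v)"
    using norm_PI_minus_T0[of v] norm_PI_le[of v] norm_PI_le[of u] \<kappa>_nonneg
    by (intro mult_mono order_trans[OF norm_PI_minus_T0] mult_left_mono) auto
  finally have 1: "\<bar>inner (PI u) (PI v - T0 (PI v))\<bar> \<le> \<kappa> * norm u * norm v" by (simp add: mult_ac)
  have "\<bar>inner (Pc u) (T0 (PI v))\<bar> \<le> leak * norm u * norm (PI v)" by (rule inner_Pc_T0)
  also have "\<dots> \<le> leak * norm u * norm v"
    using leak_nonneg norm_PI_le by (intro mult_left_mono) auto
  finally have 2: "\<bar>inner (Pc u) (T0 (PI v))\<bar> \<le> leak * norm u * norm v" .
  have 3: "\<bar>inner (Pc v) (T0 u)\<bar> \<le> leak * norm u * norm v"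
    using inner_Pc_T0[of v u] by (simp add: mult_ac)
  have 4: "0 \<le> leak * norm u * norm v" using leak_nonneg by simp
  show ?thesis unfolding eq using 1 2 3 4 by (simp add: algebra_simps)
qed

text \<open>The selected eigenvalues may be arbitrarily large, so they have to cancel. On
  \<open>PI v\<close>, replacing \<open>H\<close> by \<open>Ht - W\<close> leaves in the difference
  only perturbed eigenvalues outside \<open>I\<close>, bounded by \<open>b\<close>; on
  \<open>Pc v\<close> only unselected ones of \<open>H\<close> act, bounded by
  \<open>m\<close>.\<close>

lemma compressed_operator_bound:
  assumes u: "Pi u = u" and v: "Pi v = v"
    and m: "\<And>j. j \<in> J - I \<Longrightarrow> \<bar>\<mu> j\<bar> \<le> m" "0 \<le> m"
    and b: "\<And>l. l \<in> L - I \<Longrightarrow> \<bar>\<nu> l\<bar> \<le> b" "0 \<le> b"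
  shows "\<bar>(\<Sum>i\<in>I. \<nu> i * inner (x i) u * inner (x i) v) - (\<Sum>i\<in>I. \<mu> i * inner (p i) u * inner (p i) v)\<bar>
    \<le> (2 * e + leak * m + b * \<kappa>) * norm u * norm v"
proof -
  let ?w = "PI v - T0 (PI v)"
  have vs: "v = PI v + Pc v" using Pi_split[of v] v by auto
  have xw: "\<nu> i * inner (x i) v = inner (x i) (H v) + inner (x i) (W v)" if "i \<in> I" for i
  proof -
    have "\<nu> i * inner (x i) v = inner (Ht (x i)) v" using Ht_x[of i] that I_L by auto
    then show ?thesis by (simp add: Ht_eq inner_add H_sym W_sym)
  qed
  have "(\<Sum>i\<in>I. \<nu> i * inner (x i) u * inner (x i) v) = (\<Sum>i\<in>I. inner (x i) u * (\<nu> i * inner (x i) v))"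
    by (simp add: mult_ac)
  also have "\<dots> = (\<Sum>i\<in>I. inner (x i) u * inner (x i) (H v) + inner (x i) u * inner (x i) (W v))"
    by (intro sum.cong refl) (simp add: xw ring_distribs)
  also have "\<dots> = inner u (T0 (H v)) + inner u (T0 (W v))"
    by (simp add: sum.distrib inner_proj_sum)
  also have "T0 (H v) = T0 (H (PI v)) + T0 (H (Pc v))"
    by (simp add: proj_add[symmetric] H_add[symmetric] vs[symmetric])
  finally have 1: "(\<Sum>i\<in>I. \<nu> i * inner (x i) u * inner (x i) v)
      = inner u (T0 (H (PI v))) + inner u (T0 (H (Pc v))) + inner u (T0 (W v))" by (simp add: inner_add)
  have 2: "(\<Sum>i\<in>I. \<mu> i * inner (p i) u * inner (p i) v) = inner u (H (PI v))"
  proof -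
    have "inner (p j) (PI v) = (if j \<in> I then inner (p j) v else 0)" if j: "j \<in> J" for j
    proof (cases "j \<in> I")
      case True
      then show ?thesis by (simp add: inner_proj_member[OF on_pI])
    next
      case False
      have "inner (p j) (p i) = 0" if "i \<in> I" for i
        using inner_p_p[OF j, of i] that False I_J by auto
      then have "inner (p j) (PI v) = 0" by (simp add: proj_def inner_sum_right)
      with False show ?thesis by simp
    qed
    then have "inner u (H (PI v)) = (\<Sum>j\<in>J. if j \<in> I then \<mu> j * inner (p j) u * inner (p j) v else 0)"
      unfolding inner_H by (intro sum.cong) auto
    also have "\<dots> = (\<Sum>i\<in>I. \<mu> i * inner (p i) u * inner (p i) v)"
      using I_J fin_J by (simp add: sum.inter_restrict[symmetric] Int_absorb1)
    finally show ?thesis ..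
  qed
  have 3: "inner u (T0 (H (PI v))) - inner u (H (PI v))
      = inner u (W (PI v) - T0 (W (PI v))) - (\<Sum>l\<in>L - I. \<nu> l * (inner (x l) u * inner (x l) ?w))"
  proof -
    have "H (PI v) = Ht (PI v) - W (PI v)" by (simp add: Ht_eq)
    moreover have "inner u (T0 (Ht (PI v))) = (\<Sum>l\<in>I. \<nu> l * (inner (x l) u * inner (x l) (PI v)))"
    proof -
      have "inner (x i) (Ht (PI v)) = \<nu> i * inner (x i) (PI v)" if "i \<in> I" for i
        unfolding Ht_def using that I_L by (intro orthonormal_inner_sum[OF on_x]) auto
      then show ?thesis unfolding inner_proj_sum by (intro sum.cong) auto
    qed
    moreover have "inner u (Ht (PI v)) = (\<Sum>l\<in>I. \<nu> l * (inner (x l) u * inner (x l) (PI v)))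
        + (\<Sum>l\<in>L - I. \<nu> l * (inner (x l) u * inner (x l) (PI v)))"
      using I_L fin_L by (simp add: inner_Ht sum.subset_diff[of I L] mult.assoc add.commute)
    \<comment> \<open>The unselected \<open>x\<close> are orthogonal to the range of
      \<open>T0\<close>, so \<open>PI v\<close> may be replaced by the vector \<open>?w\<close>,
      which is short by \<open>norm_PI_minus_T0\<close>.\<close>
    moreover have "(\<Sum>l\<in>L - I. \<nu> l * (inner (x l) u * inner (x l) (PI v)))
        = (\<Sum>l\<in>L - I. \<nu> l * (inner (x l) u * inner (x l) ?w))"
    proof (intro sum.cong refl)
      fix l assume l: "l \<in> L - I"
      have "inner (x l) (x i) = 0" if "i \<in> I" for i
        using inner_x_x[of l i] that l I_L by auto
      then have "inner (x l) (T0 (PI v)) = 0" by (simp add: proj_def[of I x] inner_sum_right)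
      then show "\<nu> l * (inner (x l) u * inner (x l) (PI v)) = \<nu> l * (inner (x l) u * inner (x l) ?w)"
        by (simp add: inner_diff_right)
    qed
    ultimately show ?thesis by (simp only: proj_diff inner_diff_right)
  qed
  have We: "norm (W a) \<le> e * norm v" if "norm a \<le> norm v" for a
    using W_bound[of a] mult_left_mono[OF that e_nonneg] by linarith
  have CS: "\<bar>inner u a\<bar> \<le> M * norm u * norm v" if "norm a \<le> M * norm v" for a M
    using Cauchy_Schwarz_ineq2[of u a] mult_left_mono[OF that, of "norm u"] by (simp add: mult_ac)
  have 4: "\<bar>inner u (W (PI v) - T0 (W (PI v)))\<bar> \<le> e * norm u * norm v"
    using norm_minus_proj_le[OF on_xI] We[OF norm_PI_le] by (intro CS) (rule order_trans)
  have 5: "\<bar>inner u (T0 (W v))\<bar> \<le> e * norm u * norm v"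
    using norm_proj_le[OF on_xI] We[OF order_refl] by (intro CS) (rule order_trans)
  have 6: "\<bar>\<Sum>l\<in>L - I. \<nu> l * (inner (x l) u * inner (x l) ?w)\<bar> \<le> b * \<kappa> * norm u * norm v"
  proof -
    have on: "orthonormal_on (L - I) x" using on_x by (rule orthonormal_on_subset) auto
    have "\<bar>\<Sum>l\<in>L - I. \<nu> l * (inner (x l) u * inner (x l) ?w)\<bar>
        = \<bar>\<Sum>l\<in>L - I. (\<nu> l * inner (x l) u) * inner (x l) ?w\<bar>" by (simp add: mult.assoc)
    also have "\<dots> \<le> L2_set (\<lambda>l. \<nu> l * inner (x l) u) (L - I) * L2_set (\<lambda>l. inner (x l) ?w) (L - I)"
      by (rule abs_sum_le_L2)
    also have "\<dots> \<le> (b * L2_set (\<lambda>l. inner (x l) u) (L - I)) * norm ?w"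
      using b by (intro mult_mono L2_set_mult_le bessel[OF on]) auto
    also have "\<dots> \<le> (b * norm u) * (\<kappa> * norm v)"
      using b(2) \<kappa>_nonneg bessel[OF on, of u] norm_PI_minus_T0[of v] norm_PI_le[of v]
      by (intro mult_mono mult_left_mono order_trans[OF norm_PI_minus_T0]) auto
    finally show ?thesis by (simp add: mult_ac)
  qed
  have 7: "\<bar>inner u (T0 (H (Pc v)))\<bar> \<le> leak * m * norm u * norm v"
  proof -
    define c where "c j = \<mu> j * inner (p j) (Pc v)" for j
    have c0: "c j = 0" if "j \<in> I" for j
    proof -
      have "inner (p j) (p i) = 0" if "i \<in> J - I" for i
        using inner_p_p[of j i] that \<open>j \<in> I\<close> I_J by auto
      then have "inner (p j) (Pc v) = 0" by (simp add: proj_def inner_sum_right)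
      then show ?thesis by (simp add: c_def)
    qed
    have Hc: "H (Pc v) = (\<Sum>j\<in>J - I. c j *\<^sub>R p j)"
      unfolding H_def c_def[symmetric] using c0 fin_J I_J by (intro sum.mono_neutral_right) auto
    have "norm (H (Pc v)) \<le> m * norm (Pc v)"
      unfolding Hc orthonormal_norm_sum[OF on_pc] unfolding c_def
      by (rule order_trans[OF L2_set_mult_le[OF m]]) (auto intro!: mult_left_mono bessel[OF on_pc] m(2))
    also have "\<dots> \<le> m * norm v" using m(2) norm_Pc_le by (intro mult_left_mono) auto
    finally have nH: "norm (H (Pc v)) \<le> m * norm v" .
    have "inner u (T0 (H (Pc v))) = inner (Pc (H (Pc v))) (T0 u)"
      unfolding Hc proj_sum_self[OF on_pc] by (simp add: inner_commute inner_proj_commute)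
    also have "\<bar>\<dots>\<bar> \<le> leak * norm (H (Pc v)) * norm u" by (rule inner_Pc_T0)
    also have "\<dots> \<le> leak * (m * norm v) * norm u"
      using leak_nonneg nH by (intro mult_right_mono mult_left_mono) auto
    finally show ?thesis by (simp add: mult_ac)
  qed
  have "\<bar>(\<Sum>i\<in>I. \<nu> i * inner (x i) u * inner (x i) v) - (\<Sum>i\<in>I. \<mu> i * inner (p i) u * inner (p i) v)\<bar>
    \<le> e * norm u * norm v + b * \<kappa> * norm u * norm v + leak * m * norm u * norm v + e * norm u * norm v"
    unfolding 1 2 using 3 4 5 6 7 by linarith
  then show ?thesis by (simp add: algebra_simps)
qed

text \<open>The Neumann series for the inverse of \<open>\<nu> i - W\<close>, applied to \<open>f\<close> and stopped after \<open>K\<close> terms,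
  has components of relative size \<open>t\<close> in the range of \<open>Pi\<close>, and its remainder is negligible.\<close>

definition delocalized :: "nat \<Rightarrow> 'b \<Rightarrow> real \<Rightarrow> bool" where
  "delocalized K f t \<longleftrightarrow> 0 < K \<and> 0 \<le> t \<and> (\<forall>k<K. norm (Pi ((W ^^ k) f)) \<le> t * e ^ k)
     \<and> norm f * q ^ (K - 1) \<le> t"

lemma norm_W_power: "norm ((W ^^ k) f) \<le> e ^ k * norm f"
proof (induction k)
  case (Suc k)
  have "norm (W ((W ^^ k) f)) \<le> e * (e ^ k * norm f)"
    using W_bound[of "(W ^^ k) f"] mult_left_mono[OF Suc e_nonneg] by linarith
  then show ?case by (simp add: mult.assoc)
qed simp

text \<open>Since \<open>H (x i) = \<nu> i *\<^sub>R x i - W (x i)\<close> lies in the range of \<open>Pi\<close>, one step of the Neumann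
  series can be written without \<open>H\<close>, whose norm is not controlled.\<close>

lemma neumann_step:
  assumes i: "i \<in> I"
  shows "inner f (x i) = inner (Pi f) (x i) + (1 / \<nu> i) * (inner (W f) (x i) - inner (W (Pi f)) (x i))"
proof -
  have "inner f (H (x i)) = inner (Pi f) (H (x i))" by (simp add: inner_proj_commute Pi_H)
  then have "\<nu> i * inner f (x i) = \<nu> i * inner (Pi f) (x i) + (inner (W f) (x i) - inner (W (Pi f)) (x i))"
    by (simp add: H_x[OF i] inner_diff_right W_sym)
  then show ?thesis using \<nu>_nz[OF i] by (simp add: field_simps)
qed

text \<open>Downward induction: at \<open>k = K\<close> only Bessel's inequality is used, and each
  application of \<open>neumann_step\<close> multiplies the remainder by \<open>q\<close>. The
  constant 4/3 reproduces itself because \<open>1 + 4/3 * q + q \<le> 4/3\<close> is equivalent to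
  \<open>q \<le> 1/7\<close>.\<close>

lemma norm_inner_W_power_x:
  assumes f: "delocalized K f t" and k: "k \<le> K"
  shows "L2_set (\<lambda>i. inner ((W ^^ k) f) (x i)) I \<le> e ^ k * (4 / 3 * t + q ^ (K - k) * norm f)"
  using k
proof (induction k rule: inc_induct)
  case base
  have "0 \<le> e ^ K * (4 / 3 * t)" using f e_nonneg by (simp add: delocalized_def)
  then show ?case using bessel'[OF on_xI, of "(W ^^ K) f"] norm_W_power[of K f]
    by (simp only: distrib_left diff_self_eq_0 power_0 mult_1)
next
  case (step k)
  let ?f = "(W ^^ k) f"
  have t: "0 \<le> t" and Pf: "norm (Pi ?f) \<le> t * e ^ k" using f step.hyps by (auto simp: delocalized_def)
  have inv: "\<bar>1 / \<nu> i\<bar> \<le> 1 / s" if "i \<in> I" for i using inverse_\<nu>[OF that] .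
  have s1: "0 \<le> 1 / s" using s_pos by simp
  have "L2_set (\<lambda>i. inner ?f (x i)) I
      = L2_set (\<lambda>i. inner (Pi ?f) (x i) + (1 / \<nu> i) * (inner (W ?f) (x i) + - inner (W (Pi ?f)) (x i))) I"
    by (intro L2_set_cong refl) (simp add: neumann_step[of _ ?f])
  also have "\<dots> \<le> L2_set (\<lambda>i. inner (Pi ?f) (x i)) I
      + 1 / s * L2_set (\<lambda>i. inner (W ?f) (x i) + - inner (W (Pi ?f)) (x i)) I"
    by (intro order_trans[OF L2_set_triangle_ineq] add_mono L2_set_mult_le inv s1 order_refl)
  finally have 1: "L2_set (\<lambda>i. inner ?f (x i)) I \<le> L2_set (\<lambda>i. inner (Pi ?f) (x i)) I
      + 1 / s * L2_set (\<lambda>i. inner (W ?f) (x i) + - inner (W (Pi ?f)) (x i)) I" .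
  have 2: "L2_set (\<lambda>i. inner (W ?f) (x i) + - inner (W (Pi ?f)) (x i)) I
      \<le> e ^ Suc k * (4 / 3 * t + q ^ (K - Suc k) * norm f) + e * (t * e ^ k)"
  proof (rule order_trans[OF L2_set_triangle_ineq add_mono])
    show "L2_set (\<lambda>i. inner (W ?f) (x i)) I \<le> e ^ Suc k * (4 / 3 * t + q ^ (K - Suc k) * norm f)"
      using step.IH by simp
    show "L2_set (\<lambda>i. - inner (W (Pi ?f)) (x i)) I \<le> e * (t * e ^ k)"
      unfolding L2_set_uminus
      using bessel'[OF on_xI, of "W (Pi ?f)"] W_bound[of "Pi ?f"] mult_left_mono[OF Pf e_nonneg] by linarith
  qed
  have 3: "L2_set (\<lambda>i. inner (Pi ?f) (x i)) I \<le> t * e ^ k"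
    using bessel'[OF on_xI, of "Pi ?f"] Pf by linarith
  from 1 3 mult_left_mono[OF 2 s1] have "L2_set (\<lambda>i. inner ?f (x i)) I
    \<le> t * e ^ k + 1 / s * (e ^ Suc k * (4 / 3 * t + q ^ (K - Suc k) * norm f) + e * (t * e ^ k))"
    by linarith
  also have "\<dots> = e ^ k * (t + q * (4 / 3 * t + q ^ (K - Suc k) * norm f) + q * t)"
    by (simp add: q_def algebra_simps)
  also have "\<dots> = e ^ k * ((1 + 7 / 3 * q) * t + q ^ (K - k) * norm f)"
    using step.hyps by (simp add: Suc_diff_Suc[symmetric] algebra_simps)
  also have "\<dots> \<le> e ^ k * (4 / 3 * t + q ^ (K - k) * norm f)"
    using q_le t e_nonneg by (intro mult_left_mono add_mono mult_right_mono) auto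
  finally show ?case .
qed

text \<open>The residual is what the range of \<open>Pi\<close> misses in the coordinates of
  \<open>f\<close>. By \<open>neumann_step\<close> its product with the eigenvalue is free of
  \<open>H\<close>; so the weighted form, which the truncated matrices require, holds with no upper
  bound on the eigenvalues.\<close>

lemma delocalized_residual:
  assumes f: "delocalized K f t"
  defines "\<beta> \<equiv> \<lambda>i. inner f (x i) - inner (Pi f) (x i)"
  shows "L2_set (\<lambda>i. \<nu> i * \<beta> i) I \<le> 4 * e * t" and "L2_set \<beta> I \<le> 4 * q * t"
proof -
  have K: "0 < K" and t: "0 \<le> t" and Pf: "norm (Pi f) \<le> t" and tail: "norm f * q ^ (K - 1) \<le> t"
    using f by (auto simp: delocalized_def)
  have \<nu>\<beta>: "\<nu> i * \<beta> i = inner (W f) (x i) + - inner (W (Pi f)) (x i)" if "i \<in> I" for i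
    using neumann_step[OF that, of f] \<nu>_nz[OF that] by (simp add: \<beta>_def)
  have "L2_set (\<lambda>i. \<nu> i * \<beta> i) I = L2_set (\<lambda>i. inner (W f) (x i) + - inner (W (Pi f)) (x i)) I"
    by (intro L2_set_cong refl \<nu>\<beta>)
  also have "\<dots> \<le> L2_set (\<lambda>i. inner (W f) (x i)) I + L2_set (\<lambda>i. inner (W (Pi f)) (x i)) I"
    by (rule order_trans[OF L2_set_triangle_ineq]) (simp add: L2_set_uminus)
  also have "L2_set (\<lambda>i. inner (W f) (x i)) I \<le> e * (4 / 3 * t + q ^ (K - 1) * norm f)"
    using norm_inner_W_power_x[OF f, of 1] K by simp
  also have "\<dots> \<le> e * (4 / 3 * t + t)"
    using tail e_nonneg by (intro mult_left_mono add_mono) (auto simp: mult.commute)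
  also have "L2_set (\<lambda>i. inner (W (Pi f)) (x i)) I \<le> e * t"
    using bessel'[OF on_xI, of "W (Pi f)"] W_bound[of "Pi f"] mult_left_mono[OF Pf e_nonneg] by linarith
  \<comment> \<open>10/3 is the sum of 4/3 for the series, 1 for its remainder and 1 for the
    compressed part.\<close>
  finally have "L2_set (\<lambda>i. \<nu> i * \<beta> i) I \<le> 10 / 3 * (e * t)" by (simp add: algebra_simps)
  also have "\<dots> \<le> 4 * (e * t)" using e_nonneg t by (intro mult_right_mono) auto
  finally show 1: "L2_set (\<lambda>i. \<nu> i * \<beta> i) I \<le> 4 * e * t" by simp
  have "L2_set \<beta> I = L2_set (\<lambda>i. 1 / \<nu> i * (\<nu> i * \<beta> i)) I"
    using \<nu>_nz by (intro L2_set_cong) auto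
  also have "\<dots> \<le> 1 / s * L2_set (\<lambda>i. \<nu> i * \<beta> i) I"
    using inverse_\<nu> s_pos by (intro L2_set_mult_le) auto
  also have "\<dots> \<le> 1 / s * (4 * e * t)" using 1 s_pos by (intro mult_left_mono) auto
  finally show "L2_set \<beta> I \<le> 4 * q * t" by (simp add: q_def)
qed

text \<open>Both claims are the same estimate with weights 1 and \<nu>. In the product of two
  residuals only one carries the weight, so the unweighted bound serves for the other.\<close>

lemma delocalized_compression:
  assumes f: "delocalized K f t" and f': "delocalized K' f' t'"
  shows "\<bar>inner f (T0 f') - inner (Pi f) (T0 (Pi f'))\<bar> \<le> 11 * q * t * t'"
    and "\<bar>(\<Sum>i\<in>I. \<nu> i * inner (x i) f * inner (x i) f')
      - (\<Sum>i\<in>I. \<nu> i * inner (x i) (Pi f) * inner (x i) (Pi f'))\<bar> \<le> 11 * e * t * t'"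
proof -
  define \<alpha> where "\<alpha> i = inner (Pi f) (x i)" for i
  define \<alpha>' where "\<alpha>' i = inner (Pi f') (x i)" for i
  define \<beta> where "\<beta> i = inner f (x i) - inner (Pi f) (x i)" for i
  define \<beta>' where "\<beta>' i = inner f' (x i) - inner (Pi f') (x i)" for i
  have t: "0 \<le> t" "0 \<le> t'" using f f' by (auto simp: delocalized_def)
  have "norm (Pi f) \<le> t" "norm (Pi f') \<le> t'" using f f' by (auto simp: delocalized_def)
  then have \<alpha>: "L2_set \<alpha> I \<le> t" "L2_set \<alpha>' I \<le> t'"
    unfolding \<alpha>_def \<alpha>'_def by (auto intro: order_trans[OF bessel'[OF on_xI]])
  note \<beta> = delocalized_residual[OF f, folded \<beta>_def] and \<beta>' = delocalized_residual[OF f', folded \<beta>'_def]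
  have main: "\<bar>(\<Sum>i\<in>I. a i * inner (x i) f * inner (x i) f')
      - (\<Sum>i\<in>I. a i * inner (x i) (Pi f) * inner (x i) (Pi f'))\<bar> \<le> 11 * M * t * t'"
    if "L2_set (\<lambda>i. a i * \<beta> i) I \<le> 4 * M * t" "L2_set (\<lambda>i. a i * \<beta>' i) I \<le> 4 * M * t'" "0 \<le> M"
    for a M
  proof -
    have xf: "inner (x i) f = \<alpha> i + \<beta> i" "inner (x i) f' = \<alpha>' i + \<beta>' i"
      "inner (x i) (Pi f) = \<alpha> i" "inner (x i) (Pi f') = \<alpha>' i" for i
      by (simp_all add: \<alpha>_def \<beta>_def \<alpha>'_def \<beta>'_def inner_commute)
    have eq: "(\<Sum>i\<in>I. a i * inner (x i) f * inner (x i) f')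
        - (\<Sum>i\<in>I. a i * inner (x i) (Pi f) * inner (x i) (Pi f'))
        = (\<Sum>i\<in>I. \<alpha> i * (a i * \<beta>' i)) + (\<Sum>i\<in>I. (a i * \<beta> i) * \<alpha>' i) + (\<Sum>i\<in>I. (a i * \<beta> i) * \<beta>' i)"
      unfolding xf sum.distrib[symmetric] sum_subtractf[symmetric] by (intro sum.cong) (auto simp: algebra_simps)
    have "\<bar>\<Sum>i\<in>I. \<alpha> i * (a i * \<beta>' i)\<bar> \<le> t * (4 * M * t')"
      by (rule order_trans[OF abs_sum_le_L2]) (use that \<alpha> t in \<open>auto intro!: mult_mono\<close>)
    moreover have "\<bar>\<Sum>i\<in>I. (a i * \<beta> i) * \<alpha>' i\<bar> \<le> (4 * M * t) * t'"
      by (rule order_trans[OF abs_sum_le_L2]) (use that \<alpha> t in \<open>auto intro!: mult_mono\<close>)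
    moreover have "\<bar>\<Sum>i\<in>I. (a i * \<beta> i) * \<beta>' i\<bar> \<le> (4 * M * t) * (4 * q * t')"
      by (rule order_trans[OF abs_sum_le_L2]) (rule mult_mono, use that \<beta>'(2) t in auto)
    \<comment> \<open>The three terms add up to 4 + 4 + 16/7, which is below 11.\<close>
    moreover have "(4 * M * t) * (4 * q * t') \<le> (4 * M * t) * (4 * (1 / 7) * t')"
      using t that(3) q_le by (intro mult_left_mono mult_right_mono) auto
    moreover have "0 \<le> M * t * t'" using t that(3) by simp
    ultimately show ?thesis unfolding eq by (simp add: algebra_simps)
  qed
  show "\<bar>inner f (T0 f') - inner (Pi f) (T0 (Pi f'))\<bar> \<le> 11 * q * t * t'"
    using main[of "\<lambda>_. 1" q] \<beta>(2) \<beta>'(2) q_nonneg by (simp add: inner_proj_sum)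
  show "\<bar>(\<Sum>i\<in>I. \<nu> i * inner (x i) f * inner (x i) f')
      - (\<Sum>i\<in>I. \<nu> i * inner (x i) (Pi f) * inner (x i) (Pi f'))\<bar> \<le> 11 * e * t * t'"
    using main[of \<nu> e] \<beta>(1) \<beta>'(1) e_nonneg by simp
qed

section \<open>Bounds for entries between delocalized vectors\<close>

lemma inner_PI_Pi: "inner (Pi f) (PI (Pi f')) = inner f (PI f')"
proof -
  have "inner (p i) (Pi f) = inner (p i) f" if "i \<in> I" for i f
    using inner_proj_member[OF on_p] I_J that by auto
  then show ?thesis by (simp add: inner_proj_sum)
qed

lemma projection_entry_bound:
  assumes f: "delocalized K f t" and f': "delocalized K' f' t'"
  shows "\<bar>inner f (T0 f') - inner f (PI f')\<bar> \<le> (12 * q + 4 * leak) * t * t'"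
proof -
  have t: "0 \<le> t" "0 \<le> t'" "norm (Pi f) \<le> t" "norm (Pi f') \<le> t'"
    using f f' by (auto simp: delocalized_def)
  have "\<bar>inner (Pi f) (T0 (Pi f')) - inner f (PI f')\<bar> \<le> (\<kappa> + 3 * leak) * norm (Pi f) * norm (Pi f')"
    using compressed_projection_bound[of "Pi f" "Pi f'"] by (simp add: proj_idem[OF on_p] inner_PI_Pi)
  also have "\<dots> \<le> (\<kappa> + 3 * leak) * t * t'"
    using t \<kappa>_nonneg leak_nonneg by (intro mult_mono) auto
  finally show ?thesis using delocalized_compression(1)[OF f f'] by (simp add: \<kappa>_def algebra_simps)
qed

lemma operator_entry_bound:
  assumes f: "delocalized K f t" and f': "delocalized K' f' t'"
    and m: "\<And>j. j \<in> J - I \<Longrightarrow> \<bar>\<mu> j\<bar> \<le> m" "0 \<le> m"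
    and b: "\<And>l. l \<in> L - I \<Longrightarrow> \<bar>\<nu> l\<bar> \<le> b" "0 \<le> b"
  shows "\<bar>(\<Sum>i\<in>I. \<nu> i * inner (x i) f * inner (x i) f') - (\<Sum>i\<in>I. \<mu> i * inner (p i) f * inner (p i) f')\<bar>
    \<le> (13 * e + leak * m + b * \<kappa>) * t * t'"
proof -
  have t: "0 \<le> t" "0 \<le> t'" "norm (Pi f) \<le> t" "norm (Pi f') \<le> t'"
    using f f' by (auto simp: delocalized_def)
  have pI: "inner (p i) (Pi f) = inner (p i) f" if "i \<in> I" for i f
    using inner_proj_member[OF on_p] I_J that by auto
  have "\<bar>(\<Sum>i\<in>I. \<nu> i * inner (x i) (Pi f) * inner (x i) (Pi f'))
      - (\<Sum>i\<in>I. \<mu> i * inner (p i) f * inner (p i) f')\<bar>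
      \<le> (2 * e + leak * m + b * \<kappa>) * norm (Pi f) * norm (Pi f')"
    using compressed_operator_bound[OF _ _ m b, of "Pi f" "Pi f'"] by (simp add: proj_idem[OF on_p] pI)
  also have "\<dots> \<le> (2 * e + leak * m + b * \<kappa>) * t * t'"
    using t \<kappa>_nonneg leak_nonneg e_nonneg m b by (intro mult_mono) auto
  finally show ?thesis using delocalized_compression(2)[OF f f'] by (simp add: algebra_simps)
qed

end

section \<open>Finitely supported sequences as an inner product space\<close>

text \<open>Matrix dimensions are not types here, so a single inner product space that contains every
  Euclidean space isometrically is used for all of them.\<close>

typedef fseq = "{f :: nat \<Rightarrow> real. finite {i. f i \<noteq> 0}}"
  morphisms coord Abs_fseq
  by (rule exI[of _ "\<lambda>_. 0"]) simp

lemma finite_supp: "finite {i. coord x i \<noteq> 0}"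
  using coord[of x] by simp

lemma fseq_eqI: "(\<And>i. coord x i = coord y i) \<Longrightarrow> x = y"
  by (metis coord_inject ext)

lemma coord_Abs: "finite {i. f i \<noteq> 0} \<Longrightarrow> coord (Abs_fseq f) i = f i"
  by (simp add: Abs_fseq_inverse)

instantiation fseq :: real_vector
begin

definition zero_fseq :: fseq where "0 = Abs_fseq (\<lambda>_. 0)"
definition plus_fseq :: "fseq \<Rightarrow> fseq \<Rightarrow> fseq" where "x + y = Abs_fseq (\<lambda>i. coord x i + coord y i)"
definition minus_fseq :: "fseq \<Rightarrow> fseq \<Rightarrow> fseq" where "x - y = Abs_fseq (\<lambda>i. coord x i - coord y i)"
definition uminus_fseq :: "fseq \<Rightarrow> fseq" where "- x = Abs_fseq (\<lambda>i. - coord x i)"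
definition scaleR_fseq :: "real \<Rightarrow> fseq \<Rightarrow> fseq" where "c *\<^sub>R x = Abs_fseq (\<lambda>i. c * coord x i)"

lemma coord_zero [simp]: "coord 0 i = 0"
  by (simp add: zero_fseq_def coord_Abs)

lemma coord_plus [simp]: "coord (x + y) i = coord x i + coord y i"
  unfolding plus_fseq_def
  by (rule coord_Abs, rule finite_subset[OF _ finite_UnI[OF finite_supp[of x] finite_supp[of y]]]) auto

lemma coord_minus [simp]: "coord (x - y) i = coord x i - coord y i"
  unfolding minus_fseq_def
  by (rule coord_Abs, rule finite_subset[OF _ finite_UnI[OF finite_supp[of x] finite_supp[of y]]]) auto

lemma coord_uminus [simp]: "coord (- x) i = - coord x i"
  unfolding uminus_fseq_def by (rule coord_Abs) (simp add: finite_supp)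

lemma coord_scaleR [simp]: "coord (c *\<^sub>R x) i = c * coord x i"
  unfolding scaleR_fseq_def by (rule coord_Abs, rule finite_subset[OF _ finite_supp[of x]]) auto

instance
  by standard (auto intro!: fseq_eqI simp: algebra_simps)

end

lemma coord_sum [simp]: "coord (\<Sum>k\<in>A. f k) i = (\<Sum>k\<in>A. coord (f k) i)"
  by (induction A rule: infinite_finite_induct) simp_all

instantiation fseq :: real_inner
begin

definition inner_fseq :: "fseq \<Rightarrow> fseq \<Rightarrow> real" where
  "inner_fseq x y = (\<Sum>i | coord x i \<noteq> 0. coord x i * coord y i)"
definition norm_fseq :: "fseq \<Rightarrow> real" where "norm_fseq x = sqrt (inner x x)"
definition dist_fseq :: "fseq \<Rightarrow> fseq \<Rightarrow> real" where "dist_fseq x y = norm (x - y)"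
definition sgn_fseq :: "fseq \<Rightarrow> fseq" where "sgn_fseq x = x /\<^sub>R norm x"
definition uniformity_fseq :: "(fseq \<times> fseq) filter" where
  "uniformity_fseq = (INF e\<in>{0 <..}. principal {(x, y). dist x y < e})"
definition open_fseq :: "fseq set \<Rightarrow> bool" where
  "open_fseq U \<longleftrightarrow> (\<forall>x\<in>U. \<forall>\<^sub>F (x', y) in uniformity. x' = x \<longrightarrow> y \<in> U)"

lemma inner_fseq_eq:
  "finite B \<Longrightarrow> {i. coord x i \<noteq> 0} \<subseteq> B \<Longrightarrow> inner x y = (\<Sum>i\<in>B. coord x i * coord y i)"
  unfolding inner_fseq_def by (rule sum.mono_neutral_left) auto

instance
proof
  fix x y z :: fseq and r :: real
  let ?B = "{i. coord x i \<noteq> 0} \<union> {i. coord y i \<noteq> 0}"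
  have B: "finite ?B" using finite_supp by blast
  have s: "{i. coord (x + y) i \<noteq> 0} \<subseteq> ?B" by auto
  show "inner x y = inner y x"
    by (simp add: inner_fseq_eq[OF B] mult.commute)
  show "inner (x + y) z = inner x z + inner y z"
    by (simp add: inner_fseq_eq[OF B s] inner_fseq_eq[OF B] algebra_simps sum.distrib)
  have "{i. coord (r *\<^sub>R x) i \<noteq> 0} \<subseteq> {i. coord x i \<noteq> 0}" by auto
  from inner_fseq_eq[OF finite_supp this]
  show "inner (r *\<^sub>R x) y = r * inner x y"
    by (simp add: inner_fseq_def sum_distrib_left mult.assoc)
  show "0 \<le> inner x x" by (simp add: inner_fseq_def sum_nonneg)
  show "inner x x = 0 \<longleftrightarrow> x = 0"
  proof
    assume "inner x x = 0"
    then have "\<forall>i\<in>{i. coord x i \<noteq> 0}. coord x i * coord x i = 0"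
      unfolding inner_fseq_def using finite_supp by (subst (asm) sum_nonneg_eq_0_iff) auto
    then show "x = 0" by (intro fseq_eqI) auto
  qed (simp add: inner_fseq_def)
qed (rule norm_fseq_def dist_fseq_def sgn_fseq_def uniformity_fseq_def open_fseq_def)+

end

section \<open>Embedding of vectors and matrices\<close>

definition emb :: "real vec \<Rightarrow> fseq" where
  "emb v = Abs_fseq (\<lambda>i. if i < dim_vec v then v $ i else 0)"

definition res :: "nat \<Rightarrow> fseq \<Rightarrow> real vec" where "res n x = vec n (coord x)"

lemma coord_emb: "coord (emb v) i = (if i < dim_vec v then v $ i else 0)"
  unfolding emb_def by (rule coord_Abs, rule finite_subset[of _ "{..<dim_vec v}"]) auto

lemma dim_res [simp]: "dim_vec (res n x) = n" and res_carrier [simp]: "res n x \<in> carrier_vec n"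
  by (simp_all add: res_def)

lemma res_emb: "v \<in> carrier_vec n \<Longrightarrow> res n (emb v) = v"
  by (auto simp: res_def coord_emb)

lemma inner_emb_res: "inner (emb v) x = v \<bullet> res (dim_vec v) x"
  by (subst inner_fseq_eq[of "{..<dim_vec v}"])
    (auto simp: coord_emb scalar_prod_def res_def lessThan_atLeast0 intro!: sum.cong)

lemma inner_emb: "v \<in> carrier_vec n \<Longrightarrow> w \<in> carrier_vec n \<Longrightarrow> inner (emb v) (emb w) = v \<bullet> w"
  by (simp add: inner_emb_res res_emb)

lemma norm_emb: "norm (emb v) = vec_norm2 v"
  by (simp add: norm_eq_sqrt_inner inner_emb[of _ "dim_vec v"] vec_norm2_def)

lemma emb_smult: "emb (c \<cdot>\<^sub>v v) = c *\<^sub>R emb v"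
  by (rule fseq_eqI) (auto simp: coord_emb)

lemma norm_res_le: "vec_norm2 (res n x) \<le> norm x"
proof -
  have "vec_norm2 (res n x) * vec_norm2 (res n x) = inner (emb (res n x)) (emb (res n x))"
    by (simp add: norm_emb[symmetric] power2_norm_eq_inner[symmetric] power2_eq_square)
  also have "\<dots> = inner (emb (res n x)) x"
    by (simp add: inner_emb_res inner_emb[of _ n] res_emb[of _ n])
  also have "\<dots> \<le> vec_norm2 (res n x) * norm x"
    using norm_cauchy_schwarz[of "emb (res n x)" x] by (simp add: norm_emb)
  finally show ?thesis
    by (metis mult_left_le_imp_le norm_emb norm_ge_zero order_le_less)
qed

lemma vec_norm2_nonneg [simp]: "0 \<le> vec_norm2 v"
  by (metis norm_emb norm_ge_zero)

lemma vec_norm2_power2: "(vec_norm2 v)\<^sup>2 = (\<Sum>i<dim_vec v. (v $ i)\<^sup>2)"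
  by (simp add: vec_norm2_def scalar_prod_def sum_nonneg power2_eq_square lessThan_atLeast0)

lemma vec_norm2_smult: "vec_norm2 (c \<cdot>\<^sub>v v) = \<bar>c\<bar> * vec_norm2 v"
  by (simp add: norm_emb[symmetric] emb_smult)

definition mop :: "real mat \<Rightarrow> fseq \<Rightarrow> fseq" where
  "mop M x = emb (M *\<^sub>v res (dim_col M) x)"

lemma mop_emb: "v \<in> carrier_vec (dim_col M) \<Longrightarrow> mop M (emb v) = emb (M *\<^sub>v v)"
  by (simp add: mop_def res_emb)

lemma coord_mop: "coord (mop M x) i = (if i < dim_row M then \<Sum>j<dim_col M. M $$ (i, j) * coord x j else 0)"
  by (auto simp: mop_def coord_emb scalar_prod_def res_def lessThan_atLeast0 intro!: sum.cong)

lemma linear_mop: "linear (mop M)"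
  by (rule linearI; rule fseq_eqI) (auto simp: coord_mop algebra_simps sum.distrib sum_distrib_left)

lemma mop_add_mat: "A \<in> carrier_mat m n \<Longrightarrow> B \<in> carrier_mat m n \<Longrightarrow> mop (A + B) x = mop A x + mop B x"
  by (rule fseq_eqI) (auto simp: coord_mop algebra_simps sum.distrib)

lemma inner_mop: "inner (mop M x) y = inner x (mop (transpose_mat M) y)"
proof -
  have "inner (mop M x) y = (M *\<^sub>v res (dim_col M) x) \<bullet> res (dim_row M) y"
    by (simp add: mop_def inner_emb_res)
  also have "\<dots> = res (dim_row M) y \<bullet> (M *\<^sub>v res (dim_col M) x)"
    by (rule comm_scalar_prod[of _ "dim_row M"]) (auto intro: carrier_vecI)
  also have "\<dots> = (transpose_mat M *\<^sub>v res (dim_row M) y) \<bullet> res (dim_col M) x"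
    by (rule transpose_vec_mult_scalar[symmetric]) auto
  also have "\<dots> = inner (mop (transpose_mat M) y) x"
    by (simp add: mop_def inner_emb_res)
  finally show ?thesis by (simp add: inner_commute)
qed

section \<open>The matrix norms\<close>

text \<open>The supremum in \<open>spectral_norm\<close> can be used only once its set is known to
  be bounded; the Frobenius norm serves as the bound.\<close>

lemma spectral_norm_bdd:
  "bdd_above {vec_norm2 (M *\<^sub>v x) | x. x \<in> carrier_vec (dim_col M) \<and> vec_norm2 x \<le> 1}"
proof (rule bdd_aboveI)
  fix z assume "z \<in> {vec_norm2 (M *\<^sub>v x) | x. x \<in> carrier_vec (dim_col M) \<and> vec_norm2 x \<le> 1}"
  then obtain x where x: "x \<in> carrier_vec (dim_col M)" "vec_norm2 x \<le> 1" and z: "z = vec_norm2 (M *\<^sub>v x)"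
    by auto
  have "(row M i \<bullet> x)\<^sup>2 \<le> (vec_norm2 (row M i))\<^sup>2" for i
  proof -
    have "\<bar>inner (emb (row M i)) (emb x)\<bar> \<le> norm (emb (row M i)) * norm (emb x)"
      by (rule Cauchy_Schwarz_ineq2)
    then have "\<bar>row M i \<bullet> x\<bar> \<le> vec_norm2 (row M i) * 1"
      using x inner_emb[of "row M i" "dim_col M" x] mult_left_mono[OF x(2), of "vec_norm2 (row M i)"]
      by (simp add: norm_emb row_carrier_vec)
    then show ?thesis by (intro abs_le_square_iff[THEN iffD1]) simp
  qed
  then have "z\<^sup>2 \<le> (\<Sum>i<dim_row M. (vec_norm2 (row M i))\<^sup>2)"
    unfolding z vec_norm2_power2[of "M *\<^sub>v x"] by (auto intro!: sum_mono)
  then show "z \<le> sqrt (\<Sum>i<dim_row M. (vec_norm2 (row M i))\<^sup>2)"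
    by (rule real_le_rsqrt)
qed

lemma spectral_norm_bound:
  assumes x: "x \<in> carrier_vec (dim_col M)"
  shows "vec_norm2 (M *\<^sub>v x) \<le> spectral_norm M * vec_norm2 x"
proof (cases "vec_norm2 x = 0")
  case True
  then have "emb x = 0" by (simp add: norm_emb[symmetric])
  then have "emb (M *\<^sub>v x) = 0" using mop_emb[OF x] linear_0[OF linear_mop, of M] by simp
  with True show ?thesis by (simp add: norm_emb[symmetric])
next
  case False
  let ?x = "(1 / vec_norm2 x) \<cdot>\<^sub>v x"
  have "vec_norm2 ?x \<le> 1" using False by (simp add: vec_norm2_smult)
  then have "vec_norm2 (M *\<^sub>v ?x) \<le> spectral_norm M"
    unfolding spectral_norm_def using x by (intro cSup_upper spectral_norm_bdd) auto
  moreover have "M *\<^sub>v ?x = (1 / vec_norm2 x) \<cdot>\<^sub>v (M *\<^sub>v x)" using x by (intro mult_mat_vec) auto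
  ultimately have "vec_norm2 (M *\<^sub>v x) / vec_norm2 x \<le> spectral_norm M"
    by (simp add: vec_norm2_smult)
  with False show ?thesis by (simp add: pos_divide_le_eq order_less_le)
qed

lemma spectral_norm_pos:
  assumes M: "M \<in> carrier_mat m n" "M \<noteq> 0\<^sub>m m n"
  shows "0 < spectral_norm M"
proof -
  obtain i j where ij: "i < m" "j < n" "M $$ (i, j) \<noteq> 0"
    using M by (metis carrier_matD eq_matI index_zero_mat)
  let ?e = "unit_vec n j"
  have Me: "(M *\<^sub>v ?e) $ i = M $$ (i, j)" using ij M by simp
  have "0 < ((M *\<^sub>v ?e) $ i)\<^sup>2" using ij Me by simp
  also have "\<dots> \<le> (vec_norm2 (M *\<^sub>v ?e))\<^sup>2"
    unfolding vec_norm2_power2 using ij M by (intro member_le_sum) auto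
  finally have "0 < vec_norm2 (M *\<^sub>v ?e)" by (simp add: zero_less_power2 order_less_le)
  also have "\<dots> \<le> spectral_norm M * vec_norm2 ?e" using M by (intro spectral_norm_bound) auto
  finally show ?thesis by (simp add: zero_less_mult_iff)  (metis not_less vec_norm2_nonneg)
qed

lemma norm_mop_le:
  assumes "0 \<le> spectral_norm M"
  shows "norm (mop M x) \<le> spectral_norm M * norm x"
  unfolding mop_def norm_emb
  by (rule order_trans[OF spectral_norm_bound]) (auto intro: mult_left_mono norm_res_le assms)

lemma norm_mop_transpose_le:
  assumes "0 \<le> spectral_norm M"
  shows "norm (mop (transpose_mat M) y) \<le> spectral_norm M * norm y"
proof -
  let ?z = "mop (transpose_mat M) y"
  have "norm ?z * norm ?z = inner (mop M ?z) y"
    by (simp add: inner_mop power2_norm_eq_inner[symmetric] power2_eq_square)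
  also have "\<dots> \<le> norm (mop M ?z) * norm y" by (rule norm_cauchy_schwarz)
  also have "\<dots> \<le> (spectral_norm M * norm ?z) * norm y"
    by (intro mult_right_mono norm_mop_le assms) simp
  finally have "norm ?z * norm ?z \<le> norm ?z * (spectral_norm M * norm y)" by (simp add: mult_ac)
  then show ?thesis
    using assms by (cases "norm ?z = 0") (auto simp del: norm_eq_zero simp: mult_le_cancel_left)
qed

lemma max_norm_ge:
  assumes "i < dim_row M" "j < dim_col M"
  shows "\<bar>M $$ (i, j)\<bar> \<le> max_norm M"
proof -
  have "finite (elements_mat M)" by (simp add: elements_mat_def)
  moreover have "M $$ (i, j) \<in> elements_mat M" using assms by (force simp: elements_mat_def)
  ultimately show ?thesis unfolding max_norm_def by (intro Max_ge) auto
qed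

lemma max_norm_le:
  assumes "0 < dim_row M" "0 < dim_col M"
    and "\<And>i j. i < dim_row M \<Longrightarrow> j < dim_col M \<Longrightarrow> \<bar>M $$ (i, j)\<bar> \<le> b"
  shows "max_norm M \<le> b"
proof -
  have "finite (elements_mat M)" by (simp add: elements_mat_def)
  moreover have "elements_mat M \<noteq> {}" using assms(1,2) by (auto simp: elements_mat_def)
  ultimately show ?thesis unfolding max_norm_def using assms(3) by (subst Max_le_iff) (auto simp: elements_mat_def)
qed

lemma two_inf_norm_ge: "i < dim_row M \<Longrightarrow> vec_norm2 (row M i) \<le> two_inf_norm M"
  unfolding two_inf_norm_def by (intro Max_ge) auto

lemma two_inf_norm_le:
  "0 < dim_row M \<Longrightarrow> (\<And>i. i < dim_row M \<Longrightarrow> vec_norm2 (row M i) \<le> b) \<Longrightarrow> two_inf_norm M \<le> b"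
  unfolding two_inf_norm_def by (subst Max_le_iff) auto

lemma two_inf_norm_nonneg: "0 < dim_row M \<Longrightarrow> 0 \<le> two_inf_norm M"
  using two_inf_norm_ge[of 0 M] vec_norm2_nonneg order_trans by blast

section \<open>Hermitian dilation\<close>

definition dil :: "real mat \<Rightarrow> fseq \<times> fseq \<Rightarrow> fseq \<times> fseq" where
  "dil M z = (mop M (snd z), mop (transpose_mat M) (fst z))"

text \<open>The index \<open>(k, b)\<close> stands for the eigenvector of the dilation that belongs to the eigenvalue
  \<open>\<sigma> k\<close> (if \<open>b\<close>) or \<open>- \<sigma> k\<close> (if \<open>\<not> b\<close>).\<close>

definition sg :: "bool \<Rightarrow> real" where "sg b = (if b then 1 else - 1)"

definition svec :: "real mat \<Rightarrow> real mat \<Rightarrow> nat \<times> bool \<Rightarrow> fseq \<times> fseq" where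
  "svec U V k = ((1 / sqrt 2) *\<^sub>R emb (col U (fst k)), (sg (snd k) / sqrt 2) *\<^sub>R emb (col V (fst k)))"

definition sval :: "(nat \<Rightarrow> real) \<Rightarrow> nat \<times> bool \<Rightarrow> real" where
  "sval \<sigma> k = sg (snd k) * \<sigma> (fst k)"

lemma sg_mult: "sg b * sg b' = (if b = b' then 1 else - 1)" and abs_sg: "\<bar>sg b\<bar> = 1"
  by (auto simp: sg_def)

lemma linear_dil: "linear (dil M)"
  by (rule linearI) (simp_all add: dil_def linear_add[OF linear_mop] linear_scale[OF linear_mop])

lemma dil_sym: "inner (dil M u) v = inner u (dil M v)"
  by (simp add: dil_def inner_prod_def inner_mop[of M] inner_mop[of "transpose_mat M"])

lemma dil_add: "A \<in> carrier_mat m n \<Longrightarrow> B \<in> carrier_mat m n \<Longrightarrow> dil (A + B) z = dil A z + dil B z"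
  by (simp add: dil_def mop_add_mat[of _ m n] transpose_add[of _ m n] mop_add_mat[of _ n m])

lemma norm_dil_le:
  assumes "0 \<le> spectral_norm M"
  shows "norm (dil M z) \<le> spectral_norm M * norm z"
proof -
  have "(norm (dil M z))\<^sup>2 = (norm (mop M (snd z)))\<^sup>2 + (norm (mop (transpose_mat M) (fst z)))\<^sup>2"
    by (simp add: dil_def norm_prod_def)
  also have "\<dots> \<le> (spectral_norm M * norm (snd z))\<^sup>2 + (spectral_norm M * norm (fst z))\<^sup>2"
    by (intro add_mono power_mono norm_mop_le norm_mop_transpose_le assms norm_ge_zero)
  also have "\<dots> = (spectral_norm M * norm z)\<^sup>2"
    by (simp add: norm_prod_def power_mult_distrib algebra_simps)
  finally show ?thesis by (rule power2_le_imp_le) (simp add: assms)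
qed

lemma dil_emb:
  assumes "E \<in> carrier_mat m n" "u \<in> carrier_vec m" "v \<in> carrier_vec n"
  shows "dil E (\<alpha> *\<^sub>R emb u, \<beta> *\<^sub>R emb v) = (\<beta> *\<^sub>R emb (E *\<^sub>v v), \<alpha> *\<^sub>R emb (transpose_mat E *\<^sub>v u))"
  using assms by (simp add: dil_def linear_scale[OF linear_mop] mop_emb)

text \<open>Even powers of the dilation keep the two components apart and odd powers exchange them.
  This matches the two kinds of matrices inside each of \<open>tau1\<close> and
  \<open>tau2\<close>.\<close>

lemma dil_power_even:
  assumes E: "E \<in> carrier_mat m n" and u: "u \<in> carrier_vec m" and v: "v \<in> carrier_vec n"
  shows "(dil E ^^ (2 * a)) (\<alpha> *\<^sub>R emb u, \<beta> *\<^sub>R emb v)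
    = (\<alpha> *\<^sub>R emb ((E * transpose_mat E) ^\<^sub>m a *\<^sub>v u), \<beta> *\<^sub>R emb ((transpose_mat E * E) ^\<^sub>m a *\<^sub>v v))"
  using u v
proof (induction a arbitrary: u v)
  case 0
  then show ?case using E by simp
next
  case (Suc a)
  have Et: "transpose_mat E \<in> carrier_mat n m" using E by simp
  have c: "E *\<^sub>v v \<in> carrier_vec m" "transpose_mat E *\<^sub>v u \<in> carrier_vec n"
    "E *\<^sub>v (transpose_mat E *\<^sub>v u) \<in> carrier_vec m" "transpose_mat E *\<^sub>v (E *\<^sub>v v) \<in> carrier_vec n"
    using E Et Suc.prems by (auto intro!: mult_mat_vec_carrier)
  have sq: "E * transpose_mat E \<in> carrier_mat m m" "transpose_mat E * E \<in> carrier_mat n n"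
    using E by auto
  have pw: "(E * transpose_mat E) ^\<^sub>m a \<in> carrier_mat m m" "(transpose_mat E * E) ^\<^sub>m a \<in> carrier_mat n n"
    using sq by auto
  have "(dil E ^^ (2 * Suc a)) (\<alpha> *\<^sub>R emb u, \<beta> *\<^sub>R emb v)
      = (dil E ^^ (2 * a)) (dil E (dil E (\<alpha> *\<^sub>R emb u, \<beta> *\<^sub>R emb v)))"
    by (simp add: funpow_swap1)
  also have "dil E (dil E (\<alpha> *\<^sub>R emb u, \<beta> *\<^sub>R emb v))
      = (\<alpha> *\<^sub>R emb (E *\<^sub>v (transpose_mat E *\<^sub>v u)), \<beta> *\<^sub>R emb (transpose_mat E *\<^sub>v (E *\<^sub>v v)))"
    using dil_emb[OF E Suc.prems] dil_emb[OF E c(1,2)] by simp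
  also have "(dil E ^^ (2 * a)) \<dots>
      = (\<alpha> *\<^sub>R emb ((E * transpose_mat E) ^\<^sub>m a *\<^sub>v (E *\<^sub>v (transpose_mat E *\<^sub>v u))),
         \<beta> *\<^sub>R emb ((transpose_mat E * E) ^\<^sub>m a *\<^sub>v (transpose_mat E *\<^sub>v (E *\<^sub>v v))))"
    by (rule Suc.IH[OF c(3,4)])
  also have "(E * transpose_mat E) ^\<^sub>m a *\<^sub>v (E *\<^sub>v (transpose_mat E *\<^sub>v u))
      = (E * transpose_mat E) ^\<^sub>m Suc a *\<^sub>v u"
    using assoc_mult_mat_vec[OF pw(1) sq(1) Suc.prems(1)] assoc_mult_mat_vec[OF E Et Suc.prems(1)] by simp
  also have "(transpose_mat E * E) ^\<^sub>m a *\<^sub>v (transpose_mat E *\<^sub>v (E *\<^sub>v v))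
      = (transpose_mat E * E) ^\<^sub>m Suc a *\<^sub>v v"
    using assoc_mult_mat_vec[OF pw(2) sq(2) Suc.prems(2)] assoc_mult_mat_vec[OF Et E Suc.prems(2)] by simp
  finally show ?case .
qed

lemma dil_power_odd:
  assumes E: "E \<in> carrier_mat m n" and u: "u \<in> carrier_vec m" and v: "v \<in> carrier_vec n"
  shows "(dil E ^^ (2 * a + 1)) (\<alpha> *\<^sub>R emb u, \<beta> *\<^sub>R emb v)
    = (\<beta> *\<^sub>R emb ((E * transpose_mat E) ^\<^sub>m a *\<^sub>v (E *\<^sub>v v)),
       \<alpha> *\<^sub>R emb ((transpose_mat E * E) ^\<^sub>m a *\<^sub>v (transpose_mat E *\<^sub>v u)))"
proof -
  have c: "E *\<^sub>v v \<in> carrier_vec m" "transpose_mat E *\<^sub>v u \<in> carrier_vec n"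
    using E u v by (auto intro!: mult_mat_vec_carrier)
  have "(dil E ^^ (2 * a + 1)) z = (dil E ^^ (2 * a)) (dil E z)" for z
    by (simp add: funpow_swap1)
  then show ?thesis by (simp only: dil_emb[OF E u v] dil_power_even[OF E c])
qed

lemma power_sym:
  assumes "\<And>u v. inner (W u) v = inner u (W v)"
  shows "inner ((W ^^ k) u) v = inner u ((W ^^ k) v)"
proof (induction k arbitrary: v)
  case (Suc k)
  have "inner ((W ^^ Suc k) u) v = inner u ((W ^^ k) (W v))" by (simp add: assms Suc)
  then show ?case by (simp add: funpow_swap1)
qed simp

lemma sum_Times_bool:
  fixes f :: "nat \<times> bool \<Rightarrow> 'a::comm_monoid_add"
  shows "(\<Sum>l\<in>S \<times> UNIV. f l) = (\<Sum>i\<in>S. f (i, True) + f (i, False))"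
proof -
  have "(\<Sum>l\<in>S \<times> UNIV. f l) = (\<Sum>i\<in>S. \<Sum>b\<in>UNIV. f (i, b))"
    by (simp add: sum.cartesian_product)
  then show ?thesis by (simp add: UNIV_bool add.commute)
qed

lemma col_scalar_prod:
  assumes "U \<in> carrier_mat m k" "transpose_mat U * U = 1\<^sub>m k" "i < k" "j < k"
  shows "col U i \<bullet> col U j = (if i = j then 1 else 0)"
proof -
  have "(transpose_mat U * U) $$ (i, j) = col U i \<bullet> col U j" using assms(1,3,4) by simp
  then show ?thesis using assms by simp
qed

lemma inner_emb_col: "inner (emb (col U i)) (emb (col U j)) = col U i \<bullet> col U j"
  by (rule inner_emb[of _ "dim_row U"]) (auto intro: carrier_vecI)

lemma orthonormal_svec:
  assumes U: "U \<in> carrier_mat m k" "transpose_mat U * U = 1\<^sub>m k"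
    and V: "V \<in> carrier_mat n k" "transpose_mat V * V = 1\<^sub>m k"
  shows "orthonormal_on ({..<k} \<times> UNIV) (svec U V)"
proof -
  have "inner (svec U V (i, b)) (svec U V (j, b')) = (if (i, b) = (j, b') then 1 else 0)"
    if "i < k" "j < k" for i j b b'
  proof -
    have "inner (emb (col U i)) (emb (col U j)) = (if i = j then 1 else 0)"
      "inner (emb (col V i)) (emb (col V j)) = (if i = j then 1 else 0)"
      using col_scalar_prod[OF U that] col_scalar_prod[OF V that] U V
      by (simp_all add: inner_emb_col)
    then show ?thesis by (simp add: svec_def inner_prod_def sg_def)
  qed
  then show ?thesis by (auto simp: orthonormal_on_def)
qed

lemma mop_rank_one_sum:
  assumes U: "U \<in> carrier_mat m k" and V: "V \<in> carrier_mat n k"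
  shows "mop (rank_one_sum k U \<sigma> V) y = (\<Sum>i<k. (\<sigma> i * inner (emb (col V i)) y) *\<^sub>R emb (col U i))"
proof (rule fseq_eqI)
  fix a
  have V_in: "inner (emb (col V i)) y = (\<Sum>j<n. V $$ (j, i) * coord y j)" if "i < k" for i
    using that V by (simp add: inner_emb_res scalar_prod_def res_def lessThan_atLeast0)
  show "coord (mop (rank_one_sum k U \<sigma> V) y) a
      = coord (\<Sum>i<k. (\<sigma> i * inner (emb (col V i)) y) *\<^sub>R emb (col U i)) a"
  proof (cases "a < m")
    case True
    have "coord (mop (rank_one_sum k U \<sigma> V) y) a
        = (\<Sum>j<n. \<Sum>i<k. \<sigma> i * U $$ (a, i) * V $$ (j, i) * coord y j)"
      using U V True by (simp add: coord_mop rank_one_sum_def sum_distrib_right)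
    also have "\<dots> = (\<Sum>i<k. \<Sum>j<n. \<sigma> i * U $$ (a, i) * V $$ (j, i) * coord y j)" by (rule sum.swap)
    also have "\<dots> = (\<Sum>i<k. \<sigma> i * inner (emb (col V i)) y * U $$ (a, i))"
      by (intro sum.cong refl) (simp add: V_in sum_distrib_left sum_distrib_right mult_ac)
    finally show ?thesis using U True by (simp add: coord_emb)
  next
    case False
    then show ?thesis using U by (simp add: coord_mop coord_emb rank_one_sum_def)
  qed
qed

lemma transpose_rank_one_sum: "transpose_mat (rank_one_sum k U \<sigma> V) = rank_one_sum k V \<sigma> U"
  by (rule eq_matI) (auto simp: rank_one_sum_def mult_ac)

text \<open>The two eigenvectors of a singular triple carry opposite eigenvalues; their diagonal
  blocks cancel and the off-diagonal ones add up.\<close>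

lemma dil_svd:
  assumes "is_svd M k U \<sigma> V"
  shows "dil M z = (\<Sum>l\<in>{..<k} \<times> UNIV. (sval \<sigma> l * inner (svec U V l) z) *\<^sub>R svec U V l)"
proof -
  have U: "U \<in> carrier_mat (dim_row M) k" and V: "V \<in> carrier_mat (dim_col M) k"
    and M: "M = rank_one_sum k U \<sigma> V" using assms by (auto simp: is_svd_def)
  have Mt: "transpose_mat M = rank_one_sum k V \<sigma> U" by (subst M) (rule transpose_rank_one_sum)
  obtain a b where z: "z = (a, b)" by (cases z)
  have "(sval \<sigma> (i, True) * inner (svec U V (i, True)) z) *\<^sub>R svec U V (i, True)
      + (sval \<sigma> (i, False) * inner (svec U V (i, False)) z) *\<^sub>R svec U V (i, False)
      = ((\<sigma> i * inner (emb (col V i)) b) *\<^sub>R emb (col U i), (\<sigma> i * inner (emb (col U i)) a) *\<^sub>R emb (col V i))" for i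
    by (intro prod_eqI)
      (simp_all add: z svec_def sval_def sg_def inner_prod_def scaleR_add_left[symmetric] field_simps
        real_sqrt_mult[symmetric])
  then have "(\<Sum>l\<in>{..<k} \<times> UNIV. (sval \<sigma> l * inner (svec U V l) z) *\<^sub>R svec U V l)
      = (\<Sum>i<k. ((\<sigma> i * inner (emb (col V i)) b) *\<^sub>R emb (col U i), (\<sigma> i * inner (emb (col U i)) a) *\<^sub>R emb (col V i)))"
    by (simp add: sum_Times_bool)
  also have "\<dots> = (mop M b, mop (transpose_mat M) a)"
    unfolding Mt mop_rank_one_sum[OF V U] unfolding M mop_rank_one_sum[OF U V]
    by (simp add: sum_prod)
  finally show ?thesis by (simp add: dil_def z)
qed

text \<open>Yields \<open>r \<le> min m n\<close>, so that indices in \<open>S\<close> also name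
  singular vectors of the perturbed matrix.\<close>

lemma orthonormal_cols_le:
  fixes V :: "real mat"
  assumes V: "V \<in> carrier_mat n r" "transpose_mat V * V = 1\<^sub>m r"
  shows "r \<le> n"
proof (rule ccontr)
  assume "\<not> r \<le> n"
  then obtain c where c: "\<exists>k\<in>{..<r}. c k \<noteq> 0" "\<forall>l\<in>{..<n}. (\<Sum>k<r. c k * V $$ (l, k)) = 0"
    using underdetermined_system_nontrivial[of "{..<n}" "{..<r}" "\<lambda>k l. V $$ (l, k)"] by auto
  have on: "orthonormal_on {..<r} (\<lambda>i. emb (col V i))"
    using col_scalar_prod[OF V] V by (auto simp: orthonormal_on_def inner_emb_col)
  have "(\<Sum>k<r. c k *\<^sub>R emb (col V k)) = 0"
  proof (rule fseq_eqI)
    fix i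
    show "coord (\<Sum>k<r. c k *\<^sub>R emb (col V k)) i = coord 0 i"
      using c(2) V by (cases "i < n") (simp_all add: coord_emb)
  qed
  then have "L2_set c {..<r} = 0" using orthonormal_norm_sum[OF on, of c] by simp
  with c(1) show False by (auto simp: L2_set_eq_0_iff)
qed

text \<open>The squared row norms add up to \<open>r\<close>, so some row is not too short. This
  lower bound is what the Neumann remainder is later compared with.\<close>

lemma two_inf_norm_orthonormal_ge:
  assumes V: "V \<in> carrier_mat n r" "transpose_mat V * V = 1\<^sub>m r"
  shows "real r \<le> real n * (two_inf_norm V)\<^sup>2"
proof -
  have "real r = (\<Sum>i<r. col V i \<bullet> col V i)" using col_scalar_prod[OF V] by simp
  also have "\<dots> = (\<Sum>i<r. \<Sum>c<n. (V $$ (c, i))\<^sup>2)"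
    using V by (intro sum.cong refl) (auto simp: scalar_prod_def power2_eq_square lessThan_atLeast0)
  also have "\<dots> = (\<Sum>c<n. \<Sum>i<r. (V $$ (c, i))\<^sup>2)" by (rule sum.swap)
  also have "\<dots> = (\<Sum>c<n. (vec_norm2 (row V c))\<^sup>2)"
    using V by (intro sum.cong refl) (auto simp: vec_norm2_power2)
  also have "\<dots> \<le> (\<Sum>c<n. (two_inf_norm V)\<^sup>2)"
    using V by (intro sum_mono power_mono two_inf_norm_ge) auto
  finally show ?thesis by simp
qed

section \<open>The perturbed singular value decomposition\<close>

text \<open>Positivity of the gap has to be stated: division by zero yields 0, and a vanishing gap
  would satisfy both smallness conditions that divide by it.\<close>

locale svd_perturbation =
  fixes m n r :: nat and A E U V U' V' :: "real mat" and \<sigma> \<sigma>' :: "nat \<Rightarrow> real" and S :: "nat set"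
  assumes A: "A \<in> carrier_mat m n" and svd: "is_svd A r U \<sigma> V" and \<sigma>_pos: "\<And>i. i < r \<Longrightarrow> 0 < \<sigma> i"
    and \<sigma>_r: "\<sigma> r = 0" and E: "E \<in> carrier_mat m n" and E_nz: "E \<noteq> 0\<^sub>m m n"
    and svd': "is_svd (A + E) (min m n) U' \<sigma>' V'" and S_r: "S \<subseteq> {..<r}" and S_ne: "S \<noteq> {}"
    and \<Delta>_pos: "0 < Delta_S r \<sigma> S"
    and small_\<sigma>: "spectral_norm E / sigma_S \<sigma> S \<le> 1 / 8"
    and small_\<Delta>: "2 * real r * max_norm (transpose_mat U * E * V) / Delta_S r \<sigma> S \<le> 1 / 8"
    and small_mixed: "sqrt (2 * real r) * spectral_norm E / sqrt (Delta_S r \<sigma> S * sigma_S \<sigma> S) \<le> 1 / 8"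
begin

abbreviation e :: real where "e \<equiv> spectral_norm E"
abbreviation \<xi> :: real where "\<xi> \<equiv> max_norm (transpose_mat U * E * V)"
abbreviation y :: real where "y \<equiv> y_param E U V"
abbreviation \<sigma>S :: real where "\<sigma>S \<equiv> sigma_S \<sigma> S"
abbreviation \<Delta> :: real where "\<Delta> \<equiv> Delta_S r \<sigma> S"
abbreviation J :: "(nat \<times> bool) set" where "J \<equiv> {..<r} \<times> UNIV"
abbreviation L :: "(nat \<times> bool) set" where "L \<equiv> {..<min m n} \<times> UNIV"
abbreviation I :: "(nat \<times> bool) set" where "I \<equiv> S \<times> UNIV"
abbreviation p :: "nat \<times> bool \<Rightarrow> fseq \<times> fseq" where "p \<equiv> svec U V"
abbreviation x :: "nat \<times> bool \<Rightarrow> fseq \<times> fseq" where "x \<equiv> svec U' V'"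

lemma U: "U \<in> carrier_mat m r" "transpose_mat U * U = 1\<^sub>m r"
  and V: "V \<in> carrier_mat n r" "transpose_mat V * V = 1\<^sub>m r"
  and \<sigma>_mono: "i \<le> j \<Longrightarrow> j < r \<Longrightarrow> \<sigma> j \<le> \<sigma> i"
  using svd A by (auto simp: is_svd_def)

lemma U': "U' \<in> carrier_mat m (min m n)" "transpose_mat U' * U' = 1\<^sub>m (min m n)"
  and V': "V' \<in> carrier_mat n (min m n)" "transpose_mat V' * V' = 1\<^sub>m (min m n)"
  and \<sigma>'_nonneg: "i < min m n \<Longrightarrow> 0 \<le> \<sigma>' i"
  and \<sigma>'_mono: "i \<le> j \<Longrightarrow> j < min m n \<Longrightarrow> \<sigma>' j \<le> \<sigma>' i"
  using svd' A E by (auto simp: is_svd_def)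

lemma r_le: "r \<le> min m n"
  using orthonormal_cols_le[OF U] orthonormal_cols_le[OF V] by simp

lemma r_pos: "1 \<le> r" using S_r S_ne by force

lemma fin_S: "finite S" using S_r finite_subset by blast

lemma S_lt: "i \<in> S \<Longrightarrow> i < r" using S_r by auto

lemma e_pos: "0 < e" by (rule spectral_norm_pos[OF E E_nz])

lemma \<sigma>S_le: "i \<in> S \<Longrightarrow> \<sigma>S \<le> \<sigma> i"
  unfolding sigma_S_def using fin_S by simp

lemma \<sigma>S_pos: "0 < \<sigma>S"
  unfolding sigma_S_def using fin_S S_ne \<sigma>_pos S_lt by (subst Min_gr_iff) auto

lemma finite_gaps: "finite {\<bar>\<sigma> i - \<sigma> j\<bar> |i j. i \<in> S \<and> j \<in> {..r} - S}"
proof -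
  have "{\<bar>\<sigma> i - \<sigma> j\<bar> |i j. i \<in> S \<and> j \<in> {..r} - S} = (\<lambda>(i, j). \<bar>\<sigma> i - \<sigma> j\<bar>) ` (S \<times> ({..r} - S))"
    by auto
  then show ?thesis using fin_S by simp
qed

lemma \<Delta>_le: "i \<in> S \<Longrightarrow> j \<in> {..r} - S \<Longrightarrow> \<Delta> \<le> \<bar>\<sigma> i - \<sigma> j\<bar>"
  unfolding Delta_S_def using finite_gaps by (intro Min_le) auto

text \<open>The index \<open>r\<close> with \<open>\<sigma> r = 0\<close> never belongs to
  \<open>S\<close>, so the distance to 0 is among the gaps.\<close>

lemma \<Delta>_le_\<sigma>S: "\<Delta> \<le> \<sigma>S"
proof -
  have "\<Delta> \<le> \<sigma> i" if "i \<in> S" for i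
    using \<Delta>_le[OF that, of r] S_r \<sigma>_r \<sigma>_pos[OF S_lt[OF that]] by auto
  then show ?thesis unfolding sigma_S_def using fin_S S_ne by simp
qed

lemma e_le: "e \<le> \<sigma>S / 8" using small_\<sigma> \<sigma>S_pos by (simp add: field_simps)

lemma \<xi>_le: "2 * real r * \<xi> \<le> \<Delta> / 8" using small_\<Delta> \<Delta>_pos by (simp add: field_simps)

lemma e_square_le: "2 * real r * e\<^sup>2 \<le> \<Delta> * \<sigma>S / 64"
proof -
  have pos: "0 < \<Delta> * \<sigma>S" using \<Delta>_pos \<sigma>S_pos by simp
  have "sqrt (2 * real r) * e \<le> sqrt (\<Delta> * \<sigma>S) / 8"
    using small_mixed pos by (simp add: field_simps)
  then have "(sqrt (2 * real r) * e)\<^sup>2 \<le> (sqrt (\<Delta> * \<sigma>S) / 8)\<^sup>2"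
    using e_pos by (intro power_mono) auto
  then show ?thesis using pos by (simp add: power_mult_distrib power_divide)
qed

lemma cols [simp]: "col U i \<in> carrier_vec m" "col V i \<in> carrier_vec n"
  "E *\<^sub>v col V i \<in> carrier_vec m" "transpose_mat E *\<^sub>v col U i \<in> carrier_vec n"
  using U V E by (auto intro!: carrier_vecI)

lemma dil_E_p: "dil E (p (i, b)) = ((sg b / sqrt 2) *\<^sub>R emb (E *\<^sub>v col V i), (1 / sqrt 2) *\<^sub>R emb (transpose_mat E *\<^sub>v col U i))"
  unfolding svec_def by (simp add: dil_emb[OF E])

lemma signed_half_le: "\<bar>(sg b * a + sg b' * c) / 2\<bar> \<le> (\<bar>a\<bar> + \<bar>c\<bar>) / 2"
  by (auto simp: sg_def)

lemma entry_UEV: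
  assumes "i < r" "j < r"
  shows "\<bar>col U i \<bullet> (E *\<^sub>v col V j)\<bar> \<le> \<xi>"
proof -
  have "(transpose_mat U * E * V) $$ (i, j) = (transpose_mat U * (E * V)) $$ (i, j)"
    using U V E by (subst assoc_mult_mat[of _ r m _ n _ r]) auto
  also have "\<dots> = col U i \<bullet> col (E * V) j" using assms U V E by simp
  also have "col (E * V) j = E *\<^sub>v col V j" using assms by (intro col_mult2[OF E V(1)])
  finally have "(transpose_mat U * E * V) $$ (i, j) = col U i \<bullet> (E *\<^sub>v col V j)" .
  then show ?thesis using max_norm_ge[of i "transpose_mat U * E * V" j] assms U V by simp
qed

lemma inner_p_dil_p:
  assumes "j \<in> J" "k \<in> J"
  shows "\<bar>inner (p j) (dil E (p k))\<bar> \<le> \<xi>"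
proof -
  obtain i b i' b' where jk: "j = (i, b)" "k = (i', b')" by (cases j, cases k)
  have lt: "i < r" "i' < r" using assms jk by auto
  have "inner (emb (col V i)) (emb (transpose_mat E *\<^sub>v col U i')) = col V i \<bullet> (transpose_mat E *\<^sub>v col U i')"
    by (rule inner_emb[of _ n]) simp_all
  also have "\<dots> = (transpose_mat E *\<^sub>v col U i') \<bullet> col V i"
    by (rule comm_scalar_prod[of _ n]) simp_all
  also have "\<dots> = col U i' \<bullet> (E *\<^sub>v col V i)" by (rule transpose_vec_mult_scalar[OF E]) simp_all
  finally have 1: "inner (emb (col V i)) (emb (transpose_mat E *\<^sub>v col U i')) = col U i' \<bullet> (E *\<^sub>v col V i)" .
  have 2: "inner (emb (col U i)) (emb (E *\<^sub>v col V i')) = col U i \<bullet> (E *\<^sub>v col V i')"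
    by (rule inner_emb[of _ m]) simp_all
  have eq: "inner (p j) (dil E (p k)) = (sg b' * (col U i \<bullet> (E *\<^sub>v col V i')) + sg b * (col U i' \<bullet> (E *\<^sub>v col V i))) / 2"
    unfolding jk dil_E_p by (simp add: svec_def inner_prod_def 1 2 field_simps)
  show ?thesis
    unfolding eq using entry_UEV[OF lt] entry_UEV[OF lt(2,1)]
    by (intro order_trans[OF signed_half_le]) simp
qed

lemma y_nonneg: "0 \<le> y"
  and y_param_bound: "i < r \<Longrightarrow> j < r \<Longrightarrow> i \<noteq> j \<Longrightarrow>
    \<bar>col U i \<bullet> ((E * transpose_mat E) *\<^sub>v col U j)\<bar> + \<bar>col V i \<bullet> ((transpose_mat E * E) *\<^sub>v col V j)\<bar> \<le> 2 * y"
proof -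
  let ?f = "\<lambda>(i, j). \<bar>col U i \<bullet> ((E * transpose_mat E) *\<^sub>v col U j)\<bar> + \<bar>col V i \<bullet> ((transpose_mat E * E) *\<^sub>v col V j)\<bar>"
  let ?Y = "{\<bar>col U i \<bullet> ((E * transpose_mat E) *\<^sub>v col U j)\<bar> + \<bar>col V i \<bullet> ((transpose_mat E * E) *\<^sub>v col V j)\<bar>
      | i j. i < dim_col U \<and> j < dim_col U \<and> i \<noteq> j}"
  have "?Y \<subseteq> ?f ` ({..<dim_col U} \<times> {..<dim_col U})" by auto
  then have fin: "finite (insert 0 ?Y)" using finite_subset by blast
  show "0 \<le> y" using Max_ge[OF fin, of 0] by (simp add: y_param_def)
  assume "i < r" "j < r" "i \<noteq> j"
  then have "?f (i, j) \<in> insert 0 ?Y" using U by auto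
  from Max_ge[OF fin this]
  show "\<bar>col U i \<bullet> ((E * transpose_mat E) *\<^sub>v col U j)\<bar> + \<bar>col V i \<bullet> ((transpose_mat E * E) *\<^sub>v col V j)\<bar> \<le> 2 * y"
    by (simp add: y_param_def)
qed

text \<open>Up to a sign the inner product is the mean of an entry of
  \<open>V\<^sup>TE\<^sup>TEV\<close> and one of \<open>U\<^sup>TEE\<^sup>TU\<close>; the factor 1/2
  in \<open>y_param\<close> is this mean.\<close>

lemma inner_dil_p_dil_p:
  assumes "j \<in> J" "k \<in> J" "fst j \<noteq> fst k"
  shows "\<bar>inner (dil E (p j)) (dil E (p k))\<bar> \<le> y"
proof -
  obtain i b i' b' where jk: "j = (i, b)" "k = (i', b')" by (cases j, cases k)
  have lt: "i < r" "i' < r" "i \<noteq> i'" using assms jk by auto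
  have Et: "transpose_mat E \<in> carrier_mat n m" using E by simp
  have "inner (emb (E *\<^sub>v col V i)) (emb (E *\<^sub>v col V i')) = (E *\<^sub>v col V i) \<bullet> (E *\<^sub>v col V i')"
    by (rule inner_emb[of _ m]) simp_all
  also have "\<dots> = (transpose_mat E *\<^sub>v (E *\<^sub>v col V i')) \<bullet> col V i"
    by (subst transpose_vec_mult_scalar[OF E]) (auto intro: comm_scalar_prod[of _ m])
  also have "\<dots> = col V i \<bullet> (transpose_mat E *\<^sub>v (E *\<^sub>v col V i'))"
    using Et by (intro comm_scalar_prod[of _ n]) (auto intro!: mult_mat_vec_carrier)
  finally have 1: "inner (emb (E *\<^sub>v col V i)) (emb (E *\<^sub>v col V i')) = col V i \<bullet> ((transpose_mat E * E) *\<^sub>v col V i')"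
    using assoc_mult_mat_vec[OF Et E] by simp
  have "inner (emb (transpose_mat E *\<^sub>v col U i)) (emb (transpose_mat E *\<^sub>v col U i'))
      = (transpose_mat E *\<^sub>v col U i) \<bullet> (transpose_mat E *\<^sub>v col U i')"
    by (rule inner_emb[of _ n]) simp_all
  also have "\<dots> = col U i \<bullet> (E *\<^sub>v (transpose_mat E *\<^sub>v col U i'))"
    by (rule transpose_vec_mult_scalar[OF E]) simp_all
  finally have 2: "inner (emb (transpose_mat E *\<^sub>v col U i)) (emb (transpose_mat E *\<^sub>v col U i'))
      = col U i \<bullet> ((E * transpose_mat E) *\<^sub>v col U i')"
    using assoc_mult_mat_vec[OF E Et] by simp
  have "inner (dil E (p j)) (dil E (p k)) = ((sg b * sg b') * (col V i \<bullet> ((transpose_mat E * E) *\<^sub>v col V i'))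
      + col U i \<bullet> ((E * transpose_mat E) *\<^sub>v col U i')) / 2"
    unfolding jk dil_E_p by (simp add: inner_prod_def 1 2 field_simps)
  then show ?thesis using y_param_bound[OF lt] by (auto simp: sg_mult split: if_splits)
qed

sublocale spectral_pair J L p x "sval \<sigma>" "sval \<sigma>'" "dil E" e \<xi>
proof
  show "orthonormal_on J p" by (rule orthonormal_svec[OF U V])
  show "orthonormal_on L x" by (rule orthonormal_svec[OF U' V'])
  show "(\<Sum>j\<in>J. (sval \<sigma> j * inner (p j) v) *\<^sub>R p j) + dil E v = (\<Sum>l\<in>L. (sval \<sigma>' l * inner (x l) v) *\<^sub>R x l)" for v
    unfolding dil_svd[OF svd, symmetric] dil_svd[OF svd', symmetric] by (rule dil_add[OF A E, symmetric])
qed (rule linear_add[OF linear_dil] linear_scale[OF linear_dil] dil_sym norm_dil_le inner_p_dil_p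
    less_imp_le[OF e_pos] | assumption)+

lemma d_eq: "d = 2 * real r" by (simp add: card_cartesian_product card_UNIV_bool)

text \<open>Both eigenvalue comparisons, with the total error split evenly: \<open>d * \<xi>\<close>
  and the second-order term cost at most \<open>\<Delta> / 8\<close> each.\<close>

lemma singular_value_close:
  assumes i: "i \<in> S"
  shows "\<bar>\<sigma>' i - \<sigma> i\<bar> \<le> \<Delta> / 4" and "\<sigma> i - \<Delta> / 8 \<le> \<sigma>' i"
proof -
  have lt: "i < r" "i < min m n" using S_lt[OF i] r_le by auto
  have e_i: "e < \<sigma> i" using e_le \<sigma>S_le[OF i] \<sigma>S_pos by simp
  have "\<sigma> i - d * \<xi> \<le> \<sigma>' i"
  \<comment> \<open>Counting from 0, the eigenvalues up to index \<open>i\<close> are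
    \<open>i + 1\<close> many and face only \<open>i\<close> constraints. Negative eigenvalues of
    the dilation satisfy the upper bound trivially.\<close>
  proof (rule eigenvalue_lower_bound[where A = "{..i} \<times> {True}" and B = "{..<i} \<times> {True}"])
    show "\<sigma> i \<le> sval \<sigma> j" if "j \<in> {..i} \<times> {True}" for j
      using that \<sigma>_mono[of "fst j" i] lt by (auto simp: sval_def sg_def)
    show "sval \<sigma>' l \<le> \<sigma>' i" if "l \<in> L - {..<i} \<times> {True}" for l
    proof (cases "snd l")
      case True
      then have "i \<le> fst l" "fst l < min m n" using that by (cases l, auto)+
      then show ?thesis using \<sigma>'_mono[of i "fst l"] True by (simp add: sval_def sg_def)
    next
      case False
      have "fst l < min m n" using that by (cases l) auto
      then show ?thesis using \<sigma>'_nonneg[of "fst l"] \<sigma>'_nonneg[OF lt(2)] False by (simp add: sval_def sg_def)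
    qed
  qed (use lt \<sigma>'_nonneg in \<open>auto simp: card_cartesian_product\<close>)
  then show lower: "\<sigma> i - \<Delta> / 8 \<le> \<sigma>' i" using \<xi>_le by (simp only: d_eq)
  have "\<sigma>' i \<le> \<sigma> i + d * \<xi> + e\<^sup>2 / (\<sigma> i - e)"
  proof (rule eigenvalue_upper_bound[where A = "{..i} \<times> {True}" and B = "{..<i} \<times> {True}", OF _ _ _ _ _ e_i])
    show "\<sigma>' i \<le> sval \<sigma>' j" if "j \<in> {..i} \<times> {True}" for j
      using that \<sigma>'_mono[of "fst j" i] lt by (auto simp: sval_def sg_def)
    show "sval \<sigma> l \<le> \<sigma> i" if "l \<in> J - {..<i} \<times> {True}" for l
    proof (cases "snd l")
      case True
      then have "i \<le> fst l" "fst l < r" using that by (cases l, auto)+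
      then show ?thesis using \<sigma>_mono[of i "fst l"] True by (simp add: sval_def sg_def)
    next
      case False
      have "fst l < r" using that by (cases l) auto
      then show ?thesis using \<sigma>_pos[of "fst l"] \<sigma>_pos[OF lt(1)] False by (simp add: sval_def sg_def)
    qed
  qed (use lt in \<open>auto simp: card_cartesian_product\<close>)
  \<comment> \<open>Since \<open>e \<le> \<sigma>S / 8\<close>, the denominator is at least
    \<open>\<sigma>S / 2\<close>; the mixed smallness condition then controls
    \<open>e\<^sup>2\<close>.\<close>
  moreover have "e\<^sup>2 / (\<sigma> i - e) \<le> \<Delta> / 8"
  proof -
    have "2 * e\<^sup>2 \<le> 2 * real r * e\<^sup>2" using r_pos by (intro mult_right_mono) auto
    then have "e\<^sup>2 \<le> \<Delta> * \<sigma>S / 128" using e_square_le by simp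
    also have "\<dots> \<le> \<Delta> / 8 * (\<sigma>S / 2)" using \<Delta>_pos \<sigma>S_pos by simp
    also have "\<dots> \<le> \<Delta> / 8 * (\<sigma> i - e)"
      using \<Delta>_pos e_le \<sigma>S_le[OF i] \<sigma>S_pos by (intro mult_left_mono) auto
    finally show ?thesis using e_i by (simp add: pos_divide_le_eq)
  qed
  ultimately show "\<bar>\<sigma>' i - \<sigma> i\<bar> \<le> \<Delta> / 4" using \<xi>_le lower \<Delta>_pos unfolding d_eq by linarith
qed

text \<open>A perturbed selected singular value loses at most
  \<open>\<Delta> / 8 \<le> \<sigma>S / 8\<close>, whence 7/8, and moves by at most
  \<open>\<Delta> / 4\<close>, whence 3/4. The condition \<open>e \<le> \<sigma>S / 8\<close> then
  becomes exactly \<open>e \<le> s / 7\<close>.\<close>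

sublocale spectral_perturbation J L p x "sval \<sigma>" "sval \<sigma>'" "dil E" e \<xi>
  I "\<lambda>(k, b). (k, \<not> b)" "7 / 8 * \<sigma>S" "3 / 4 * \<Delta>" y
proof
  show "I \<subseteq> J" "I \<subseteq> L" using S_lt r_le by force+
  show "0 < 7 / 8 * \<sigma>S" "e \<le> 7 / 8 * \<sigma>S / 7" "0 < 3 / 4 * \<Delta>" "0 \<le> y"
    using \<sigma>S_pos e_le \<Delta>_pos y_nonneg by auto
  have large: "7 / 8 * \<sigma>S \<le> \<sigma>' i" if "i \<in> S" for i
    using singular_value_close(2)[OF that] \<sigma>S_le[OF that] \<Delta>_le_\<sigma>S by simp
  show "7 / 8 * \<sigma>S \<le> \<bar>sval \<sigma>' l\<bar>" if "l \<in> I" for l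
    using large[of "fst l"] that by (auto simp: sval_def abs_mult abs_sg)
  show "3 / 4 * \<Delta> \<le> \<bar>sval \<sigma>' l - sval \<sigma> j\<bar>" if "l \<in> I" "j \<in> J - I" for l j
  proof -
    obtain i b k b' where lj: "l = (i, b)" "j = (k, b')" by (cases l, cases j)
    have ik: "i \<in> S" "k \<in> {..r} - S" "k < r" using that lj by auto
    have "3 / 4 * \<Delta> \<le> \<bar>\<sigma>' i - \<sigma> k\<bar>" using \<Delta>_le[OF ik(1,2)] singular_value_close(1)[OF ik(1)] by linarith
    \<comment> \<open>Eigenvalues of opposite sign are at least \<open>7 / 8 * \<sigma>S\<close>
      apart, which exceeds the required gap because \<open>\<Delta> \<le> \<sigma>S\<close>.\<close>
    moreover have "3 / 4 * \<Delta> \<le> \<sigma>' i + \<sigma> k" using large[OF ik(1)] \<sigma>_pos[OF ik(3)] \<Delta>_le_\<sigma>S \<Delta>_pos by linarith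
    moreover have "\<bar>sval \<sigma>' l - sval \<sigma> j\<bar> = (if b = b' then \<bar>\<sigma>' i - \<sigma> k\<bar> else \<bar>\<sigma>' i + \<sigma> k\<bar>)"
      by (auto simp: lj sval_def sg_def abs_real_def)
    ultimately show ?thesis using abs_ge_self[of "\<sigma>' i + \<sigma> k"] by (cases "b = b'") simp_all
  qed
  show "\<bar>inner (dil E (p j)) (dil E (p k))\<bar> \<le> y"
    if "j \<in> J" "k \<in> J" "k \<noteq> j" "k \<noteq> (\<lambda>(k, b). (k, \<not> b)) j" for j k
    using that by (intro inner_dil_p_dil_p) (cases j; cases k; auto)+
qed auto

section \<open>The overlap in terms of the error of the theorem\<close>

definition \<epsilon> :: real where
  "\<epsilon> = e / \<sigma>S + 2 * real r * \<xi> / \<Delta> + 2 * real r * y / (\<Delta> * \<sigma>S)"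

lemma \<xi>_nonneg': "0 \<le> \<xi>" using \<xi>_nonneg[of "(0, True)"] r_pos by simp

lemma \<epsilon>_ge: "e / \<sigma>S \<le> \<epsilon>" and \<epsilon>_nonneg: "0 \<le> \<epsilon>"
  using \<xi>_nonneg' y_nonneg \<Delta>_pos \<sigma>S_pos e_pos by (auto simp: \<epsilon>_def)

lemma q_eq: "q = 8 / 7 * (e / \<sigma>S)" unfolding q_def by simp

lemma leak_le: "leak \<le> 3 * \<epsilon>"
proof -
  let ?D = "2 * real r" and ?a = "e / \<sigma>S"
  have D: "2 \<le> ?D" using r_pos by simp
  have De: "?D * e\<^sup>2 / (7 / 8 * \<sigma>S) \<le> \<Delta> / 56"
    using e_square_le \<sigma>S_pos by (simp add: field_simps)
  have "2 * e\<^sup>2 / (7 / 8 * \<sigma>S) \<le> ?D * e\<^sup>2 / (7 / 8 * \<sigma>S)"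
    using r_pos \<sigma>S_pos by (intro divide_right_mono mult_right_mono) auto
  with De have "2 * e\<^sup>2 / (7 / 8 * \<sigma>S) \<le> \<Delta> / 56" by linarith
  \<comment> \<open>Absorbing the diagonal and partner terms leaves \<open>3/4 - 1/56\<close> of
    \<Delta>, more than one half.\<close>
  then have "\<Delta> / 2 * leak \<le> (3 / 4 * \<Delta> - 2 * e\<^sup>2 / (7 / 8 * \<sigma>S)) * leak"
    using \<Delta>_pos leak_nonneg by (intro mult_right_mono) auto
  also have "\<dots> \<le> ?D * \<xi> * (1 + q) + ?D * y / (7 / 8 * \<sigma>S) + sqrt ?D * e ^ 3 / (7 / 8 * \<sigma>S)\<^sup>2"
    using leak_bound by (simp only: d_eq)
  also have "?D * \<xi> * (1 + q) \<le> ?D * \<xi> * (8 / 7)"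
    using q_le \<xi>_nonneg' by (intro mult_left_mono) auto
  \<comment> \<open>The cubic term: one factor \<open>e\<close> goes into \<open>q\<close>, and the
    mixed smallness condition lets \<Delta> pay for the other two.\<close>
  also have "sqrt ?D * e ^ 3 / (7 / 8 * \<sigma>S)\<^sup>2 \<le> q * (\<Delta> / 56)"
  proof -
    have "sqrt ?D \<le> ?D" using D by (intro real_le_lsqrt) (auto simp: power2_eq_square)
    then have "q * (sqrt ?D * e\<^sup>2 / (7 / 8 * \<sigma>S)) \<le> q * (?D * e\<^sup>2 / (7 / 8 * \<sigma>S))"
      using q_nonneg \<sigma>S_pos by (intro mult_left_mono divide_right_mono mult_right_mono) auto
    also have "\<dots> \<le> q * (\<Delta> / 56)" using De q_nonneg by (intro mult_left_mono) auto
    finally show ?thesis unfolding q_def by (simp add: power2_eq_square power3_eq_cube mult_ac)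
  qed
  finally have "\<Delta> / 2 * leak \<le> ?D * \<xi> * (8 / 7) + ?D * y / (7 / 8 * \<sigma>S) + q * (\<Delta> / 56)" by simp
  then have "leak \<le> (?D * \<xi> * (8 / 7) + ?D * y / (7 / 8 * \<sigma>S) + q * (\<Delta> / 56)) / (\<Delta> / 2)"
    using \<Delta>_pos by (simp add: pos_le_divide_eq mult.commute)
  also have "\<dots> = 16 / 7 * (?D * \<xi> / \<Delta>) + 16 / 7 * (?D * y / (\<Delta> * \<sigma>S)) + 2 / 49 * ?a"
    unfolding q_eq using \<Delta>_pos \<sigma>S_pos by (simp add: add_divide_distrib mult_ac)
  also have "\<dots> \<le> 3 * \<epsilon>"
  proof -
    have "0 \<le> ?D * \<xi> / \<Delta>" "0 \<le> ?D * y / (\<Delta> * \<sigma>S)" "0 \<le> ?a"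
      using \<xi>_nonneg' y_nonneg \<Delta>_pos \<sigma>S_pos e_pos by auto
    moreover have "16 / 7 * u + 16 / 7 * v + 2 / 49 * w \<le> 3 * (w + u + v)"
      if "0 \<le> u" "0 \<le> v" "0 \<le> w" for u v w :: real
      using that by simp
    ultimately show ?thesis unfolding \<epsilon>_def by blast
  qed
  finally show ?thesis .
qed

lemma projection_entry_bound_\<epsilon>:
  assumes "delocalized K f t" "delocalized K' f' t'"
  shows "\<bar>inner f (T0 f') - inner f (PI f')\<bar> \<le> 30 * \<epsilon> * t * t'"
proof -
  \<comment> \<open>\<open>12 * (8/7) + 4 * 3\<close> is below 30.\<close>
  have "12 * q + 4 * leak \<le> 30 * \<epsilon>" using q_eq \<epsilon>_ge leak_le \<epsilon>_nonneg by linarith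
  then have "(12 * q + 4 * leak) * t * t' \<le> 30 * \<epsilon> * t * t'"
    using assms[unfolded delocalized_def] by (intro mult_right_mono) auto
  with projection_entry_bound[OF assms] show ?thesis by linarith
qed

end

section \<open>Entries of the projections and truncations attached to \<open>S\<close>\<close>

lemma bij_betw_pick:
  assumes "finite S"
  shows "bij_betw (pick S) {..<card S} S"
proof -
  have "inj_on (pick S) {..<card S}" 
    by (rule linorder_inj_onI') (metis less_irrefl lessThan_iff pick_mono_le)
  moreover have "pick S ` {..<card S} \<subseteq> S" using pick_in_set_le by auto
  ultimately show ?thesis
    by (simp add: bij_betw_def card_image card_subset_eq assms)
qed

lemma select_cols_gram:
  assumes V: "V \<in> carrier_mat n k" and S: "S \<subseteq> {..<k}" and ab: "a < n" "b < n"
  shows "(select_cols V S * transpose_mat (select_cols V S)) $$ (a, b) = (\<Sum>i\<in>S. V $$ (a, i) * V $$ (b, i))"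
proof -
  have fin: "finite S" using S finite_subset by blast
  have set: "{j. j < k \<and> j \<in> S} = S" "{i. i < n} = {..<n}" using S by auto
  have dims: "dim_row (select_cols V S) = n" "dim_col (select_cols V S) = card S"
    using V by (auto simp: select_cols_def dim_submatrix set)
  have entry: "select_cols V S $$ (c, j) = V $$ (c, pick S j)" if "c < n" "j < card S" for c j
    using that V unfolding select_cols_def by (subst submatrix_index) (auto simp: set pick_UNIV)
  have "(select_cols V S * transpose_mat (select_cols V S)) $$ (a, b)
      = (\<Sum>j<card S. V $$ (a, pick S j) * V $$ (b, pick S j))"
    using ab dims entry by (simp add: scalar_prod_def lessThan_atLeast0)
  also have "\<dots> = (\<Sum>i\<in>S. V $$ (a, i) * V $$ (b, i))"
    by (rule sum.reindex_bij_betw[OF bij_betw_pick[OF fin], of "\<lambda>i. V $$ (a, i) * V $$ (b, i)"])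
  finally show ?thesis .
qed

lemma dim_row_select_cols: "dim_row (select_cols V S) = dim_row V"
  by (simp add: select_cols_def dim_submatrix)

lemma inner_emb_unit:
  assumes "w \<in> carrier_vec n" "c < n"
  shows "inner (emb w) (emb (unit_vec n c)) = w $ c"
  using assms by (simp add: inner_emb[of _ n])

lemma inner_svec_snd:
  assumes "Q \<in> carrier_mat n k"  "w \<in> carrier_vec n"
  shows "inner (svec P Q (i, b)) (0, emb w) = sg b / sqrt 2 * (col Q i \<bullet> w)"
  using assms inner_emb[of "col Q i" n w] by (auto simp: svec_def inner_prod_def intro: carrier_vecI)

lemma inner_svec_fst:
  assumes "P \<in> carrier_mat m k"  "w \<in> carrier_vec m"
  shows "inner (svec P Q (i, b)) (emb w, 0) = 1 / sqrt 2 * (col P i \<bullet> w)"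
  using assms inner_emb[of "col P i" m w] by (auto simp: svec_def inner_prod_def intro: carrier_vecI)

text \<open>For each index the two signs contribute one half each to the lower diagonal block, which
  is why selecting both signs recovers the projection onto the right singular vectors.\<close>

lemma projection_svec_entry:
  assumes Q: "Q \<in> carrier_mat n k" and S: "S \<subseteq> {..<k}" and c: "c < n" and w: "w \<in> carrier_vec n"
  shows "inner (0, emb (unit_vec n c)) (proj (S \<times> UNIV) (svec P Q) (0, emb w))
    = (\<Sum>b<n. (\<Sum>i\<in>S. Q $$ (c, i) * Q $$ (b, i)) * w $ b)"
proof -
  have "inner (0, emb (unit_vec n c)) (proj (S \<times> UNIV) (svec P Q) (0, emb w))
      = (\<Sum>i\<in>S. Q $$ (c, i) * (col Q i \<bullet> w))"
    unfolding inner_proj_sum sum_Times_bool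
    using Q S c by (intro sum.cong refl) (auto simp: inner_svec_snd[OF Q] w sg_def)
  also have "\<dots> = (\<Sum>i\<in>S. \<Sum>b<n. Q $$ (c, i) * Q $$ (b, i) * w $ b)"
    using Q S w by (intro sum.cong refl) (auto simp: scalar_prod_def sum_distrib_left lessThan_atLeast0 mult.assoc intro!: sum.cong)
  also have "\<dots> = (\<Sum>b<n. (\<Sum>i\<in>S. Q $$ (c, i) * Q $$ (b, i)) * w $ b)"
    by (subst sum.swap) (simp add: sum_distrib_right)
  finally show ?thesis .
qed

text \<open>In the off-diagonal block the sign of the eigenvalue cancels the sign in the second
  component, so the two halves add up to the truncated decomposition.\<close>

lemma sval_svec_entry:
  assumes P: "P \<in> carrier_mat m k" and Q: "Q \<in> carrier_mat n k" and S: "S \<subseteq> {..<k}" and ab: "a < m" "b < n"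
  shows "(\<Sum>l\<in>S \<times> UNIV. sval \<tau> l * inner (svec P Q l) (emb (unit_vec m a), 0) * inner (svec P Q l) (0, emb (unit_vec n b)))
    = (\<Sum>i\<in>S. \<tau> i * P $$ (a, i) * Q $$ (b, i))"
  unfolding sum_Times_bool
  using P Q S ab by (intro sum.cong refl) (auto simp: inner_svec_snd[OF Q] inner_svec_fst[OF P] sval_def sg_def)

section \<open>Delocalization of the coordinate vectors\<close>

context svd_perturbation
begin

text \<open>The number of consecutive powers of the dilation that \<open>tau1\<close> and
  \<open>tau2\<close> control: the exponents \<open>2 * a\<close> and \<open>2 * a + 1\<close> for
  every admissible \<open>a\<close>, including 0.\<close>

definition K :: nat where "K = 2 * nat \<lfloor>10 * ln (real (m + n))\<rfloor> + 2"

lemma mn: "0 < m" "0 < n" using r_pos r_le by auto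

text \<open>The base is at most \<open>1/7\<close>, hence below \<open>exp (- 1)\<close>, and the
  exponent \<open>K - 1\<close> exceeds \<open>ln (m + n)\<close>.\<close>

lemma q_power_le: "q ^ (K - 1) \<le> 1 / real (m + n)"
proof -
  define l where "l = nat \<lfloor>10 * ln (real (m + n))\<rfloor>"
  have ln0: "0 \<le> ln (real (m + n))" using mn by simp
  have "10 * ln (real (m + n)) < real l + 1" unfolding l_def by linarith
  then have "ln (real (m + n)) \<le> real (2 * l + 1)" using ln0 by simp
  then have "exp (- real (2 * l + 1)) \<le> exp (- ln (real (m + n)))" by simp
  also have "\<dots> = 1 / real (m + n)" using mn by (simp add: exp_minus inverse_eq_divide)
  finally have 1: "exp (- real (2 * l + 1)) \<le> 1 / real (m + n)" .
  have "q \<le> exp (- 1)"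
  proof -
    have "1 / 3 \<le> exp (- 1 :: real)" using exp_le by (simp add: exp_minus inverse_eq_divide frac_le)
    then show ?thesis using q_le by linarith
  qed
  then have "q ^ (2 * l + 1) \<le> exp (- 1) ^ (2 * l + 1)" using q_nonneg by (intro power_mono)
  also have "\<dots> = exp (- real (2 * l + 1))" by (simp only: exp_of_nat_mult[symmetric]) simp
  finally show ?thesis using 1 by (simp add: K_def l_def)
qed

lemma delocalizedI:
  assumes f: "norm f = 1" and t: "0 \<le> t" "1 \<le> real (m + n) * t\<^sup>2"
    and even: "\<And>a. a \<in> tau_range E \<Longrightarrow> norm (Pi ((dil E ^^ (2 * a)) f)) \<le> t * e ^ (2 * a)"
    and odd: "\<And>a. a \<in> tau_range E \<Longrightarrow> norm (Pi ((dil E ^^ (2 * a + 1)) f)) \<le> t * e ^ (2 * a + 1)"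
  shows "delocalized K f t"
proof -
  have ln0: "0 \<le> 10 * ln (real (m + n))" using mn by simp
  have "norm (Pi ((dil E ^^ k) f)) \<le> t * e ^ k" if "k < K" for k
  proof -
    have "k div 2 \<le> nat \<lfloor>10 * ln (real (m + n))\<rfloor>" using that by (simp add: K_def)
    then have "real (k div 2) \<le> 10 * ln (real (m + n))"
      using of_nat_floor[OF ln0] by (meson of_nat_le_iff order_trans)
    then have a: "k div 2 \<in> tau_range E" using E by (simp add: tau_range_def)
    show ?thesis
    proof (cases "even k")
      case True
      then show ?thesis using even[OF a] by simp
    next
      case False
      then have "2 * (k div 2) + 1 = k" by presburger
      then show ?thesis using odd[OF a] by metis
    qed
  qed
  moreover have "norm f * q ^ (K - 1) \<le> t"
  proof -
    let ?N = "real (m + n)"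
    have N: "1 \<le> ?N" using mn by simp
    \<comment> \<open>The remainder, at most \<open>1 / ?N\<close>, is compared with
      \<open>t\<close>, whose square is at least \<open>1 / ?N\<close> and therefore at least
      \<open>(1 / ?N)\<^sup>2\<close>.\<close>
    have "(1 / ?N) * (1 / ?N) \<le> 1 * (1 / ?N)" using N by (intro mult_right_mono) simp_all
    then have "(1 / ?N)\<^sup>2 \<le> 1 / ?N" by (simp only: power2_eq_square mult_1)
    also have "\<dots> \<le> t\<^sup>2" using t(2) N by (simp add: field_simps)
    finally have "1 / ?N \<le> t" using t(1) by (rule power2_le_imp_le)
    then show ?thesis using q_power_le f by simp
  qed
  ultimately show ?thesis unfolding delocalized_def using t by (simp add: K_def)
qed

text \<open>Admits arbitrary test vectors at the price of their norm. The row-norm bound uses it on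
  one side, and therefore carries only a single factor \<open>tau2\<close>.\<close>

lemma delocalized_trivial: "delocalized K f (norm f)"
proof -
  have "norm (Pi ((dil E ^^ k) f)) \<le> norm f * e ^ k" for k
    using norm_proj_le[OF on_p, of "(dil E ^^ k) f"] norm_W_power[of k f] by (simp add: mult.commute)
  moreover have "norm f * q ^ (K - 1) \<le> norm f * 1"
    using q_nonneg q_le by (intro mult_left_mono power_le_one) auto
  ultimately show ?thesis unfolding delocalized_def by (simp add: K_def)
qed

text \<open>By symmetry the powers move onto the singular directions, where the two signs contribute
  half of each squared entry; this is how row norms enter.\<close>

lemma norm_Pi_row:
  assumes N: "N \<in> carrier_mat n' r" "c < n'"
    and h: "\<And>i b. i < r \<Longrightarrow> inner ((dil E ^^ k) (p (i, b))) f = s' b / sqrt 2 * N $$ (c, i)"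
    and s': "\<And>b. \<bar>s' b\<bar> = (1::real)"
  shows "norm (Pi ((dil E ^^ k) f)) = vec_norm2 (row N c)"
proof -
  have s2: "(s' b)\<^sup>2 = 1" for b using s'[of b] by (metis abs_1 one_power2 power2_abs)
  have "(norm (Pi ((dil E ^^ k) f)))\<^sup>2 = (\<Sum>l\<in>J. (inner (p l) ((dil E ^^ k) f))\<^sup>2)"
    by (simp add: norm_proj[OF on_p] L2_set_def sum_nonneg)
  also have "\<dots> = (\<Sum>i<r. (N $$ (c, i))\<^sup>2)"
    unfolding sum_Times_bool power_sym[OF dil_sym, symmetric]
    by (intro sum.cong refl) (simp add: h power_mult_distrib power_divide s2)
  also have "\<dots> = (vec_norm2 (row N c))\<^sup>2" using N by (simp add: vec_norm2_power2)
  finally show ?thesis by simp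
qed

lemma finite_tau_range: "finite (tau_range E)"
proof (rule finite_subset)
  show "tau_range E \<subseteq> {..nat \<lfloor>10 * ln (real (m + n))\<rfloor>}"
    using E by (auto simp: tau_range_def le_nat_floor)
qed simp

lemma zero_tau_range: "0 \<in> tau_range E"
  using E mn by (simp add: tau_range_def)

lemma tau_bound:
  fixes g h :: "nat \<Rightarrow> real"
  assumes a: "a \<in> tau_range E"
    and M: "M = Max ((\<lambda>a. 1 / sqrt (real r) * max (g a / e ^ (2 * a)) (h a / e ^ (2 * a + 1))) ` tau_range E)"
  shows "g a \<le> sqrt (real r) * M * e ^ (2 * a)" and "h a \<le> sqrt (real r) * M * e ^ (2 * a + 1)"
proof -
  have sr: "0 < sqrt (real r)" using r_pos by simp
  have ep: "0 < e ^ k" for k using e_pos by simp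
  have "1 / sqrt (real r) * max (g a / e ^ (2 * a)) (h a / e ^ (2 * a + 1)) \<le> M"
    unfolding M using a finite_tau_range by (intro Max_ge) auto
  then have "max (g a / e ^ (2 * a)) (h a / e ^ (2 * a + 1)) \<le> sqrt (real r) * M"
    using sr by (simp add: field_simps)
  then have "g a / e ^ (2 * a) \<le> sqrt (real r) * M" "h a / e ^ (2 * a + 1) \<le> sqrt (real r) * M" by auto
  then show "g a \<le> sqrt (real r) * M * e ^ (2 * a)" "h a \<le> sqrt (real r) * M * e ^ (2 * a + 1)"
    using ep by (simp_all only: pos_divide_le_eq)
qed

abbreviation t1 :: real where "t1 \<equiv> sqrt (real r) * tau1 E U V"
abbreviation t2 :: real where "t2 \<equiv> sqrt (real r) * tau2 E U V"

lemma tau1_bound: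
  assumes "a \<in> tau_range E"
  shows "two_inf_norm ((E * transpose_mat E) ^\<^sub>m a * U) \<le> t1 * e ^ (2 * a)"
    and "two_inf_norm ((E * transpose_mat E) ^\<^sub>m a * E * V) \<le> t1 * e ^ (2 * a + 1)"
  using U tau_bound[OF assms, of "tau1 E U V" "\<lambda>a. two_inf_norm ((E * transpose_mat E) ^\<^sub>m a * U)"
      "\<lambda>a. two_inf_norm ((E * transpose_mat E) ^\<^sub>m a * E * V)"]
  by (auto simp: tau1_def)

lemma tau2_bound:
  assumes "a \<in> tau_range E"
  shows "two_inf_norm ((transpose_mat E * E) ^\<^sub>m a * V) \<le> t2 * e ^ (2 * a)"
    and "two_inf_norm ((transpose_mat E * E) ^\<^sub>m a * transpose_mat E * U) \<le> t2 * e ^ (2 * a + 1)"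
  using V tau_bound[OF assms, of "tau2 E U V" "\<lambda>a. two_inf_norm ((transpose_mat E * E) ^\<^sub>m a * V)"
      "\<lambda>a. two_inf_norm ((transpose_mat E * E) ^\<^sub>m a * transpose_mat E * U)"]
  by (auto simp: tau2_def)

lemma t1_ge: "0 \<le> t1" "1 \<le> real (m + n) * t1\<^sup>2"
proof -
  \<comment> \<open>The term \<open>a = 0\<close> of the maximum.\<close>
  have "two_inf_norm U \<le> t1" using tau1_bound(1)[OF zero_tau_range] U E by simp
  moreover have "0 \<le> two_inf_norm U" using U mn by (intro two_inf_norm_nonneg) auto
  ultimately have "real m * (two_inf_norm U)\<^sup>2 \<le> real (m + n) * t1\<^sup>2" and "0 \<le> t1"
    by (auto intro!: mult_mono power_mono)
  then show "0 \<le> t1" "1 \<le> real (m + n) * t1\<^sup>2"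
    using two_inf_norm_orthonormal_ge[OF U] r_pos by simp_all
qed

lemma t2_ge: "0 \<le> t2" "1 \<le> real (m + n) * t2\<^sup>2"
proof -
  have "two_inf_norm V \<le> t2" using tau2_bound(1)[OF zero_tau_range] V E by simp
  moreover have "0 \<le> two_inf_norm V" using V mn by (intro two_inf_norm_nonneg) auto
  ultimately have "real n * (two_inf_norm V)\<^sup>2 \<le> real (m + n) * t2\<^sup>2" and "0 \<le> t2"
    by (auto intro!: mult_mono power_mono)
  then show "0 \<le> t2" "1 \<le> real (m + n) * t2\<^sup>2"
    using two_inf_norm_orthonormal_ge[OF V] r_pos by simp_all
qed

lemma Et: "transpose_mat E \<in> carrier_mat n m" using E by simp

lemma powers [simp]: "(E * transpose_mat E) ^\<^sub>m a \<in> carrier_mat m m" "(transpose_mat E * E) ^\<^sub>m a \<in> carrier_mat n n"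
  using E by auto

lemma delocalized_fst:
  assumes c: "c < m"
  shows "delocalized K (emb (unit_vec m c), 0) t1"
proof (rule delocalizedI[OF _ t1_ge])
  show "norm (emb (unit_vec m c), 0 :: fseq) = 1"
    using c by (simp add: norm_prod_def norm_emb vec_norm2_def)
  fix a assume a: "a \<in> tau_range E"
  let ?P = "(E * transpose_mat E) ^\<^sub>m a"
  have N: "?P * U \<in> carrier_mat m r" "?P * E * V \<in> carrier_mat m r"
    using powers(1) U(1) V(1) E by (auto intro!: mult_carrier_mat)
  have "norm (Pi ((dil E ^^ (2 * a)) (emb (unit_vec m c), 0))) = vec_norm2 (row (?P * U) c)"
  proof (rule norm_Pi_row[OF N(1) c, where s' = "\<lambda>_. 1"])
    fix i b assume i: "i < r"
    have "(?P * U) $$ (c, i) = (?P *\<^sub>v col U i) $ c"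
      using i c N(1) col_mult2[OF powers(1) U(1) i] by (metis carrier_matD index_col)
    then show "inner ((dil E ^^ (2 * a)) (p (i, b))) (emb (unit_vec m c), 0) = 1 / sqrt 2 * (?P * U) $$ (c, i)"
      using c by (simp add: svec_def dil_power_even[OF E] inner_prod_def inner_emb_unit mult_mat_vec_carrier[OF powers(1)])
  qed simp
  also have "\<dots> \<le> two_inf_norm (?P * U)" using c N(1) by (intro two_inf_norm_ge) auto
  finally show "norm (Pi ((dil E ^^ (2 * a)) (emb (unit_vec m c), 0))) \<le> t1 * e ^ (2 * a)"
    using tau1_bound(1)[OF a] by linarith
  have "norm (Pi ((dil E ^^ (2 * a + 1)) (emb (unit_vec m c), 0))) = vec_norm2 (row (?P * E * V) c)"
  \<comment> \<open>An odd power moves the signed second component of a singular direction into the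
    first one.\<close>
  proof (rule norm_Pi_row[OF N(2) c, where s' = sg])
    fix i b assume i: "i < r"
    have "col (?P * E * V) i = ?P *\<^sub>v (E *\<^sub>v col V i)"
      using col_mult2[OF mult_carrier_mat[OF powers(1) E] V(1) i] assoc_mult_mat_vec[OF powers(1) E cols(2)] by simp
    then have "(?P * E * V) $$ (c, i) = (?P *\<^sub>v (E *\<^sub>v col V i)) $ c"
      using i c N(2) by (metis carrier_matD index_col)
    then show "inner ((dil E ^^ (2 * a + 1)) (p (i, b))) (emb (unit_vec m c), 0) = sg b / sqrt 2 * (?P * E * V) $$ (c, i)"
      using c by (simp add: svec_def dil_power_odd[OF E] inner_prod_def inner_emb_unit mult_mat_vec_carrier[OF powers(1)]
          del: funpow.simps One_nat_def)
  qed (rule abs_sg)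
  also have "\<dots> \<le> two_inf_norm (?P * E * V)" using c N(2) by (intro two_inf_norm_ge) auto
  finally show "norm (Pi ((dil E ^^ (2 * a + 1)) (emb (unit_vec m c), 0))) \<le> t1 * e ^ (2 * a + 1)"
    using tau1_bound(2)[OF a] by linarith
qed

lemma delocalized_snd:
  assumes c: "c < n"
  shows "delocalized K (0, emb (unit_vec n c)) t2"
proof (rule delocalizedI[OF _ t2_ge])
  show "norm (0 :: fseq, emb (unit_vec n c)) = 1"
    using c by (simp add: norm_prod_def norm_emb vec_norm2_def)
  fix a assume a: "a \<in> tau_range E"
  let ?P = "(transpose_mat E * E) ^\<^sub>m a"
  have N: "?P * V \<in> carrier_mat n r" "?P * transpose_mat E * U \<in> carrier_mat n r"
    using powers(2) U(1) V(1) Et by (auto intro!: mult_carrier_mat)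
  have "norm (Pi ((dil E ^^ (2 * a)) (0, emb (unit_vec n c)))) = vec_norm2 (row (?P * V) c)"
  proof (rule norm_Pi_row[OF N(1) c, where s' = sg])
    fix i b assume i: "i < r"
    have "(?P * V) $$ (c, i) = (?P *\<^sub>v col V i) $ c"
      using i c N(1) col_mult2[OF powers(2) V(1) i] by (metis carrier_matD index_col)
    then show "inner ((dil E ^^ (2 * a)) (p (i, b))) (0, emb (unit_vec n c)) = sg b / sqrt 2 * (?P * V) $$ (c, i)"
      using c by (simp add: svec_def dil_power_even[OF E] inner_prod_def inner_emb_unit mult_mat_vec_carrier[OF powers(2)])
  qed (rule abs_sg)
  also have "\<dots> \<le> two_inf_norm (?P * V)" using c N(1) by (intro two_inf_norm_ge) auto
  finally show "norm (Pi ((dil E ^^ (2 * a)) (0, emb (unit_vec n c)))) \<le> t2 * e ^ (2 * a)"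
    using tau2_bound(1)[OF a] by linarith
  have "norm (Pi ((dil E ^^ (2 * a + 1)) (0, emb (unit_vec n c)))) = vec_norm2 (row (?P * transpose_mat E * U) c)"
  proof (rule norm_Pi_row[OF N(2) c, where s' = "\<lambda>_. 1"])
    fix i b assume i: "i < r"
    have "col (?P * transpose_mat E * U) i = ?P *\<^sub>v (transpose_mat E *\<^sub>v col U i)"
      using col_mult2[OF mult_carrier_mat[OF powers(2) Et] U(1) i] assoc_mult_mat_vec[OF powers(2) Et cols(1)] by simp
    then have "(?P * transpose_mat E * U) $$ (c, i) = (?P *\<^sub>v (transpose_mat E *\<^sub>v col U i)) $ c"
      using i c N(2) by (metis carrier_matD index_col)
    then show "inner ((dil E ^^ (2 * a + 1)) (p (i, b))) (0, emb (unit_vec n c)) = 1 / sqrt 2 * (?P * transpose_mat E * U) $$ (c, i)"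
      using c by (simp add: svec_def dil_power_odd[OF E] inner_prod_def inner_emb_unit mult_mat_vec_carrier[OF powers(2)]
          del: funpow.simps One_nat_def)
  qed simp
  also have "\<dots> \<le> two_inf_norm (?P * transpose_mat E * U)" using c N(2) by (intro two_inf_norm_ge) auto
  finally show "norm (Pi ((dil E ^^ (2 * a + 1)) (0, emb (unit_vec n c)))) \<le> t2 * e ^ (2 * a + 1)"
    using tau2_bound(2)[OF a] by linarith
qed

section \<open>The three perturbation bounds\<close>

abbreviation D :: "real mat" where
  "D \<equiv> select_cols V' S * transpose_mat (select_cols V' S) - select_cols V S * transpose_mat (select_cols V S)"

lemma D_dim: "dim_row D = n" "dim_col D = n"
  using V V' by (simp_all add: dim_row_select_cols)

lemma S_min: "S \<subseteq> {..<min m n}" using S_lt r_le by force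

lemma D_entry:
  assumes "a < n" "b < n"
  shows "D $$ (a, b) = (\<Sum>i\<in>S. V' $$ (a, i) * V' $$ (b, i)) - (\<Sum>i\<in>S. V $$ (a, i) * V $$ (b, i))"
proof -
  have "a < dim_row (select_cols V S * transpose_mat (select_cols V S))"
    "b < dim_col (select_cols V S * transpose_mat (select_cols V S))"
    using assms V by (simp_all add: dim_row_select_cols)
  then show ?thesis
    by (simp only: index_minus_mat(1) select_cols_gram[OF V'(1) S_min assms] select_cols_gram[OF V(1) S_r assms])
qed

lemma D_inner:
  assumes a: "a < n" and w: "w \<in> carrier_vec n"
  shows "inner (0, emb (unit_vec n a)) (T0 (0, emb w)) - inner (0, emb (unit_vec n a)) (PI (0, emb w)) = row D a \<bullet> w"
proof -
  have "row D a \<bullet> w = (\<Sum>b<n. D $$ (a, b) * w $ b)"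
    using a w D_dim by (auto simp: scalar_prod_def lessThan_atLeast0 intro!: sum.cong)
  also have "\<dots> = (\<Sum>b<n. (\<Sum>i\<in>S. V' $$ (a, i) * V' $$ (b, i)) * w $ b - (\<Sum>i\<in>S. V $$ (a, i) * V $$ (b, i)) * w $ b)"
    using a by (intro sum.cong refl) (simp only: D_entry lessThan_iff left_diff_distrib)
  finally show ?thesis
    unfolding projection_svec_entry[OF V'(1) S_min a w] projection_svec_entry[OF V(1) S_r a w]
    by (simp add: sum_subtractf)
qed

lemma max_norm_D: "max_norm D \<le> 30 * (tau2 E U V)\<^sup>2 * real r * \<epsilon>"
proof (rule max_norm_le)
  fix a b assume "a < dim_row D" "b < dim_col D"
  then have ab: "a < n" "b < n" by (simp_all only: D_dim)
  have "row D a \<bullet> unit_vec n b = D $$ (a, b)" using ab D_dim by simp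
  then have "\<bar>D $$ (a, b)\<bar> \<le> 30 * \<epsilon> * t2 * t2"
    using projection_entry_bound_\<epsilon>[OF delocalized_snd[OF ab(1)] delocalized_snd[OF ab(2)]]
      D_inner[OF ab(1) unit_vec_carrier[of n b]] by simp
  also have "\<dots> = 30 * (tau2 E U V)\<^sup>2 * (sqrt (real r) * sqrt (real r)) * \<epsilon>"
    by (simp only: power2_eq_square mult_ac)
  finally show "\<bar>D $$ (a, b)\<bar> \<le> 30 * (tau2 E U V)\<^sup>2 * real r * \<epsilon>" by simp
qed (use mn D_dim in simp_all)

text \<open>Each row of \<open>D\<close> is tested against itself: its squared norm is at most a
  constant times its norm, and one factor cancels.\<close>

lemma two_inf_norm_D: "two_inf_norm D \<le> 30 * tau2 E U V * real r * \<epsilon>"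
proof (rule two_inf_norm_le)
  fix a assume "a < dim_row D"
  then have a: "a < n" by (simp only: D_dim)
  let ?w = "row D a"
  have w: "?w \<in> carrier_vec n" using D_dim by (metis row_carrier)
  have nw: "norm (0 :: fseq, emb ?w) = vec_norm2 ?w" by (simp add: norm_prod_def norm_emb)
  have "vec_norm2 ?w * vec_norm2 ?w = ?w \<bullet> ?w"
    by (metis abs_of_nonneg power2_eq_square real_sqrt_abs real_sqrt_pow2_iff vec_norm2_def vec_norm2_nonneg
        inner_emb inner_ge_zero real_sqrt_ge_0_iff)
  also have "\<dots> \<le> 30 * \<epsilon> * t2 * vec_norm2 ?w"
    using projection_entry_bound_\<epsilon>[OF delocalized_snd[OF a] delocalized_trivial[of "(0, emb ?w)"]]
    unfolding D_inner[OF a w] nw by simp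
  finally have le: "vec_norm2 ?w * vec_norm2 ?w \<le> 30 * \<epsilon> * t2 * vec_norm2 ?w" .
  have pos: "0 \<le> 30 * \<epsilon> * t2" using \<epsilon>_nonneg t2_ge(1) by simp
  have "vec_norm2 ?w \<le> 30 * \<epsilon> * t2"
  proof (cases "vec_norm2 ?w = 0")
    case False
    then have "0 < vec_norm2 ?w" by (simp add: order_less_le)
    with le show ?thesis by (rule mult_right_le_imp_le)
  qed (use pos in simp)
  \<comment> \<open>The argument gives \<open>sqrt r\<close>; weakening it to \<open>r\<close>
    produces the stated form.\<close>
  also have "t2 \<le> real r * tau2 E U V"
  proof -
    have "0 \<le> tau2 E U V" using t2_ge(1) r_pos by (simp add: zero_le_mult_iff)
    moreover have "sqrt (real r) \<le> real r" using r_pos by (intro real_le_lsqrt) (auto simp: power2_eq_square)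
    ultimately show ?thesis by (intro mult_right_mono)
  qed
  then have "30 * \<epsilon> * t2 \<le> 30 * \<epsilon> * (real r * tau2 E U V)" using \<epsilon>_nonneg by (intro mult_left_mono) auto
  finally show "vec_norm2 ?w \<le> 30 * tau2 E U V * real r * \<epsilon>" by (simp add: mult_ac)
qed (use mn D_dim in simp)

lemma initial_segment:
  assumes S: "S = {..<s}" and s: "1 \<le> s"
  shows "\<sigma>S = \<sigma> (s - 1)" "\<Delta> = \<sigma> (s - 1) - \<sigma> s"
proof -
  have sr: "s \<le> r" "s - 1 < r" "s - 1 \<in> S" using S S_r s by (auto simp: subset_iff)
  \<comment> \<open>Monotonicity is extended to the index \<open>r\<close>, where
    \<open>\<sigma> r = 0\<close>, so that the case \<open>s = r\<close> is included.\<close>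
  have mono: "\<sigma> j \<le> \<sigma> i" if "i \<le> j" "j \<le> r" "i < r" for i j
    using that \<sigma>_mono[of i j] \<sigma>_pos[of i] \<sigma>_r by (cases "j = r") auto
  show "\<sigma>S = \<sigma> (s - 1)"
    unfolding sigma_S_def using fin_S sr S by (intro Min_eqI) (auto intro!: \<sigma>_mono)
  have "\<sigma> s \<le> \<sigma> (s - 1)" using mono[of "s - 1" s] sr by simp
  then have eq: "\<sigma> (s - 1) - \<sigma> s = \<bar>\<sigma> (s - 1) - \<sigma> s\<bar>" by simp
  show "\<Delta> = \<sigma> (s - 1) - \<sigma> s"
    unfolding Delta_S_def
  proof (rule Min_eqI[OF finite_gaps])
    show "\<sigma> (s - 1) - \<sigma> s \<in> {\<bar>\<sigma> i - \<sigma> j\<bar> |i j. i \<in> S \<and> j \<in> {..r} - S}"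
      using eq sr S by blast
    fix z assume "z \<in> {\<bar>\<sigma> i - \<sigma> j\<bar> |i j. i \<in> S \<and> j \<in> {..r} - S}"
    then obtain i j where ij: "z = \<bar>\<sigma> i - \<sigma> j\<bar>" "i < s" "s \<le> j" "j \<le> r" using S by auto
    have "\<sigma> (s - 1) \<le> \<sigma> i" "\<sigma> j \<le> \<sigma> s" using mono[of i "s - 1"] mono[of s j] ij sr \<sigma>_r
      by (auto, cases "s = r", auto)
    then show "\<sigma> (s - 1) - \<sigma> s \<le> z" using ij(1) by linarith
  qed
qed

text \<open>For an initial segment all unselected singular values are at most the last selected one,
  unperturbed as well as perturbed. This supplies the bounds \<open>m\<close> and \<open>b\<close>
  of \<open>operator_entry_bound\<close>.\<close>

lemma max_norm_truncation:
  assumes S: "S = {..<s}" and s: "1 \<le> s"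
  shows "max_norm (rank_one_sum s U' \<sigma>' V' - rank_one_sum s U \<sigma> V)
    \<le> 30 * tau1 E U V * tau2 E U V * \<sigma> (s - 1) * real r * \<epsilon>"
proof (rule max_norm_le)
  let ?D = "rank_one_sum s U' \<sigma>' V' - rank_one_sum s U \<sigma> V"
  let ?\<sigma> = "\<sigma> (s - 1)"
  have sS: "s - 1 \<in> S" using S s by simp
  have sr: "s - 1 < r" "s - 1 < min m n" using sS S_lt S_min by auto
  have \<sigma>S: "\<sigma>S = ?\<sigma>" by (rule initial_segment(1)[OF S s])
  have \<sigma>0: "0 < ?\<sigma>" using \<sigma>_pos sr by simp
  show "0 < dim_row ?D" "0 < dim_col ?D" using U V mn by (simp_all add: rank_one_sum_def)
  fix a b assume "a < dim_row ?D" "b < dim_col ?D"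
  then have ab: "a < m" "b < n" using U V by (simp_all add: rank_one_sum_def)
  have m: "\<bar>sval \<sigma> j\<bar> \<le> ?\<sigma>" if "j \<in> J - I" for j
    using that S sr \<sigma>_mono[of "s - 1" "fst j"] \<sigma>_pos[of "fst j"] by (cases j) (auto simp: sval_def abs_mult abs_sg)
  have b': "\<bar>sval \<sigma>' l\<bar> \<le> \<sigma>' (s - 1)" if "l \<in> L - I" for l
    using that S sr \<sigma>'_mono[of "s - 1" "fst l"] \<sigma>'_nonneg[of "fst l"] by (cases l) (auto simp: sval_def abs_mult abs_sg)
  have "?D $$ (a, b) = (\<Sum>i\<in>I. sval \<sigma>' i * inner (x i) (emb (unit_vec m a), 0) * inner (x i) (0, emb (unit_vec n b)))
      - (\<Sum>i\<in>I. sval \<sigma> i * inner (p i) (emb (unit_vec m a), 0) * inner (p i) (0, emb (unit_vec n b)))"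
    unfolding sval_svec_entry[OF U'(1) V'(1) S_min ab] sval_svec_entry[OF U(1) V(1) S_r ab]
    using ab U V U' V' by (simp add: rank_one_sum_def S)
  then have "\<bar>?D $$ (a, b)\<bar> \<le> (13 * e + leak * ?\<sigma> + \<sigma>' (s - 1) * \<kappa>) * t1 * t2"
    using operator_entry_bound[OF delocalized_fst[OF ab(1)] delocalized_snd[OF ab(2)] m _ b'] \<sigma>0 \<sigma>'_nonneg[OF sr(2)]
    by simp
  also have "\<dots> \<le> 30 * ?\<sigma> * \<epsilon> * t1 * t2"
  proof (intro mult_right_mono t1_ge(1) t2_ge(1))
    have "e \<le> \<epsilon> * ?\<sigma>" using \<epsilon>_ge \<sigma>0 by (simp add: \<sigma>S pos_divide_le_eq)
    moreover have "leak * ?\<sigma> \<le> 3 * \<epsilon> * ?\<sigma>" using leak_le \<sigma>0 by (intro mult_right_mono) auto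
    moreover have "\<sigma>' (s - 1) * \<kappa> \<le> (5 / 4 * ?\<sigma>) * (5 * \<epsilon>)"
    proof (intro mult_mono)
      show "\<sigma>' (s - 1) \<le> 5 / 4 * ?\<sigma>" using singular_value_close(1)[OF sS] \<Delta>_le_\<sigma>S \<sigma>S by linarith
      show "\<kappa> \<le> 5 * \<epsilon>" unfolding \<kappa>_def using leak_le q_eq \<epsilon>_ge \<epsilon>_nonneg by linarith
    qed (use \<sigma>0 \<kappa>_nonneg in auto)
    moreover have "0 \<le> \<epsilon> * ?\<sigma>" using \<epsilon>_nonneg \<sigma>0 by simp
    \<comment> \<open>The coefficients sum to \<open>13 + 3 + 25/4\<close>, below 30.\<close>
    ultimately show "13 * e + leak * ?\<sigma> + \<sigma>' (s - 1) * \<kappa> \<le> 30 * ?\<sigma> * \<epsilon>"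
      by (simp add: algebra_simps)
  qed
  also have "\<dots> = 30 * tau1 E U V * tau2 E U V * ?\<sigma> * (sqrt (real r) * sqrt (real r)) * \<epsilon>"
    by (simp only: mult_ac)
  finally show "\<bar>?D $$ (a, b)\<bar> \<le> 30 * tau1 E U V * tau2 E U V * ?\<sigma> * real r * \<epsilon>" by simp
qed

end

theorem theorem3p2:
  shows "\<exists>C::real. \<forall>(m::nat) (n::nat) (r::nat) (A::real mat) (E::real mat)
      (U::real mat) (V::real mat) (\<sigma>::nat \<Rightarrow> real)
      (U'::real mat) (V'::real mat) (\<sigma>'::nat \<Rightarrow> real) (S::nat set).
    A \<in> carrier_mat m n \<and> vec_space.rank m A = r \<and>
    is_svd A r U \<sigma> V \<and> (\<forall>i<r. 0 < \<sigma> i) \<and> \<sigma> r = 0 \<and>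
    E \<in> carrier_mat m n \<and> E \<noteq> 0\<^sub>m m n \<and>
    is_svd (A + E) (min m n) U' \<sigma>' V' \<and>
    S \<subseteq> {..<r} \<and> S \<noteq> {} \<and>
    0 < Delta_S r \<sigma> S \<and>
    max (spectral_norm E / sigma_S \<sigma> S)
      (max (2 * real r * max_norm (transpose_mat U * E * V) / Delta_S r \<sigma> S)
           (sqrt (2 * real r) * spectral_norm E / sqrt (Delta_S r \<sigma> S * sigma_S \<sigma> S))) \<le> 1 / 8
    \<longrightarrow>
    max_norm (select_cols V' S * transpose_mat (select_cols V' S)
              - select_cols V S * transpose_mat (select_cols V S))
      \<le> C * (tau2 E U V)\<^sup>2 * real r *
          (spectral_norm E / sigma_S \<sigma> S
           + 2 * real r * max_norm (transpose_mat U * E * V) / Delta_S r \<sigma> S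
           + 2 * real r * y_param E U V / (Delta_S r \<sigma> S * sigma_S \<sigma> S))
    \<and>
    two_inf_norm (select_cols V' S * transpose_mat (select_cols V' S)
                  - select_cols V S * transpose_mat (select_cols V S))
      \<le> C * tau2 E U V * real r *
          (spectral_norm E / sigma_S \<sigma> S
           + 2 * real r * max_norm (transpose_mat U * E * V) / Delta_S r \<sigma> S
           + 2 * real r * y_param E U V / (Delta_S r \<sigma> S * sigma_S \<sigma> S))
    \<and>
    (\<forall>s\<in>{1..r}. S = {..<s} \<longrightarrow>
      (let \<sigma>\<^sub>s = \<sigma> (s - 1); \<delta>\<^sub>s = \<sigma> (s - 1) - \<sigma> s in
       max_norm (rank_one_sum s U' \<sigma>' V' - rank_one_sum s U \<sigma> V)
         \<le> C * tau1 E U V * tau2 E U V * \<sigma>\<^sub>s * real r *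
             (spectral_norm E / \<sigma>\<^sub>s
              + 2 * real r * max_norm (transpose_mat U * E * V) / \<delta>\<^sub>s
              + 2 * real r * y_param E U V / (\<delta>\<^sub>s * \<sigma>\<^sub>s))))"
proof (intro exI[of _ 30] allI impI)
  fix m n r :: nat and A E U V :: "real mat" and \<sigma> :: "nat \<Rightarrow> real"
    and U' V' :: "real mat" and \<sigma>' :: "nat \<Rightarrow> real" and S :: "nat set"
  assume "A \<in> carrier_mat m n \<and> vec_space.rank m A = r \<and>
    is_svd A r U \<sigma> V \<and> (\<forall>i<r. 0 < \<sigma> i) \<and> \<sigma> r = 0 \<and>
    E \<in> carrier_mat m n \<and> E \<noteq> 0\<^sub>m m n \<and>
    is_svd (A + E) (min m n) U' \<sigma>' V' \<and>
    S \<subseteq> {..<r} \<and> S \<noteq> {} \<and>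
    0 < Delta_S r \<sigma> S \<and>
    max (spectral_norm E / sigma_S \<sigma> S)
      (max (2 * real r * max_norm (transpose_mat U * E * V) / Delta_S r \<sigma> S)
           (sqrt (2 * real r) * spectral_norm E / sqrt (Delta_S r \<sigma> S * sigma_S \<sigma> S))) \<le> 1 / 8"
  then interpret svd_perturbation m n r A E U V U' V' \<sigma> \<sigma>' S
    by unfold_locales (auto simp only: max.bounded_iff)
  show "max_norm D \<le> 30 * (tau2 E U V)\<^sup>2 * real r * (e / \<sigma>S + 2 * real r * \<xi> / \<Delta> + 2 * real r * y / (\<Delta> * \<sigma>S))
    \<and> two_inf_norm D \<le> 30 * tau2 E U V * real r * (e / \<sigma>S + 2 * real r * \<xi> / \<Delta> + 2 * real r * y / (\<Delta> * \<sigma>S))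
    \<and> (\<forall>s\<in>{1..r}. S = {..<s} \<longrightarrow>
      (let \<sigma>\<^sub>s = \<sigma> (s - 1); \<delta>\<^sub>s = \<sigma> (s - 1) - \<sigma> s in
       max_norm (rank_one_sum s U' \<sigma>' V' - rank_one_sum s U \<sigma> V)
         \<le> 30 * tau1 E U V * tau2 E U V * \<sigma>\<^sub>s * real r *
             (e / \<sigma>\<^sub>s + 2 * real r * \<xi> / \<delta>\<^sub>s + 2 * real r * y / (\<delta>\<^sub>s * \<sigma>\<^sub>s))))"
    \<comment> \<open>All three brackets are \<epsilon>: for an initial segment
      \<open>initial_segment\<close> identifies \<sigma>S and \<Delta> with the last selected
      singular value and the gap below it.\<close>
    unfolding \<epsilon>_def[symmetric] Let_def
    by (intro conjI ballI impI max_norm_D two_inf_norm_D)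
      (metis max_norm_truncation initial_segment \<epsilon>_def atLeastAtMost_iff)
qed

end
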